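(* Let $q$ be a prime power and let $m \le n$ be positive integers. The number of orbits of $\mathrm{GU}_m(q) \times \mathrm{GU}_n(q)$ on $M_{m\times n}(q^2)$ is $$\sum_{i=0}^m f(m-i, n-i)\, k(\mathrm{GL}_i(q)).$$
   Context: $M_{m\times n}(q^2)$ is the set of $m \times n$ matrices over $\mathbb{F}_{q^2}$. For a matrix $A$ over $\mathbb{F}_{q^2}$, $A^*$ is the transpose of the matrix obtained by raising all entries to the $q$-th power, and $\mathrm{GU}_n(q) = \{X \in \mathrm{GL}_n(\mathbb{F}_{q^2}) : XX^*=I\}$. The group $\mathrm{GU}_m(q) \times \mathrm{GU}_n(q)$ acts on $M_{m \times n}(q^2)$ by $(X,Y): A \mapsto XAY^{*}$. For a finite group $G$, $k(G)$ is the number of conjugacy classes of $G$. The number $f(a,b)$ is the number of orbits of $\mathrm{GU}_a(q) \times \mathrm{GU}_b(q)$ on the set of matrices $A \in M_{a\times b}(q^2)$ such that $A^*A$ is nilpotent (this number does not depend on $q$). Conventions: $k(\mathrm{GL}_0(q)) = 1$ and $f(0,b) = 1$ for all $b \ge 0$. *)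

theory Defs
  imports
    "HOL-Library.Cardinality"
    "HOL-Algebra.Group_Action"
    "HOL-Number_Theory.Prime_Powers"
    "HOL-Number_Theory.Residues"
    "Jordan_Normal_Form.Determinant"
begin

definition GL :: "'a::field itself \<Rightarrow> nat \<Rightarrow> 'a mat monoid" where
  "GL T n = units_of (ring_mat T n ())"

definition conj_trans :: "nat \<Rightarrow> 'a::field mat \<Rightarrow> 'a mat" where
  "conj_trans q A = transpose_mat (map_mat (\<lambda>x. x ^ q) A)"

text \<open>\<open>GU T q n\<close> is the group \<open>GU\<^sub>n(q)\<close>, where \<open>T\<close> is a field with \<open>q\<^sup>2\<close> elements.\<close>

definition GU :: "'a::field itself \<Rightarrow> nat \<Rightarrow> nat \<Rightarrow> 'a mat monoid" where
  "GU T q n = (GL T n)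
     \<lparr>carrier := {X \<in> carrier (GL T n). X * conj_trans q X = 1\<^sub>m n}\<rparr>"

text \<open>The action \<open>(X, Y) : A \<mapsto> X A Y\<^sup>*\<close> on an invariant set \<open>E\<close> of matrices.  It is
  restricted to \<open>E\<close> because \<^const>\<open>BijGroup\<close> consists of extensional functions.\<close>

definition GU_act :: "nat \<Rightarrow> 'a::field mat set \<Rightarrow> 'a mat \<times> 'a mat \<Rightarrow> 'a mat \<Rightarrow> 'a mat" where
  "GU_act q E = (\<lambda>(X, Y). \<lambda>A\<in>E. X * A * conj_trans q Y)"

definition num_conj_classes :: "('a, 'b) monoid_scheme \<Rightarrow> nat" where
  "num_conj_classes G = card (orbits G (carrier G)
     (\<lambda>g. \<lambda>h\<in>carrier G. g \<otimes>\<^bsub>G\<^esub> h \<otimes>\<^bsub>G\<^esub> inv\<^bsub>G\<^esub> g))"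

definition nilpotent_mat :: "'a::semiring_1 mat \<Rightarrow> bool" where
  "nilpotent_mat N \<longleftrightarrow> square_mat N \<and> (\<exists>k. N ^\<^sub>m k = 0\<^sub>m (dim_row N) (dim_row N))"

definition nil_mats :: "'a::field itself \<Rightarrow> nat \<Rightarrow> nat \<Rightarrow> nat \<Rightarrow> 'a mat set" where
  "nil_mats T q a b = {A \<in> carrier_mat a b. nilpotent_mat (conj_trans q A * A)}"

text \<open>The number \<open>f(a, b)\<close>, counted over the field \<open>T\<close> with \<open>q\<^sup>2\<close> elements.  No case
  distinction is needed for \<open>f(0, b) = 1\<close> and \<open>k(GL\<^sub>0(q)) = 1\<close>: see \<open>f_orbits_0\<close> and
  \<open>num_conj_classes_GL_0\<close> below.\<close>

definition f_orbits :: "'a::field itself \<Rightarrow> nat \<Rightarrow> nat \<Rightarrow> nat \<Rightarrow> nat" where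
  "f_orbits T q a b =
     card (orbits (GU T q a \<times>\<times> GU T q b) (nil_mats T q a b) (GU_act q (nil_mats T q a b)))"


subsection \<open>Basic facts\<close>

lemma carrier_GL: "carrier (GL TYPE('a::field) n) =
    {X \<in> carrier_mat n n. \<exists>Y\<in>carrier_mat n n. Y * X = 1\<^sub>m n \<and> X * Y = 1\<^sub>m n}"
  by (auto simp: GL_def units_of_def Units_def ring_mat_simps)

lemma GL_simps [simp]: "monoid.mult (GL T n) = (*)" "one (GL T n) = 1\<^sub>m n"
  by (simp_all add: GL_def units_of_def ring_mat_simps)

lemma group_GL: "group (GL TYPE('a::field) n)"
proof -
  interpret ring "ring_mat TYPE('a) n ()" by (rule ring_mat)
  show ?thesis unfolding GL_def by (rule units_group)
qed

lemma conj_trans_carrier [simp, intro]: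
  "A \<in> carrier_mat m n \<Longrightarrow> conj_trans q A \<in> carrier_mat n m"
  by (auto simp: conj_trans_def)

lemma group_actionI:
  assumes G: "group G"
    and ext: "\<And>g. g \<in> carrier G \<Longrightarrow> \<phi> g \<in> extensional E"
    and cl: "\<And>g x. g \<in> carrier G \<Longrightarrow> x \<in> E \<Longrightarrow> \<phi> g x \<in> E"
    and one: "\<And>x. x \<in> E \<Longrightarrow> \<phi> \<one>\<^bsub>G\<^esub> x = x"
    and mult: "\<And>g h x. g \<in> carrier G \<Longrightarrow> h \<in> carrier G \<Longrightarrow> x \<in> E \<Longrightarrow>
                 \<phi> (g \<otimes>\<^bsub>G\<^esub> h) x = \<phi> g (\<phi> h x)"
  shows "group_action G E \<phi>"
proof -
  interpret group G by fact
  have inv: "\<phi> (inv\<^bsub>G\<^esub> g) (\<phi> g x) = x" "\<phi> g (\<phi> (inv\<^bsub>G\<^esub> g) x) = x"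
    if "g \<in> carrier G" "x \<in> E" for g x
    using that by (simp_all add: mult[symmetric] one)
  have bij: "\<phi> g \<in> Bij E" if g: "g \<in> carrier G" for g
  proof -
    have "bij_betw (\<phi> g) E E"
      using g by (intro bij_betwI[where g = "\<phi> (inv\<^bsub>G\<^esub> g)"]) (auto simp: inv cl)
    then show ?thesis using ext[OF g] by (simp add: Bij_def)
  qed
  have "\<phi> (g \<otimes>\<^bsub>G\<^esub> h) = compose E (\<phi> g) (\<phi> h)" if "g \<in> carrier G" "h \<in> carrier G" for g h
    using that
    by (intro extensionalityI[where A = E]) (auto simp: ext mult compose_def)
  then have "\<phi> \<in> hom G (BijGroup E)"
    by (auto simp: hom_def BijGroup_def bij)
  then show ?thesis
    unfolding group_action_def group_hom_def group_hom_axioms_def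
    using G group_BijGroup by blast
qed

lemma conjugation_action:
  assumes "group G"
  shows "group_action G (carrier G) (\<lambda>g. \<lambda>h\<in>carrier G. g \<otimes>\<^bsub>G\<^esub> h \<otimes>\<^bsub>G\<^esub> inv\<^bsub>G\<^esub> g)"
proof -
  interpret group G by fact
  show ?thesis
    by (rule group_actionI) (auto simp: assms m_assoc inv_mult_group)
qed

lemma num_conj_classes_GL_0: "num_conj_classes (GL TYPE('a::field) 0) = 1"
proof -
  let ?G = "GL TYPE('a) 0"
  interpret group ?G by (rule group_GL)
  interpret group_action ?G "carrier ?G"
      "\<lambda>g. \<lambda>h\<in>carrier ?G. g \<otimes>\<^bsub>?G\<^esub> h \<otimes>\<^bsub>?G\<^esub> inv\<^bsub>?G\<^esub> g"
    by (rule conjugation_action) (rule group_GL)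
  have c: "carrier ?G = {1\<^sub>m 0}"
    using one_closed by (auto simp: carrier_GL intro!: eq_matI)
  have "1\<^sub>m 0 * 1\<^sub>m 0 * inv\<^bsub>?G\<^esub> (1\<^sub>m 0) = (1\<^sub>m 0 :: 'a mat)"
    using inv_one by simp
  then have "orbits ?G (carrier ?G)
      (\<lambda>g. \<lambda>h\<in>carrier ?G. g \<otimes>\<^bsub>?G\<^esub> h \<otimes>\<^bsub>?G\<^esub> inv\<^bsub>?G\<^esub> g) = {{1\<^sub>m 0}}"
    by (simp add: c orbits_def orbit_def)
  then show ?thesis by (simp add: num_conj_classes_def)
qed

context
  fixes q :: nat
  assumes q: "primepow q" "CARD('a::{field,finite}) = q\<^sup>2"
begin

lemma q_power_add: "(x + y :: 'a) ^ q = x ^ q + y ^ q"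
proof -
  from q(1) obtain p k where p: "prime p" "q = p ^ k"
    by (auto simp: primepow_def)
  have pr: "prime (CHAR('a))"
    using prime_CHAR_semidom[where ?'a = 'a] finite_imp_CHAR_pos[where ?'a = 'a] by simp
  have "CHAR('a) dvd p ^ (k * 2)"
    using CHAR_dvd_CARD[where ?'a = 'a] by (simp add: q(2) p(2) power_mult)
  then have "CHAR('a) = p"
    using pr p(1) prime_dvd_power primes_dvd_imp_eq by blast
  then show ?thesis
    using freshmans_dream'[of q k x y] pr p(2) by simp
qed

lemma q_pos: "q > 0"
  using primepow_gt_Suc_0[OF q(1)] by simp

lemma q_power_sum: "(\<Sum>i\<in>I. g i :: 'a) ^ q = (\<Sum>i\<in>I. g i ^ q)"
  by (induction I rule: infinite_finite_induct) (use q_pos in \<open>auto simp: q_power_add\<close>)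

lemma q_power_power: "((x :: 'a) ^ q) ^ q = x"
proof (cases "x = 0")
  case False
  let ?U = "UNIV - {0 :: 'a}"
  have "bij_betw ((*) x) ?U ?U"
    using False by (intro bij_betwI[where g = "\<lambda>y. y / x"]) auto
  then have "\<Prod>?U = (\<Prod>y\<in>?U. x * y)"
    by (simp only: prod.reindex_bij_betw[where g = "\<lambda>y. y"])
  also have "\<dots> = x ^ card ?U * \<Prod>?U"
    by (simp add: prod.distrib)
  finally have 1: "x ^ card ?U = 1" by simp
  have "card ?U = q * q - 1"
    using q(2) by (simp add: power2_eq_square)
  moreover have "q * q > 0"
    using q_pos by simp
  ultimately have "q * q = Suc (card ?U)"
    by linarith
  then have "x ^ (q * q) = x" by (simp only: power_Suc 1 mult_1_right)
  then show ?thesis by (simp add: power_mult)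
qed (use q_pos in simp)

lemma conj_trans_mult:
  assumes A: "(A :: 'a mat) \<in> carrier_mat l m" and B: "B \<in> carrier_mat m n"
  shows "conj_trans q (A * B) = conj_trans q B * conj_trans q A"
  using assms
  by (intro eq_matI)
     (auto simp: conj_trans_def scalar_prod_def q_power_sum power_mult_distrib mult.commute)

lemma conj_trans_conj_trans: "conj_trans q (conj_trans q A) = (A :: 'a mat)"
  by (intro eq_matI) (auto simp: conj_trans_def q_power_power)

lemma conj_trans_one: "conj_trans q (1\<^sub>m n) = (1\<^sub>m n :: 'a mat)"
  using q_pos by (intro eq_matI) (auto simp: conj_trans_def)

lemma carrier_GU:
  "carrier (GU TYPE('a) q n) = {X \<in> carrier_mat n n. X * conj_trans q X = 1\<^sub>m n}"
proof -
  have "X \<in> carrier (GL TYPE('a) n)"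
    if X: "X \<in> carrier_mat n n" "X * conj_trans q X = 1\<^sub>m n" for X :: "'a mat"
  proof -
    have cX: "conj_trans q X \<in> carrier_mat n n" using X by simp
    have "conj_trans q X * X = 1\<^sub>m n"
      by (rule mat_mult_left_right_inverse[OF X(1) cX X(2)])
    then show ?thesis
      unfolding carrier_GL using X cX by blast
  qed
  moreover have "X \<in> carrier_mat n n" if "X \<in> carrier (GL TYPE('a) n)" for X
    using that by (simp add: carrier_GL)
  ultimately show ?thesis
    unfolding GU_def by auto
qed

lemma group_GU: "group (GU TYPE('a) q n)"
proof -
  interpret group "GL TYPE('a) n" by (rule group_GL)
  note c = carrier_GU[of n, unfolded GU_def, simplified]
  let ?H = "{X \<in> carrier_mat n n. X * conj_trans q X = (1\<^sub>m n :: 'a mat)}"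
  have eq: "{X \<in> carrier (GL TYPE('a) n). X * conj_trans q X = 1\<^sub>m n} = ?H"
    using c by simp
  have sub: "?H \<subseteq> carrier (GL TYPE('a) n)"
    using eq by blast
  have left: "conj_trans q X * X = 1\<^sub>m n" if "X \<in> ?H" for X
    using that by (auto intro: mat_mult_left_right_inverse)
  have "subgroup ?H (GL TYPE('a) n)"
  proof (rule subgroupI)
    show "?H \<subseteq> carrier (GL TYPE('a) n)" by (rule sub)
    have "1\<^sub>m n \<in> ?H" by (simp add: conj_trans_one)
    then show "?H \<noteq> {}" by blast
  next
    fix X assume X: "X \<in> ?H"
    have "conj_trans q X \<in> ?H"
      using X left[OF X] by (auto simp: conj_trans_conj_trans)
    moreover from this have "inv\<^bsub>GL TYPE('a) n\<^esub> X = conj_trans q X"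
      using X left[OF X] sub by (intro inv_equality) auto
    ultimately show "inv\<^bsub>GL TYPE('a) n\<^esub> X \<in> ?H" by simp
  next
    fix X Y assume X: "X \<in> ?H" and Y: "Y \<in> ?H"
    have cX: "conj_trans q X \<in> carrier_mat n n" and cY: "conj_trans q Y \<in> carrier_mat n n"
      using X Y by auto
    have XY: "X \<in> carrier_mat n n" "Y \<in> carrier_mat n n" using X Y by auto
    have "X * Y * conj_trans q (X * Y) = X * (Y * (conj_trans q Y * conj_trans q X))"
      unfolding conj_trans_mult[OF XY]
      by (rule assoc_mult_mat[OF XY mult_carrier_mat[OF cY cX]])
    also have "\<dots> = X * ((Y * conj_trans q Y) * conj_trans q X)"
      by (subst assoc_mult_mat[of Y n n _ n _ n]) (use XY cX cY in auto)
    also have "\<dots> = 1\<^sub>m n"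
      using X Y by (simp add: left_mult_one_mat[OF cX])
    finally have "X * Y * conj_trans q (X * Y) = 1\<^sub>m n" .
    then show "X \<otimes>\<^bsub>GL TYPE('a) n\<^esub> Y \<in> ?H" using X Y by auto
  qed
  then show ?thesis
    unfolding GU_def eq by (rule subgroup.subgroup_is_group) (rule group_GL)
qed

lemma GU_simps [simp]: "monoid.mult (GU T q n) = (*)" "one (GU T q n) = 1\<^sub>m n"
  by (simp_all add: GU_def)

lemma GU_action:
  assumes E: "E \<subseteq> carrier_mat m n"
    and inv: "\<And>X Y A. X \<in> carrier (GU TYPE('a) q m) \<Longrightarrow> Y \<in> carrier (GU TYPE('a) q n) \<Longrightarrow>
                A \<in> E \<Longrightarrow> X * A * conj_trans q Y \<in> E"
  shows "group_action (GU TYPE('a) q m \<times>\<times> GU TYPE('a) q n) E (GU_act q E)"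
proof (rule group_actionI)
  show "group (GU TYPE('a) q m \<times>\<times> GU TYPE('a) q n)"
    by (intro DirProd_group group_GU)
next
  fix x assume "x \<in> E"
  then show "GU_act q E \<one>\<^bsub>GU TYPE('a) q m \<times>\<times> GU TYPE('a) q n\<^esub> x = x"
    using E by (auto simp: GU_act_def conj_trans_one)
next
  fix g h A
  assume g: "g \<in> carrier (GU TYPE('a) q m \<times>\<times> GU TYPE('a) q n)"
    and h: "h \<in> carrier (GU TYPE('a) q m \<times>\<times> GU TYPE('a) q n)" and A: "A \<in> E"
  obtain X Y X' Y' where gh: "g = (X, Y)" "h = (X', Y')" by fastforce
  have c: "X \<in> carrier_mat m m" "X' \<in> carrier_mat m m" "Y \<in> carrier_mat n n"
      "Y' \<in> carrier_mat n n" "A \<in> carrier_mat m n"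
    using g h gh A E by (auto simp: carrier_GU)
  have c': "conj_trans q Y \<in> carrier_mat n n" "conj_trans q Y' \<in> carrier_mat n n"
    using c by auto
  have "X * X' * A * (conj_trans q Y' * conj_trans q Y)
      = X * X' * A * conj_trans q Y' * conj_trans q Y"
    by (rule assoc_mult_mat[symmetric, of _ m n _ n _ n]) (use c c' in auto)
  moreover have "X * X' * A = X * (X' * A)"
    by (rule assoc_mult_mat[of _ m m _ m _ n]) (use c in auto)
  moreover have "X * (X' * A) * conj_trans q Y' = X * (X' * A * conj_trans q Y')"
    by (rule assoc_mult_mat[of _ m m _ n _ n]) (use c c' in auto)
  ultimately have "X * X' * A * conj_trans q (Y * Y') = X * (X' * A * conj_trans q Y') * conj_trans q Y"
    using c by (simp add: conj_trans_mult[of _ n n _ n])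
  moreover have "X' * A * conj_trans q Y' \<in> E"
    by (rule inv) (use h gh A in auto)
  moreover have "g \<otimes>\<^bsub>GU TYPE('a) q m \<times>\<times> GU TYPE('a) q n\<^esub> h = (X * X', Y * Y')"
    by (simp add: gh)
  ultimately show "GU_act q E (g \<otimes>\<^bsub>GU TYPE('a) q m \<times>\<times> GU TYPE('a) q n\<^esub> h) A
      = GU_act q E g (GU_act q E h A)"
    using A by (simp only: gh GU_act_def split_conv restrict_apply if_True)
qed (use inv in \<open>auto simp: GU_act_def\<close>)

lemma GU_action_carrier_mat:
  "group_action (GU TYPE('a) q m \<times>\<times> GU TYPE('a) q n) (carrier_mat m n) (GU_act q (carrier_mat m n))"
proof (rule GU_action)
  fix X Y A :: "'a mat"
  assume "X \<in> carrier (GU TYPE('a) q m)" "Y \<in> carrier (GU TYPE('a) q n)" "A \<in> carrier_mat m n"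
  then show "X * A * conj_trans q Y \<in> carrier_mat m n"
    unfolding carrier_GU by (metis (no_types, lifting) CollectD conj_trans_carrier mult_carrier_mat)
qed simp

lemma GU_action_nil_mats:
  "group_action (GU TYPE('a) q m \<times>\<times> GU TYPE('a) q n)
     (nil_mats TYPE('a) q m n) (GU_act q (nil_mats TYPE('a) q m n))"
proof (rule GU_action)
  show "nil_mats TYPE('a) q m n \<subseteq> carrier_mat m n"
    by (auto simp: nil_mats_def)
next
  fix X Y A
  assume X: "X \<in> carrier (GU TYPE('a) q m)" and Y: "Y \<in> carrier (GU TYPE('a) q n)"
    and A: "A \<in> nil_mats TYPE('a) q m n"
  let ?X = "conj_trans q X" and ?Y = "conj_trans q Y" and ?A = "conj_trans q A"
  have c: "X \<in> carrier_mat m m" "Y \<in> carrier_mat n n" "A \<in> carrier_mat m n"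
      "?X \<in> carrier_mat m m" "?Y \<in> carrier_mat n n" "?A \<in> carrier_mat n m"
    using X Y A by (auto simp: carrier_GU nil_mats_def)
  have XX: "?X * X = 1\<^sub>m m" and YY: "?Y * Y = 1\<^sub>m n" "Y * ?Y = 1\<^sub>m n"
    using X Y c by (auto simp: carrier_GU intro: mat_mult_left_right_inverse)
  let ?N = "?A * A" and ?M = "conj_trans q (X * A * ?Y) * (X * A * ?Y)"
  have ct: "conj_trans q (X * A * ?Y) = Y * (?A * ?X)"
    using c by (simp add: conj_trans_mult[of _ m n _ n] conj_trans_mult[of _ m m _ n]
        conj_trans_conj_trans)
  have "?M = Y * ?A * (?X * X) * A * ?Y"
    unfolding ct using c
    by (simp add: assoc_mult_mat[of _ n n _ m _ m] assoc_mult_mat[of _ n m _ m _ m]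
        assoc_mult_mat[of _ n m _ m _ n] assoc_mult_mat[of _ n m _ n _ n]
        assoc_mult_mat[of _ n n _ m _ n] assoc_mult_mat[of _ n n _ n _ n]
        assoc_mult_mat[of _ m m _ m _ n] assoc_mult_mat[of _ m m _ n _ n]
        assoc_mult_mat[of _ m n _ n _ n] mult_carrier_mat[of _ n m] mult_carrier_mat[of _ m m]
        mult_carrier_mat[of _ m n] mult_carrier_mat[of _ n n])
  also have "\<dots> = Y * ?N * ?Y"
    unfolding XX using c
    by (subst right_mult_one_mat[of _ n m]) (auto simp: assoc_mult_mat[of _ n n _ m _ n])
  finally have M: "?M = Y * ?N * ?Y" .
  have Nc: "?N \<in> carrier_mat n n" by (rule mult_carrier_mat[OF c(6) c(3)])
  have Zc: "X * A * ?Y \<in> carrier_mat m n"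
    by (rule mult_carrier_mat[OF mult_carrier_mat[OF c(1) c(3)] c(5)])
  have Mc: "?M \<in> carrier_mat n n"
    by (rule mult_carrier_mat[OF conj_trans_carrier[OF Zc] Zc])
  have "similar_mat_wit ?M ?N Y ?Y"
    by (rule similar_mat_witI[OF YY(2) YY(1) M Mc Nc c(2) c(5)])
  then have pow: "?M ^\<^sub>m k = Y * ?N ^\<^sub>m k * ?Y" for k
    by (rule similar_mat_wit_pow_id)
  obtain k where k: "?N ^\<^sub>m k = 0\<^sub>m n n"
    using A Nc by (auto simp: nil_mats_def nilpotent_mat_def)
  have "?M ^\<^sub>m k = 0\<^sub>m n n"
    by (simp add: pow k right_mult_zero_mat[OF c(2)] left_mult_zero_mat[OF c(5)])
  with Mc have "nilpotent_mat ?M"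
    unfolding nilpotent_mat_def by (metis carrier_matD square_mat.simps)
  then show "X * A * ?Y \<in> nil_mats TYPE('a) q m n"
    using Zc by (simp add: nil_mats_def)
qed

lemma f_orbits_0: "f_orbits TYPE('a) q 0 b = 1"
proof -
  let ?G = "GU TYPE('a) q 0 \<times>\<times> GU TYPE('a) q b" and ?E = "nil_mats TYPE('a) q 0 b"
  interpret group_action ?G ?E "GU_act q ?E" by (rule GU_action_nil_mats)
  have "conj_trans q A * A = 0\<^sub>m b b" if "A \<in> carrier_mat 0 b" for A :: "'a mat"
    using that by (intro eq_matI) (auto simp: conj_trans_def scalar_prod_def)
  then have "nilpotent_mat (conj_trans q A * A)" if "A \<in> carrier_mat 0 b" for A :: "'a mat"
    using that unfolding nilpotent_mat_def by (auto intro!: exI[of _ 1])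
  then have "?E = carrier_mat 0 b" by (auto simp: nil_mats_def)
  also have "\<dots> = {0\<^sub>m 0 b}" by (auto intro!: eq_matI)
  finally have E: "?E = {0\<^sub>m 0 b}" .
  have "orbit ?G (GU_act q ?E) (0\<^sub>m 0 b) = {0\<^sub>m 0 b}"
    using orbit_refl[of "0\<^sub>m 0 b"] element_image E unfolding orbit_def by fastforce
  then have "orbits ?G ?E (GU_act q ?E) = {{0\<^sub>m 0 b}}"
    using E by (auto simp: orbits_def)
  then show ?thesis by (simp add: f_orbits_def)
qed

end

end

theory Submission imports Defs
begin

text \<open>
  For a matrix \<open>A\<close> over the field with \<open>q\<^sup>2\<close> elements, \<open>A\<close> intertwines the Hermitian matrices
  \<open>A\<^sup>* A\<close> and \<open>A A\<^sup>*\<close>.  Suitable powers of these are idempotent, because the field is finite, and a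
  Hermitian idempotent can be diagonalised by a unitary matrix.  Moving both idempotents to standard
  form cuts \<open>A\<close> into a block \<open>B\<close>, invertible of some size \<open>i\<close>, and a block \<open>C\<close> for which \<open>C\<^sup>* C\<close> is
  nilpotent: a unitary version of the Fitting decomposition.  Unitary matrices between two such
  forms commute with the standard idempotents, hence are block diagonal, so that \<open>i\<close> and the unitary
  orbits of \<open>B\<close> and \<open>C\<close> are invariants of the orbit of \<open>A\<close> (\<open>normal_form_exists\<close>,
  \<open>normal_form_unique\<close>).  The orbits of \<open>C\<close> are counted by \<open>f(m - i, n - i)\<close>, and it remains to see
  that \<open>GL\<^sub>i(q\<^sup>2)\<close> has \<open>k(GL\<^sub>i(q))\<close> orbits under \<open>GU\<^sub>i(q) \<times> GU\<^sub>i(q)\<close>.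

  Two invertible matrices \<open>B\<close> and \<open>D\<close> lie in one orbit if and only if \<open>B\<^sup>* B\<close> and \<open>D\<^sup>* D\<close> are similar
  (\<open>unitary_equivalent_iff\<close>), and every invertible Hermitian matrix has the form \<open>B\<^sup>* B\<close>
  (\<open>hermitian_gram\<close>).  So the orbits are the similarity classes of invertible matrices over the large
  field that contain a Hermitian matrix.  These are the classes of the \<open>H\<close> that are similar to \<open>H\<^sup>*\<close>
  (\<open>similar_conj_trans_hermitian\<close>).  As every matrix is similar to its transpose
  (\<open>similar_mat_transpose\<close>), they are also the classes that are stable under the Frobenius map
  \<open>x \<mapsto> x\<^sup>q\<close> on the entries, and these are the classes that contain a matrix over the subfield with \<open>q\<close>
  elements (\<open>frob_similar_fixed\<close>).  Finally, similarity over the large field of two matrices over the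
  subfield implies similarity over the subfield (\<open>fixed_similar_descent\<close>).  Hence the classes in
  question correspond to the conjugacy classes of \<open>GL\<^sub>i(q)\<close>.

  The arguments about similarity share one tool: an invertible matrix \<open>r\<close> over the large field is a
  norm \<open>p(r) p'(r)\<close>, where \<open>p'\<close> arises from the polynomial \<open>p\<close> by raising its coefficients to the
  \<open>q\<close>-th power (\<open>norm_mat\<close>).  Since \<open>r\<close> has finite order \<open>k\<close>, this only requires the congruence
  \<open>p p' \<equiv> X\<close> modulo \<open>X\<^sup>k - 1\<close> (\<open>norm_poly_cyclic\<close>).  It takes the place of square roots of Hermitian
  matrices, and by a counting argument it implies a form of Hilbert's Theorem 90 in the commutative
  algebra generated by one matrix (\<open>hilbert90_mat\<close>).
\<close>

section \<open>Norm, trace and square roots in a quadratic extension of finite fields\<close>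

lemma card_le_fibres:
  assumes "finite S" and "\<And>y. y \<in> f ` S \<Longrightarrow> card {x \<in> S. f x = y} \<le> k"
  shows "card S \<le> k * card (f ` S)"
proof -
  have "card S = card (\<Union>y\<in>f ` S. {x \<in> S. f x = y})"
    by (rule arg_cong[where f = card]) auto
  also have "\<dots> \<le> (\<Sum>y\<in>f ` S. card {x \<in> S. f x = y})"
    using assms(1) by (intro card_UN_le) simp
  also have "\<dots> \<le> (\<Sum>y\<in>f ` S. k)"
    by (intro sum_mono assms(2))
  finally show ?thesis by (simp add: mult.commute)
qed

lemma CHAR_eq_of_card:
  assumes "prime p" "CARD('a::{field,finite}) = p ^ k"
  shows "CHAR('a) = p"
proof -
  have "prime (CHAR('a))"
    using prime_CHAR_semidom[where ?'a = 'a] finite_imp_CHAR_pos[where ?'a = 'a] by simp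
  moreover have "CHAR('a) dvd p ^ k"
    using CHAR_dvd_CARD[where ?'a = 'a] assms(2) by simp
  ultimately show ?thesis
    using prime_dvd_power primes_dvd_imp_eq[OF _ assms(1)] by blast
qed

lemma power_card_field: "(x :: 'a::{field,finite}) ^ CARD('a) = x"
proof (cases "x = 0")
  case False
  let ?U = "UNIV - {0 :: 'a}"
  have "bij_betw ((*) x) ?U ?U"
    using False by (intro bij_betwI[where g = "\<lambda>y. y / x"]) auto
  then have "\<Prod>?U = (\<Prod>y\<in>?U. x * y)"
    by (simp only: prod.reindex_bij_betw[where g = "\<lambda>y. y"])
  also have "\<dots> = x ^ card ?U * \<Prod>?U"
    by (simp add: prod.distrib)
  finally have 1: "x ^ card ?U = 1" by simp
  have "CARD('a) = Suc (card ?U)"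
    using finite_UNIV_card_ge_0[where ?'a = 'a] by simp
  then show ?thesis by (simp only: power_Suc 1 mult_1_right)
qed simp

text \<open>
  Solutions of \<open>a a' = X\<close> and \<open>b b' = X\<close> modulo coprime \<open>M\<close> and \<open>N\<close> are glued along the element \<open>E\<close>
  of the Chinese remainder theorem, which is \<open>1\<close> modulo \<open>M\<close> and \<open>0\<close> modulo \<open>N\<close>: on the right, every
  summand is then divisible by \<open>M N\<close>.
\<close>

lemma idempotent_glue:
  fixes E :: "'a::comm_ring_1"
  shows "(E * a + (1 - E) * b) * (E * a' + (1 - E) * b') - X
       = E * (a * a' - X) + (1 - E) * (b * b' - X) - E * (1 - E) * ((a - b) * (a' - b'))"
  by (simp add: algebra_simps)

text \<open>
  A Newton step that lifts \<open>c c' = X\<close> from modulo \<open>D\<close> to modulo \<open>D\<^sup>2\<close> in characteristic 2, where \<open>W\<close>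
  inverts \<open>X\<close> modulo \<open>D\<close>.  The correction \<open>D h W\<close> has to be shared between the two conjugate
  factors; it cannot be halved, and is split with weights \<open>t + t' = 1\<close> instead.
\<close>

lemma newton_step:
  fixes t t' :: "'a::comm_ring_1"
  assumes "t + t' = 1" "c * c' = X + D * h" "X * W = 1 + D * v" "D * h + D * h = 0"
  shows "(c * (1 + t * D * h * W)) * (c' * (1 + t' * D * h * W))
       = X + D * D * (h * v + h * h * W + (X + D * h) * t * t' * (h * W) * (h * W))"
proof -
  have "(c * (1 + t * D * h * W)) * (c' * (1 + t' * D * h * W))
      = (c * c') * (1 + (t + t') * (D * h * W) + t * t' * (D * h * W) * (D * h * W))"
    by (simp add: algebra_simps)
  also have "\<dots> = X + D * h * (X * W) + D * h + D * D * (h * h * W +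
         (X + D * h) * t * t' * (h * W) * (h * W))"
    unfolding assms(1,2) by (simp add: algebra_simps)
  also have "X + D * h * (X * W) + D * h = X + D * D * (h * v) + (D * h + D * h)"
    unfolding assms(3) by (simp add: algebra_simps)
  finally show ?thesis by (simp add: assms(4) algebra_simps)
qed

definition conj_poly :: "nat \<Rightarrow> 'a::field poly \<Rightarrow> 'a poly" where
  "conj_poly q p = map_poly (\<lambda>x. x ^ q) p"

context
  fixes q :: nat
  assumes q: "primepow q" "CARD('a::{field,finite}) = q\<^sup>2"
begin

lemmas add_q = q_power_add[OF q]
lemmas qq = q_power_power[OF q]
lemmas pos_q = q_pos[OF q]

lemma minus_q: "(- x :: 'a) ^ q = - (x ^ q)"
proof -
  have "x ^ q + (- x) ^ q = 0"
    using add_q[of x "- x"] pos_q by (simp add: power_0_left)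
  then show ?thesis by (simp add: eq_neg_iff_add_eq_0 add.commute)
qed

lemma diff_q: "(x - y :: 'a) ^ q = x ^ q - y ^ q"
  using add_q[of x "- y"] by (simp add: minus_q)

lemma numeral_2_q: "(2 :: 'a) ^ q = 2"
  using add_q[of 1 1] by simp

lemma q_gt_1: "q > 1"
  using primepow_gt_Suc_0[OF q(1)] by simp

lemma fixed_points_card_le: "card {x :: 'a. x ^ q = x} \<le> q"
proof -
  define p where "p = monom (1::'a) q - monom 1 1"
  have "coeff p q = 1" using q_gt_1 by (simp add: p_def)
  then have "p \<noteq> 0" by auto
  have "degree p \<le> q"
    unfolding p_def by (rule degree_diff_le) (use q_gt_1 in \<open>auto simp: degree_monom_eq\<close>)
  moreover have "{x. x ^ q = x} = {x. poly p x = 0}"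
    by (auto simp: p_def poly_monom)
  ultimately show ?thesis
    using card_poly_roots_bound[OF \<open>p \<noteq> 0\<close>] by simp
qed

text \<open>
  The fibres of the norm \<open>x \<mapsto> x x\<^sup>q\<close> consist of roots of \<open>X\<^bsup>q + 1\<^esup> - y\<close>, so they have at most \<open>q + 1\<close>
  elements, and the image of the \<open>q\<^sup>2 - 1\<close> nonzero elements has at least \<open>q - 1\<close>.  The nonzero fixed
  points, among which the norms lie, number at most \<open>q - 1\<close>, since all fixed points are roots of
  \<open>X\<^sup>q - X\<close>.  Hence both bounds are attained.
\<close>

lemma norm_image: "(\<lambda>x :: 'a. x * x ^ q) ` (UNIV - {0}) = {x. x ^ q = x} - {0}"
  and card_fixed_points: "card {x :: 'a. x ^ q = x} = q"
proof -
  let ?U = "UNIV - {0 :: 'a}" and ?f = "\<lambda>x :: 'a. x * x ^ q" and ?T = "{x :: 'a. x ^ q = x} - {0}"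
  have "?f ` ?U \<subseteq> ?T"
    using pos_q by (auto simp: power_mult_distrib qq)
  have "card {x \<in> ?U. ?f x = y} \<le> q + 1" for y
  proof -
    define p where "p = monom (1::'a) (q + 1) - [:y:]"
    have "coeff p (q + 1) = 1" by (simp add: p_def)
    then have "p \<noteq> 0" by auto
    have "degree p \<le> q + 1"
      unfolding p_def by (rule degree_diff_le) (auto simp: degree_monom_eq)
    moreover have "{x \<in> ?U. ?f x = y} \<subseteq> {x. poly p x = 0}"
      by (auto simp: p_def poly_monom)
    then have "card {x \<in> ?U. ?f x = y} \<le> card {x. poly p x = 0}"
      by (intro card_mono) auto
    ultimately show ?thesis
      using card_poly_roots_bound[OF \<open>p \<noteq> 0\<close>] by linarith
  qed
  then have "card ?U \<le> (q + 1) * card (?f ` ?U)"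
    by (intro card_le_fibres) auto
  moreover have "card ?U = q * q - 1"
    using q(2) by (simp add: power2_eq_square)
  moreover have "q * q - 1 = (q + 1) * (q - 1)"
    using q_gt_1 by (simp add: algebra_simps)
  ultimately have ge: "q - 1 \<le> card (?f ` ?U)"
    using mult_le_cancel1[of "q + 1" "q - 1" "card (?f ` ?U)"] by simp
  have le: "card ?T \<le> q - 1"
    using fixed_points_card_le pos_q by simp
  then show eq: "?f ` ?U = ?T"
    using \<open>?f ` ?U \<subseteq> ?T\<close> ge by (intro card_seteq) auto
  have "card ?T = q - 1" using ge le unfolding eq by simp
  moreover have "card ?T = card {x :: 'a. x ^ q = x} - 1" using pos_q by simp
  moreover have "card {x :: 'a. x ^ q = x} \<noteq> 0"
    using pos_q by (auto intro!: exI[of _ 0])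
  ultimately show "card {x :: 'a. x ^ q = x} = q" using pos_q by linarith
qed

lemma norm_surj:
  assumes "(z :: 'a) ^ q = z" "z \<noteq> 0"
  obtains x where "x * x ^ q = z"
proof -
  have "z \<in> (\<lambda>x. x * x ^ q) ` (UNIV - {0})"
    unfolding norm_image using assms by simp
  then show thesis using that by (elim imageE) simp
qed

text \<open>
  The trace \<open>x\<^sup>q + x\<close> is a polynomial of degree \<open>q < q\<^sup>2\<close>, so it does not vanish everywhere; as its
  values are fixed by the Frobenius map, a nonzero value can be scaled to \<open>1\<close>.
\<close>

lemma trace_one: obtains t :: 'a where "t + t ^ q = 1"
proof -
  define p where "p = monom (1::'a) q + monom 1 1"
  have "coeff p q = 1" using q_gt_1 by (simp add: p_def)
  then have "p \<noteq> 0" by auto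
  have "degree p \<le> q"
    unfolding p_def by (rule degree_add_le) (use q_gt_1 in \<open>auto simp: degree_monom_eq\<close>)
  then have "card {x. poly p x = 0} \<le> q"
    using card_poly_roots_bound[OF \<open>p \<noteq> 0\<close>] by simp
  moreover have "q < CARD('a)"
    using q_gt_1 by (simp add: q(2) power2_eq_square)
  ultimately obtain x where x: "poly p x \<noteq> 0"
    by (cases "\<forall>x. poly p x = 0") auto
  define d where "d = x ^ q + x"
  have "d \<noteq> 0" "d ^ q = d"
    using x by (auto simp: d_def p_def poly_monom add_q qq)
  then have "x / d + (x / d) ^ q = 1"
    by (simp add: power_divide d_def add_divide_distrib[symmetric] add.commute)
  then show thesis by (rule that)
qed

text \<open>
  If \<open>z = x\<^bsup>q + 1\<^esup>\<close> is a norm, then \<open>x\<^bsup>(q + 1) / 2\<^esup>\<close> is a square root of \<open>z\<close>.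
\<close>

lemma sqrt_fixed:
  assumes "(z :: 'a) ^ q = z" "z \<noteq> 0" "odd q"
  obtains w where "w\<^sup>2 = z" "w ^ q = w \<or> w ^ q = - w"
proof -
  obtain x where x: "x * x ^ q = z" using norm_surj[OF assms(1,2)] .
  define w where "w = x ^ ((q + 1) div 2)"
  have "(q + 1) div 2 * 2 = q + 1"
    using \<open>odd q\<close> by presburger
  then have "w\<^sup>2 = x ^ (q + 1)"
    unfolding w_def power_mult[symmetric] by (rule arg_cong)
  then have w: "w\<^sup>2 = z" using x by simp
  then have "(w ^ q)\<^sup>2 = w\<^sup>2"
    using assms(1) by (simp add: power_mult[symmetric] mult.commute[of q]) (simp add: power_mult)
  then show thesis using that w power2_eq_iff by blast
qed

subsection \<open>The norm equation for polynomials\<close>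

lemma coeff_conj_poly [simp]: "coeff (conj_poly q p) i = coeff (p :: 'a poly) i ^ q"
  using pos_q by (simp add: conj_poly_def coeff_map_poly)

lemma conj_poly_simps [simp]:
  "conj_poly q (p + r) = conj_poly q p + conj_poly q (r :: 'a poly)"
  "conj_poly q (p - r) = conj_poly q p - conj_poly q (r :: 'a poly)"
  "conj_poly q (smult a p) = smult (a ^ q) (conj_poly q p)"
  "conj_poly q (conj_poly q p) = p"
     apply (intro poly_eqI, simp add: add_q)
    apply (intro poly_eqI, simp add: diff_q)
   apply (intro poly_eqI, simp add: power_mult_distrib)
  apply (intro poly_eqI, simp add: qq)
  done

lemma conj_poly_0 [simp]: "conj_poly q 0 = (0 :: 'a poly)"
  using pos_q by (intro poly_eqI) simp

lemma conj_poly_pCons [simp]: "conj_poly q (pCons a p) = pCons (a ^ q) (conj_poly q (p :: 'a poly))"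
  by (intro poly_eqI) (simp add: coeff_pCons split: nat.split)

lemma conj_poly_1 [simp]: "conj_poly q 1 = (1 :: 'a poly)"
  by (simp add: one_pCons)

lemma conj_poly_monom [simp]: "conj_poly q (monom a k) = (monom (a ^ q) k :: 'a poly)"
  using pos_q by (intro poly_eqI) simp

lemma conj_poly_mult [simp]: "conj_poly q (p * r) = conj_poly q p * conj_poly q (r :: 'a poly)"
  by (intro poly_eqI) (simp add: coeff_mult q_power_sum[OF q] power_mult_distrib)

lemma two_eq_0_iff: "(2 :: 'a) = 0 \<longleftrightarrow> even q"
proof -
  obtain p k where p: "prime p" "q = p ^ k"
    using q(1) by (auto simp: primepow_def)
  have "CHAR('a) = p"
    using CHAR_eq_of_card[of p "k * 2", where ?'a = 'a] p q(2) by (simp add: power_mult)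
  moreover have "(2 :: 'a) = of_nat 2" by simp
  ultimately have "(2 :: 'a) = 0 \<longleftrightarrow> p dvd 2"
    by (metis of_nat_eq_0_iff_char_dvd)
  also have "\<dots> \<longleftrightarrow> p = 2"
    using primes_dvd_imp_eq[OF p(1) two_is_prime_nat] by auto
  also have "\<dots> \<longleftrightarrow> even q"
  proof
    show "even q" if "p = 2"
      using that p(2) q_gt_1 by (cases k) auto
    show "p = 2" if "even q"
    proof -
      have "2 dvd p ^ k" using that p(2) by simp
      then have "2 dvd p" using prime_dvd_power[OF two_is_prime_nat] by blast
      then show "p = 2" using primes_dvd_imp_eq[OF two_is_prime_nat p(1)] by simp
    qed
  qed
  finally show ?thesis .
qed

text \<open>
  Induction on \<open>s\<close>, with modulus \<open>Y\<^sup>2 - z\<close> for \<open>Y = X\<^bsup>2 ^ s\<^esup>\<close>.  For odd \<open>q\<close> write \<open>z = w\<^sup>2\<close>, so that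
  the modulus is \<open>(Y - w) (Y + w)\<close> with coprime factors.  If \<open>w\<close> is fixed by the Frobenius map, the
  solutions for both factors are glued.  If \<open>w\<^sup>q = - w\<close>, the Frobenius map exchanges the factors, and a
  solution is the element that is \<open>X\<close> modulo one of them and \<open>1\<close> modulo the other.  For even \<open>q\<close> the
  modulus is the square \<open>(Y - e)\<^sup>2\<close> with \<open>e\<^sup>2 = z\<close>, and a Newton step applies.
\<close>

lemma norm_poly_2power:
  assumes "(z :: 'a) ^ q = z" "z \<noteq> 0"
  shows "\<exists>c. monom 1 (2 ^ s) - [:z:] dvd c * conj_poly q c - monom (1 :: 'a) 1"
  using assms
proof (induction s arbitrary: z)
  case 0
  obtain x where "x * x ^ q = z" using norm_surj[OF 0] .
  then have "[:x:] * conj_poly q [:x:] - monom 1 1 = - (monom 1 1 - [:z:])"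
    by (simp add: mult.commute)
  then have "monom 1 (2 ^ 0) - [:z:] dvd [:x:] * conj_poly q [:x:] - monom 1 1"
    by (simp only: dvd_minus_iff power_0 dvd_refl)
  then show ?case by (rule exI)
next
  case (Suc s)
  define X where "X = monom (1 :: 'a) 1"
  define Y where "Y = monom (1 :: 'a) (2 ^ s)"
  have Y2: "monom (1 :: 'a) (2 ^ Suc s) = Y * Y"
    by (simp add: Y_def mult_monom mult_2)
  have conj: "conj_poly q X = X" "conj_poly q Y = Y"
    by (simp_all add: X_def Y_def)
  show ?case
  proof (cases "odd q")
    case True
    then have two: "(2 :: 'a) \<noteq> 0" by (simp add: two_eq_0_iff)
    obtain w where w: "w\<^sup>2 = z" "w ^ q = w \<or> w ^ q = - w"
      using sqrt_fixed Suc.prems True by blast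
    have w0: "w \<noteq> 0" using w Suc.prems by auto
    \<comment> \<open>\<open>E\<close> is \<open>1\<close> modulo \<open>Y - w\<close> and \<open>0\<close> modulo \<open>Y + w\<close>.\<close>
    define E where "E = smult (1 / (2 * w)) (Y + [:w:])"
    have E': "1 - E = smult (- 1 / (2 * w)) (Y - [:w:])"
    proof -
      have "1 / (2 * w) * w + 1 / (2 * w) * w = 1"
        using w0 two by (simp add: field_simps)
      then have "coeff (1 - E) i = coeff (smult (- 1 / (2 * w)) (Y - [:w:])) i" for i
        by (cases i) (auto simp: E_def ring_distribs eq_diff_eq)
      then show ?thesis by (rule poly_eqI)
    qed
    have YY: "(Y + [:w:]) * (Y - [:w:]) = Y * Y - [:z:]"
      using w(1) by (simp add: algebra_simps power2_eq_square)
    have EE: "Y * Y - [:z:] dvd E * (1 - E)"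
    proof -
      have "E * (1 - E) = smult (1 / (2 * w) * (- 1 / (2 * w))) ((Y + [:w:]) * (Y - [:w:]))"
        unfolding E' unfolding E_def by (simp only: mult_smult_left mult_smult_right smult_smult mult.commute)
      then show ?thesis unfolding YY by (simp add: dvd_smult)
    qed
    show ?thesis
    proof (cases "w ^ q = w")
      case True
      have "(- w) ^ q = - w" using True by (simp add: minus_q)
      have neg: "- [:- w:] = [:w:]" by simp
      obtain c1 where c1: "Y - [:w:] dvd c1 * conj_poly q c1 - X"
        using Suc.IH[OF True w0] unfolding X_def Y_def by (rule exE)
      obtain c2 where "Y - [:- w:] dvd c2 * conj_poly q c2 - X"
        using Suc.IH[of "- w"] \<open>(- w) ^ q = - w\<close> w0 unfolding X_def Y_def by auto
      then have c2: "Y + [:w:] dvd c2 * conj_poly q c2 - X"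
        unfolding diff_conv_add_uminus neg .
      have Ec: "conj_poly q E = E"
        using True by (simp add: E_def conj power_divide power_mult_distrib numeral_2_q)
      have 1: "Y * Y - [:z:] dvd E * (c1 * conj_poly q c1 - X)"
        unfolding E_def YY[symmetric] mult_smult_left
        by (intro dvd_smult mult_dvd_mono dvd_refl c1)
      have 2: "Y * Y - [:z:] dvd (1 - E) * (c2 * conj_poly q c2 - X)"
        unfolding E' YY[symmetric] mult_smult_left mult.commute[of "Y + [:w:]"]
        by (intro dvd_smult mult_dvd_mono dvd_refl c2)
      define c where "c = E * c1 + (1 - E) * c2"
      have "c * conj_poly q c - X = E * (c1 * conj_poly q c1 - X)
          + (1 - E) * (c2 * conj_poly q c2 - X)
          - E * (1 - E) * ((c1 - c2) * (conj_poly q c1 - conj_poly q c2))"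
        unfolding c_def conj_poly_simps conj_poly_mult conj_poly_1 Ec by (rule idempotent_glue)
      then have "Y * Y - [:z:] dvd c * conj_poly q c - X"
        using 1 2 EE by (simp only: dvd_add dvd_diff dvd_mult2)
      then show ?thesis unfolding Y2 X_def by (rule exI)
    next
      case False
      then have wq: "w ^ q = - w" using w by blast
      have "conj_poly q E = 1 - E"
        unfolding E' unfolding diff_conv_add_uminus
        by (simp add: E_def conj power_divide power_mult_distrib numeral_2_q wq)
      then have "(E * X + (1 - E)) * conj_poly q (E * X + (1 - E)) - X
          = (E * X + (1 - E)) * ((1 - E) * X + E) - X"
        by (simp add: conj)
      also have "\<dots> = E * (1 - E) * (X * X + 1 - 2 * X)"
        by (simp add: algebra_simps)
      finally have "Y * Y - [:z:] dvd (E * X + (1 - E)) * conj_poly q (E * X + (1 - E)) - X"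
        using dvd_mult2[OF EE] by simp
      then show ?thesis unfolding Y2 X_def by (rule exI)
    qed
  next
    case False
    then have two: "(2 :: 'a) = 0" by (simp add: two_eq_0_iff)
    have aa: "a + a = 0" for a :: 'a
      using two mult_2[of a] by simp
    have two': "p + p = 0" for p :: "'a poly"
      by (intro poly_eqI) (simp only: coeff_add aa coeff_0)
    \<comment> \<open>The square root of \<open>z\<close> in characteristic 2, since \<open>z\<^sup>q = z\<close>.\<close>
    define e where "e = z ^ (q div 2)"
    have "e\<^sup>2 = z ^ q"
      unfolding e_def power_mult[symmetric] using False by simp
    then have e2: "e\<^sup>2 = z" using Suc.prems by simp
    then have e0: "e \<noteq> 0" using Suc.prems by auto
    have eq: "e ^ q = e"
    proof -
      have "e ^ q = (z ^ q) ^ (q div 2)"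
        unfolding e_def power_mult[symmetric] by (simp only: mult.commute)
      then show ?thesis using Suc.prems(1) by (simp add: e_def)
    qed
    define D where "D = Y - [:e:]"
    have DD: "Y * Y - [:z:] = D * D"
    proof -
      have "D * D = Y * Y + [:z:] - ([:e:] * Y + [:e:] * Y)"
        using e2 by (simp add: D_def algebra_simps power2_eq_square)
      also have "\<dots> = Y * Y - [:z:]"
        using two'[of "[:z:]"] by (simp only: two' diff_0_right eq_diff_eq add.assoc add_0_right)
      finally show ?thesis ..
    qed
    obtain c h where c: "c * conj_poly q c = X + D * h"
      using Suc.IH[OF eq e0] unfolding D_def Y_def X_def
      by (auto simp: dvd_def diff_eq_eq add.commute)
    have Dc: "conj_poly q D = D" by (simp add: D_def conj eq)
    have "coeff D (2 ^ s) = 1"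
      by (simp add: D_def Y_def coeff_pCons split: nat.split)
    then have "D \<noteq> 0" by auto
    have "conj_poly q (c * conj_poly q c) = c * conj_poly q c"
      by (simp add: mult.commute)
    then have "X + D * conj_poly q h = X + D * h"
      unfolding c by (simp add: conj Dc)
    then have hc: "conj_poly q h = h" using \<open>D \<noteq> 0\<close> by simp
    obtain t :: 'a where t: "t + t ^ q = 1" by (rule trace_one)
    \<comment> \<open>Since \<open>X W = Y / e\<close>, and \<open>Y\<close> is \<open>e\<close> modulo \<open>D\<close>, this inverts \<open>X\<close> modulo \<open>D\<close>.\<close>
    define W where "W = monom (1 / e) (2 ^ s - 1)"
    have Wc: "conj_poly q W = W" by (simp add: W_def power_divide eq)
    have XW: "X * W = 1 + smult (1 / e) D"
      using e0 by (simp add: X_def W_def D_def Y_def mult_monom smult_diff_right smult_monom one_pCons)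
    have tt: "[:t:] + [:t ^ q:] = 1" using t by (simp add: one_pCons)
    have "smult (1 / e) D = D * [:1 / e:]" by simp
    note step = newton_step[OF tt c XW[unfolded this] two']
    define C where "C = c * (1 + [:t:] * D * h * W)"
    have "conj_poly q C = conj_poly q c * (1 + [:t ^ q:] * D * h * W)"
      by (simp add: C_def Dc hc Wc)
    then have "D * D dvd C * conj_poly q C - X"
      unfolding C_def by (simp only: step add_diff_cancel_left' dvd_triv_left)
    then show ?thesis unfolding Y2 X_def DD by (rule exI)
  qed
qed

end

section \<open>Polynomials in a matrix\<close>

definition poly_mat :: "'a::comm_ring_1 poly \<Rightarrow> 'a mat \<Rightarrow> 'a mat" where
  "poly_mat p A = fold_coeffs (\<lambda>a M. a \<cdot>\<^sub>m 1\<^sub>m (dim_row A) + A * M) p (0\<^sub>m (dim_row A) (dim_row A))"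

lemma poly_mat_0 [simp]: "A \<in> carrier_mat n n \<Longrightarrow> poly_mat 0 A = 0\<^sub>m n n"
  by (simp add: poly_mat_def)

lemma poly_mat_pCons:
  assumes A: "A \<in> carrier_mat n n"
  shows "poly_mat (pCons a p) A = a \<cdot>\<^sub>m 1\<^sub>m n + A * poly_mat p A"
proof (cases "a = 0 \<and> p = 0")
  case True
  then show ?thesis using A by (auto simp: poly_mat_def)
next
  case False
  then show ?thesis using A by (auto simp: poly_mat_def)
qed

lemma poly_mat_carrier [simp, intro]:
  "A \<in> carrier_mat n n \<Longrightarrow> poly_mat p A \<in> carrier_mat n n"
  by (induction p) (auto simp: poly_mat_pCons intro!: add_carrier_mat)

lemma poly_mat_dim [simp]:
  "A \<in> carrier_mat n n \<Longrightarrow> dim_row (poly_mat p A) = n"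
  "A \<in> carrier_mat n n \<Longrightarrow> dim_col (poly_mat p A) = n"
  using poly_mat_carrier by blast+

lemma poly_mat_const: "A \<in> carrier_mat n n \<Longrightarrow> poly_mat [:a:] A = a \<cdot>\<^sub>m 1\<^sub>m n"
  by (simp add: poly_mat_pCons)

lemma poly_mat_1 [simp]: "A \<in> carrier_mat n n \<Longrightarrow> poly_mat 1 A = 1\<^sub>m n"
  by (auto simp: one_pCons poly_mat_const)

lemma poly_mat_smult: "A \<in> carrier_mat n n \<Longrightarrow> poly_mat (smult c p) A = c \<cdot>\<^sub>m poly_mat p A"
proof (induction p)
  case (pCons a p)
  have "c \<cdot>\<^sub>m (a \<cdot>\<^sub>m 1\<^sub>m n + A * poly_mat p A) = (c * a) \<cdot>\<^sub>m 1\<^sub>m n + c \<cdot>\<^sub>m (A * poly_mat p A)"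
    using pCons.prems by (intro eq_matI) (auto simp: algebra_simps)
  then show ?case
    using pCons by (simp add: poly_mat_pCons mult_smult_distrib[OF pCons.prems poly_mat_carrier])
qed (auto simp: smult_zero_mat)

lemma poly_mat_add:
  assumes A: "A \<in> carrier_mat n n"
  shows "poly_mat (p + r) A = poly_mat p A + poly_mat r A"
proof (induction p r rule: poly_induct2)
  case (pCons a p b r)
  let ?P = "A * poly_mat p A" and ?R = "A * poly_mat r A"
  have "A * (poly_mat p A + poly_mat r A) = ?P + ?R"
    using A by (intro mult_add_distrib_mat) auto
  moreover have "(a + b) \<cdot>\<^sub>m 1\<^sub>m n + (?P + ?R) = (a \<cdot>\<^sub>m 1\<^sub>m n + ?P) + (b \<cdot>\<^sub>m 1\<^sub>m n + ?R)"
    using A by (intro eq_matI) (auto simp: algebra_simps)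
  ultimately show ?case
    using A pCons.IH by (simp add: poly_mat_pCons)
qed (use A in auto)

lemma poly_mat_mult:
  assumes A: "A \<in> carrier_mat n n"
  shows "poly_mat (p * r) A = poly_mat p A * poly_mat r A"
proof (induction p)
  case (pCons a p)
  let ?P = "poly_mat p A" and ?R = "poly_mat r A"
  have c: "?P \<in> carrier_mat n n" "?R \<in> carrier_mat n n" "A * ?P \<in> carrier_mat n n"
    using A by auto
  have "poly_mat (pCons a p * r) A = a \<cdot>\<^sub>m ?R + A * (?P * ?R)"
    using A pCons.IH by (auto simp: poly_mat_add poly_mat_smult poly_mat_pCons)
  also have "a \<cdot>\<^sub>m ?R = (a \<cdot>\<^sub>m 1\<^sub>m n) * ?R"
    using c by (subst mult_smult_assoc_mat[of _ n n _ n]) auto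
  also have "A * (?P * ?R) = (A * ?P) * ?R"
    using A c by (intro assoc_mult_mat[symmetric]) auto
  also have "(a \<cdot>\<^sub>m 1\<^sub>m n) * ?R + (A * ?P) * ?R = (a \<cdot>\<^sub>m 1\<^sub>m n + A * ?P) * ?R"
    by (rule add_mult_distrib_mat[symmetric, of _ n n _ _ n]) (use c in auto)
  finally show ?case using A by (simp add: poly_mat_pCons)
qed (use A in auto)

lemma poly_mat_commute:
  "A \<in> carrier_mat n n \<Longrightarrow> poly_mat p A * poly_mat r A = poly_mat r A * poly_mat p A"
  by (metis poly_mat_mult mult.commute)

lemma poly_mat_monom: "A \<in> carrier_mat n n \<Longrightarrow> poly_mat (monom 1 k) A = A ^\<^sub>m k"
proof (induction k)
  case (Suc k)
  have "poly_mat (monom 1 (Suc k)) A = poly_mat (monom 1 k * [:0, 1:]) A"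
    by (simp add: monom_Suc)
  also have "\<dots> = poly_mat (monom 1 k) A * poly_mat [:0, 1:] A"
    by (rule poly_mat_mult[OF Suc.prems])
  also have "poly_mat [:0, 1:] A = A"
  proof -
    have "(1 :: 'a) \<cdot>\<^sub>m 1\<^sub>m n = 1\<^sub>m n" "(0 :: 'a) \<cdot>\<^sub>m 1\<^sub>m n = 0\<^sub>m n n"
      by (auto intro!: eq_matI)
    then show ?thesis using Suc.prems by (simp add: poly_mat_pCons)
  qed
  also have "poly_mat (monom 1 k) A = A ^\<^sub>m k" using Suc by simp
  finally show ?case by simp
qed (simp add: monom_0 flip: one_pCons)

lemma poly_mat_X [simp]: "A \<in> carrier_mat n n \<Longrightarrow> poly_mat (monom 1 (Suc 0)) A = A"
  by (subst poly_mat_monom) auto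

lemma pow_mat_add:
  "A \<in> carrier_mat n n \<Longrightarrow> A ^\<^sub>m (i + j) = A ^\<^sub>m i * (A :: 'a::comm_ring_1 mat) ^\<^sub>m j"
  unfolding poly_mat_monom[symmetric] poly_mat_mult[symmetric] by (simp add: mult_monom)

text \<open>
  Transfers commutation and intertwining relations from matrices to all polynomials in them, in
  particular to their powers.  The matrix \<open>G\<close> may be rectangular, as is needed for \<open>A (A\<^sup>* A) = (A A\<^sup>*) A\<close>.
\<close>

lemma poly_mat_intertwine:
  assumes A: "A \<in> carrier_mat n n" and B: "B \<in> carrier_mat m m" and G: "G \<in> carrier_mat m n"
    and eq: "G * A = B * G"
  shows "G * poly_mat p A = poly_mat p B * G"
proof (induction p)
  case 0
  show ?case using A B G by simp
next
  case (pCons a p)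
  let ?P = "poly_mat p A" and ?R = "poly_mat p B"
  have c: "?P \<in> carrier_mat n n" "?R \<in> carrier_mat m m" using A B by auto
  have "G * (A * ?P) = (G * A) * ?P"
    by (rule assoc_mult_mat[symmetric]) (use A G c in auto)
  also have "\<dots> = B * (G * ?P)"
    unfolding eq by (rule assoc_mult_mat) (use B G c in auto)
  also have "\<dots> = (B * ?R) * G"
    unfolding pCons.IH by (rule assoc_mult_mat[symmetric]) (use B G c in auto)
  finally have 1: "G * (A * ?P) = (B * ?R) * G" .
  have "G * poly_mat (pCons a p) A = G * (a \<cdot>\<^sub>m 1\<^sub>m n) + G * (A * ?P)"
    unfolding poly_mat_pCons[OF A] by (rule mult_add_distrib_mat) (use A G c in auto)
  also have "G * (a \<cdot>\<^sub>m 1\<^sub>m n) = a \<cdot>\<^sub>m 1\<^sub>m m * G"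
    using G by (simp add: mult_smult_distrib[OF G one_carrier_mat]
        mult_smult_assoc_mat[OF one_carrier_mat G])
  also have "a \<cdot>\<^sub>m 1\<^sub>m m * G + G * (A * ?P) = poly_mat (pCons a p) B * G"
    unfolding poly_mat_pCons[OF B] 1
    by (rule add_mult_distrib_mat[symmetric]) (use B G c in auto)
  finally show ?case .
qed

lemma poly_mat_transpose:
  assumes A: "A \<in> carrier_mat n n"
  shows "transpose_mat (poly_mat p A) = poly_mat p (transpose_mat A)"
proof (induction p)
  case (pCons a p)
  have "transpose_mat (A * poly_mat p A) = transpose_mat (poly_mat p A) * transpose_mat A"
    using A by (intro transpose_mult) auto
  also have "\<dots> = transpose_mat A * poly_mat p (transpose_mat A)"
    unfolding pCons.IH using A
    by (intro poly_mat_intertwine[symmetric, of _ n _ n]) auto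
  moreover have "transpose_mat (a \<cdot>\<^sub>m 1\<^sub>m n + A * poly_mat p A)
      = a \<cdot>\<^sub>m 1\<^sub>m n + transpose_mat (A * poly_mat p A)"
    using A by (intro eq_matI) auto
  ultimately show ?case
    using A by (simp add: poly_mat_pCons)
qed (use A in simp)

lemma (in comm_ring_hom) poly_mat_hom:
  assumes A: "A \<in> carrier_mat n n"
  shows "mat_hom (poly_mat p A) = poly_mat (map_poly hom p) (mat_hom A)"
proof (induction p)
  case 0
  show ?case using A by (auto intro!: eq_matI)
next
  case (pCons a p)
  have "mat_hom (a \<cdot>\<^sub>m 1\<^sub>m n + A * poly_mat p A) = hom a \<cdot>\<^sub>m 1\<^sub>m n + mat_hom (A * poly_mat p A)"
    using A by (intro eq_matI) (auto simp: hom_distribs)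
  also have "mat_hom (A * poly_mat p A) = mat_hom A * mat_hom (poly_mat p A)"
    using A by (intro mat_hom_mult) auto
  finally show ?case
    using A pCons by (simp add: poly_mat_pCons map_poly_pCons)
qed

lemma finite_carrier_mat [simp]: "finite (carrier_mat n m :: 'a::finite mat set)"
proof (rule finite_subset)
  show "carrier_mat n m \<subseteq> (\<lambda>f. mat n m f) ` (({..<n} \<times> {..<m}) \<rightarrow>\<^sub>E (UNIV :: 'a set))"
  proof
    fix A :: "'a mat" assume A: "A \<in> carrier_mat n m"
    let ?f = "restrict (\<lambda>ij. A $$ ij) ({..<n} \<times> {..<m})"
    have "A = mat n m ?f"
      using A by (intro eq_matI) auto
    moreover have "?f \<in> ({..<n} \<times> {..<m}) \<rightarrow>\<^sub>E UNIV" by auto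
    ultimately show "A \<in> (\<lambda>f. mat n m f) ` (({..<n} \<times> {..<m}) \<rightarrow>\<^sub>E UNIV)"
      by (rule image_eqI)
  qed
qed (intro finite_imageI finite_PiE; simp)

text \<open>
  By the pigeonhole principle \<open>A\<^bsup>i + d\<^esup> = A\<^sup>i\<close> for some \<open>d \<ge> 1\<close>; then \<open>A\<^sup>k\<close> is idempotent for
  every multiple \<open>k\<close> of \<open>d\<close> with \<open>k \<ge> i\<close>.
\<close>

lemma idempotent_power:
  assumes A: "(A :: 'a::{finite,comm_ring_1} mat) \<in> carrier_mat n n"
  obtains k where "k \<ge> 1" "A ^\<^sub>m (k + k) = A ^\<^sub>m k"
proof -
  have "range (\<lambda>i. A ^\<^sub>m i) \<subseteq> carrier_mat n n"
    using pow_carrier_mat[OF A] by (auto simp del: pow_mat.simps)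
  then have "finite (range (\<lambda>i. A ^\<^sub>m i))"
    by (rule finite_subset) (rule finite_carrier_mat)
  then have "\<not> inj (\<lambda>i. A ^\<^sub>m i)"
    using finite_imageD[of "\<lambda>i. A ^\<^sub>m i" UNIV] by auto
  then obtain i j where "A ^\<^sub>m i = A ^\<^sub>m j" "i \<noteq> j"
    unfolding inj_on_def by (auto simp del: pow_mat.simps)
  then obtain i d where d: "d \<ge> 1" "A ^\<^sub>m (i + d) = A ^\<^sub>m i"
  proof (cases "i < j")
    case True
    then show ?thesis using that[of "j - i" i] \<open>A ^\<^sub>m i = A ^\<^sub>m j\<close> by simp
  next
    case False
    then show ?thesis using that[of "i - j" j] \<open>A ^\<^sub>m i = A ^\<^sub>m j\<close> \<open>i \<noteq> j\<close> by simp
  qed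
  have 1: "A ^\<^sub>m (i + d * t) = A ^\<^sub>m i" for t
  proof (induction t)
    case (Suc t)
    have "A ^\<^sub>m (i + d * Suc t) = A ^\<^sub>m ((i + d * t) + d)"
      by (simp add: ac_simps)
    also have "\<dots> = A ^\<^sub>m (i + d)"
      unfolding pow_mat_add[OF A, of "i + d * t" d] Suc pow_mat_add[OF A, of i d] ..
    finally show ?case using d by simp
  qed simp
  define k where "k = d * (i + 1)"
  have k: "k \<ge> i" "k \<ge> 1" using d(1) by (cases d; simp add: k_def)+
  have "A ^\<^sub>m (k + k) = A ^\<^sub>m ((i + d * (i + 1)) + (k - i))"
    using k(1) by (intro arg_cong[where f = "\<lambda>k. A ^\<^sub>m k"]) (simp add: k_def)
  also have "\<dots> = A ^\<^sub>m (i + (k - i))"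
    unfolding pow_mat_add[OF A, of _ "k - i"] 1 ..
  also have "i + (k - i) = k" using k by simp
  finally show thesis by (rule that[OF k(2)])
qed

lemma pow_mat_inverse:
  fixes A :: "'a::comm_ring_1 mat"
  assumes A: "A \<in> carrier_mat n n" and B: "B \<in> carrier_mat n n" and AB: "A * B = 1\<^sub>m n"
  shows "A ^\<^sub>m k * B ^\<^sub>m k = 1\<^sub>m n"
proof (induction k)
  case (Suc k)
  have c: "A ^\<^sub>m k \<in> carrier_mat n n" "B ^\<^sub>m k \<in> carrier_mat n n" using A B by auto
  have "A ^\<^sub>m Suc k * B ^\<^sub>m Suc k = A ^\<^sub>m k * A * (B * B ^\<^sub>m k)"
    using B pow_mat_add[of B n 1 k] by simp
  also have "\<dots> = A ^\<^sub>m k * (A * B) * B ^\<^sub>m k"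
    using A B c by (simp add: assoc_mult_mat[of _ n n _ n _ n] mult_carrier_mat[of _ n n _ n])
  finally show ?case using A B Suc AB by simp
qed (use A B in simp)

text \<open>
  Some power of \<open>A\<close> is idempotent, and an invertible idempotent is the identity.
\<close>

lemma invertible_finite_order:
  assumes A: "(A :: 'a::{finite,comm_ring_1} mat) \<in> carrier_mat n n" and B: "B \<in> carrier_mat n n"
    and AB: "A * B = 1\<^sub>m n"
  obtains k where "k \<ge> 1" "A ^\<^sub>m k = 1\<^sub>m n"
proof -
  note inv = pow_mat_inverse[OF A B AB]
  obtain k where k: "k \<ge> 1" "A ^\<^sub>m (k + k) = A ^\<^sub>m k"
    using A by (rule idempotent_power)
  have c: "A ^\<^sub>m k \<in> carrier_mat n n" "B ^\<^sub>m k \<in> carrier_mat n n"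
    using A B by auto
  have "A ^\<^sub>m k = A ^\<^sub>m k * (A ^\<^sub>m k * B ^\<^sub>m k)"
    unfolding inv by (rule right_mult_one_mat[OF c(1), symmetric])
  also have "\<dots> = A ^\<^sub>m (k + k) * B ^\<^sub>m k"
    unfolding pow_mat_add[OF A] by (rule assoc_mult_mat[symmetric, OF c(1) c(1) c(2)])
  also have "\<dots> = 1\<^sub>m n" unfolding k by (rule inv)
  finally show thesis by (rule that[OF k(1)])
qed

section \<open>Norms and Hilbert's Theorem 90\<close>

lemma (in group_hom) card_kernel_image:
  assumes fin: "finite (carrier G)"
  shows "card (carrier G) = card (kernel G H h) * card (h ` carrier G)"
proof -
  let ?F = "\<lambda>y. {x \<in> carrier G. h x = y}"
  have fibre: "card (?F y) = card (kernel G H h)" if y: "y \<in> h ` carrier G" for y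
  proof -
    obtain x where x: "x \<in> carrier G" "y = h x" using y by auto
    have "bij_betw (\<lambda>k. k \<otimes> x) (kernel G H h) (?F y)"
      by (rule bij_betwI[where g = "\<lambda>z. z \<otimes> inv x"])
         (use x in \<open>auto simp: kernel_def G.m_assoc\<close>)
    then show ?thesis by (simp add: bij_betw_same_card)
  qed
  have "carrier G = (\<Union>y\<in>h ` carrier G. ?F y)" by auto
  then have "card (carrier G) = (\<Sum>y\<in>h ` carrier G. card (?F y))"
    using fin by (subst card_UN_disjoint[symmetric]) auto
  also have "\<dots> = (\<Sum>y\<in>h ` carrier G. card (kernel G H h))"
    by (intro sum.cong fibre) auto
  finally show ?thesis by simp
qed

text \<open>
  Put \<open>N d = d \<phi>(d)\<close> and \<open>B d = d \<phi>(d)\<^bsup>-1\<^esup>\<close>.  The kernel of \<open>B\<close> consists of fixed points of \<open>\<phi>\<close>, which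
  are norms by assumption, so \<open>|ker B| \<le> |im N|\<close>.  As \<open>|ker N| |im N| = |ker B| |im B|\<close>, it follows that
  \<open>|ker N| \<le> |im B|\<close>, and the inclusion of \<open>im B\<close> in \<open>ker N\<close> is an equality.
\<close>

lemma (in comm_group) hilbert90_counting:
  assumes fin: "finite (carrier G)" and hom: "\<phi> \<in> hom G G"
    and invol: "\<And>x. x \<in> carrier G \<Longrightarrow> \<phi> (\<phi> x) = x"
    and norm: "\<And>r. r \<in> carrier G \<Longrightarrow> \<phi> r = r \<Longrightarrow> \<exists>d\<in>carrier G. r = d \<otimes> \<phi> d"
    and z: "z \<in> carrier G" "z \<otimes> \<phi> z = \<one>"
  obtains c where "c \<in> carrier G" "z = c \<otimes> inv (\<phi> c)"
proof -
  interpret \<phi>: group_hom G G \<phi>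
    by unfold_locales (rule hom)
  let ?N = "\<lambda>d. d \<otimes> \<phi> d" and ?B = "\<lambda>d. d \<otimes> inv (\<phi> d)"
  interpret N: group_hom G G ?N
    by unfold_locales (auto simp: hom_def m_ac)
  interpret B: group_hom G G ?B
    by unfold_locales (auto simp: hom_def m_ac inv_mult)
  have "kernel G G ?B \<subseteq> ?N ` carrier G"
  proof
    fix r assume "r \<in> kernel G G ?B"
    then have r: "r \<in> carrier G" "r \<otimes> inv (\<phi> r) = \<one>" by (auto simp: kernel_def)
    then have "\<phi> r = r"
      using inv_equality[of r "inv (\<phi> r)"] by (simp add: inv_inv)
    then show "r \<in> ?N ` carrier G" using norm r by blast
  qed
  then have "card (kernel G G ?B) \<le> card (?N ` carrier G)"
    using fin by (intro card_mono) auto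
  then have "card (kernel G G ?N) * card (kernel G G ?B) \<le> card (carrier G)"
    unfolding N.card_kernel_image[OF fin] by simp
  also have "\<dots> = card (?B ` carrier G) * card (kernel G G ?B)"
    unfolding B.card_kernel_image[OF fin] by simp
  finally have "card (kernel G G ?N) \<le> card (?B ` carrier G) \<or> card (kernel G G ?B) = 0"
    by auto
  moreover have "\<one> \<in> kernel G G ?B" "finite (kernel G G ?B)" "finite (kernel G G ?N)"
    using fin by (auto simp: kernel_def)
  ultimately have "card (kernel G G ?N) \<le> card (?B ` carrier G)" by auto
  moreover have "?B ` carrier G \<subseteq> kernel G G ?N"
  proof
    fix y assume "y \<in> ?B ` carrier G"
    then obtain d where d: "d \<in> carrier G" "y = d \<otimes> inv (\<phi> d)" by auto
    have "\<phi> y = inv y"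
      using d by (simp add: invol inv_mult m_comm)
    then show "y \<in> kernel G G ?N" using d by (simp add: kernel_def)
  qed
  ultimately have "?B ` carrier G = kernel G G ?N"
    using \<open>finite (kernel G G ?N)\<close> by (intro card_seteq)
  moreover have "z \<in> kernel G G ?N" using z by (simp add: kernel_def)
  ultimately have "z \<in> ?B ` carrier G" by simp
  then show thesis using that by (elim imageE) simp
qed

lemma pcompose_monom: "pcompose (monom 1 k) p = (p :: 'a::comm_ring_1 poly) ^ k"
  by (induction k) (simp_all add: monom_0 monom_Suc pcompose_pCons pcompose_1 one_pCons[symmetric])

context
  fixes q :: nat
  assumes q: "primepow q" "CARD('a::{field,finite}) = q\<^sup>2"
begin

lemma conj_poly_pcompose_monom:
  "conj_poly q (pcompose p (monom 1 m)) = pcompose (conj_poly q p) (monom (1 :: 'a) m)"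
proof (induction p)
  case 0
  show ?case by (simp only: pcompose_0 conj_poly_0[OF q])
next
  case (pCons a p)
  then show ?case
    by (simp only: pcompose_pCons conj_poly_simps(1)[OF q] conj_poly_pCons[OF q] conj_poly_0[OF q]
        conj_poly_mult[OF q] conj_poly_monom[OF q] power_one)
qed

text \<open>
  Write \<open>k = 2\<^sup>t m\<close> with \<open>m\<close> odd.  Substituting \<open>X\<^sup>m\<close> into a solution modulo \<open>X\<^bsup>2 ^ t\<^esup> - 1\<close> gives \<open>c\<close> with
  norm \<open>X\<^sup>m\<close> modulo \<open>X\<^sup>k - 1\<close>.  The factor \<open>X\<^sup>j\<close> changes this norm by \<open>X\<^bsup>2 j\<^esup>\<close>, and as \<open>m\<close> is odd, the exponent
  \<open>m + 2 j\<close> can be made congruent to \<open>1\<close> modulo \<open>k\<close>.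
\<close>

lemma norm_poly_cyclic:
  assumes "k \<ge> 1"
  obtains p where "monom (1 :: 'a) k - 1 dvd p * conj_poly q p - monom 1 1"
proof -
  obtain t m where k: "k = 2 ^ t * m" "odd m"
  proof (rule multiplicity_decompose'[of k 2])
    show "k \<noteq> 0" "\<not> is_unit (2 :: nat)" using assms by auto
  qed
  let ?M = "monom (1 :: 'a) m" and ?X = "monom (1 :: 'a) 1"
  obtain c where "monom 1 (2 ^ t) - [:1:] dvd c * conj_poly q c - ?X"
    using norm_poly_2power[OF q power_one one_neq_zero, of t] by (elim exE)
  then have "pcompose (monom 1 (2 ^ t) - [:1:]) ?M dvd pcompose (c * conj_poly q c - ?X) ?M"
    by (auto simp: dvd_def pcompose_mult)
  moreover have "pcompose (monom 1 (2 ^ t) - [:1:]) ?M = monom 1 k - 1"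
    by (simp add: pcompose_diff pcompose_monom monom_power k(1) mult.commute pcompose_1 flip: one_pCons)
  ultimately have dvd: "monom 1 k - 1 dvd pcompose c ?M * conj_poly q (pcompose c ?M) - ?M"
    unfolding conj_poly_pcompose_monom by (simp add: pcompose_diff pcompose_mult pcompose_monom)
  \<comment> \<open>Modulo \<open>k\<close> this is \<open>- (m - 1) / 2\<close>.\<close>
  define j where "j = (k - 1) * ((m - 1) div 2)"
  have j: "m + 2 * j = 1 + k * (m - 1)"
  proof -
    obtain k' m' where "k = Suc k'" "m = Suc (2 * m')"
      using assms k(2) by (metis Suc_le_D One_nat_def oddE Suc_eq_plus1)
    then show ?thesis by (simp add: j_def algebra_simps)
  qed
  define p where "p = monom 1 j * pcompose c ?M"
  have "p * conj_poly q p - ?X = monom 1 (2 * j) * (pcompose c ?M * conj_poly q (pcompose c ?M) - ?M)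
      + (monom 1 (m + 2 * j) - ?X)"
  proof -
    have "monom (1::'a) (m + 2 * j) = monom 1 (2 * j) * ?M" "monom (1::'a) (2 * j) = monom 1 j * monom 1 j"
      by (simp_all add: mult_monom mult_2 add.commute)
    then show ?thesis
      unfolding p_def conj_poly_mult[OF q] conj_poly_monom[OF q] by (simp add: algebra_simps)
  qed
  moreover have "monom 1 k - 1 dvd monom 1 (m + 2 * j) - ?X"
  proof -
    have "monom (1::'a) k - 1 dvd monom 1 k ^ (m - 1) - 1 ^ (m - 1)"
      by (simp only: power_diff_sumr2 dvd_triv_left)
    moreover have "monom (1::'a) (m + 2 * j) - ?X = ?X * (monom 1 k ^ (m - 1) - 1 ^ (m - 1))"
      unfolding j by (simp add: monom_power mult_monom algebra_simps)
    ultimately show ?thesis by simp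
  qed
  ultimately have "monom 1 k - 1 dvd p * conj_poly q p - ?X"
    using dvd by (metis dvd_add dvd_mult)
  then show thesis by (rule that)
qed

end

lemma poly_mat_pcompose:
  assumes A: "A \<in> carrier_mat n n"
  shows "poly_mat (pcompose p r) A = poly_mat p (poly_mat r A)"
proof (induction p)
  case 0
  show ?case by (simp add: poly_mat_0[OF A] poly_mat_0[OF poly_mat_carrier[OF A]])
next
  case (pCons a p)
  have "poly_mat (pcompose (pCons a p) r) A = poly_mat ([:a:] + r * pcompose p r) A"
    by (simp add: pcompose_pCons)
  also have "\<dots> = a \<cdot>\<^sub>m 1\<^sub>m n + poly_mat r A * poly_mat p (poly_mat r A)"
    by (simp only: poly_mat_add[OF A] poly_mat_mult[OF A] poly_mat_const[OF A] pCons)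
  also have "\<dots> = poly_mat (pCons a p) (poly_mat r A)"
    using A by (intro poly_mat_pCons[symmetric]) auto
  finally show ?case .
qed

lemma mult_cancel_inverse_mat:
  assumes "A * B = 1\<^sub>m n" "A \<in> carrier_mat n n" "B \<in> carrier_mat n n" "X \<in> carrier_mat n m"
  shows "A * (B * X) = (X :: 'a::semiring_1 mat)"
  using assms by (simp add: assoc_mult_mat[symmetric, of A n n B n X m])

lemma carrier_GL_iff:
  "X \<in> carrier (GL TYPE('a::field) n) \<longleftrightarrow> X \<in> carrier_mat n n \<and> (\<exists>Y\<in>carrier_mat n n. X * Y = 1\<^sub>m n)"
  unfolding carrier_GL using mat_mult_left_right_inverse by blast

context
  fixes q :: nat
  assumes q: "primepow q" "CARD('a::{field,finite}) = q\<^sup>2"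
begin

text \<open>
  If \<open>r\<^sup>k = 1\<close>, then congruences modulo \<open>X\<^sup>k - 1\<close> become equations on substituting \<open>r\<close> for \<open>X\<close>.
\<close>

lemma norm_mat:
  assumes r: "r \<in> carrier_mat n n" and "s \<in> carrier_mat n n" "r * s = 1\<^sub>m n"
  obtains p where "poly_mat p r * poly_mat (conj_poly q p) r = (r :: 'a mat)"
proof -
  obtain k where k: "k \<ge> 1" "r ^\<^sub>m k = 1\<^sub>m n"
    using invertible_finite_order[OF assms] .
  obtain p where "monom (1 :: 'a) k - 1 dvd p * conj_poly q p - monom 1 1"
    using norm_poly_cyclic[OF q k(1)] .
  then obtain h where h: "p * conj_poly q p - monom 1 1 = (monom 1 k - 1) * h"
    by (rule dvdE)
  have "p * conj_poly q p + h = monom 1 k * h + monom 1 1"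
    using h by (simp add: algebra_simps)
  then have "poly_mat (p * conj_poly q p + h) r = poly_mat (monom 1 k * h + monom 1 1) r"
    by (rule arg_cong)
  then have eq: "poly_mat (p * conj_poly q p) r + poly_mat h r = poly_mat h r + r"
    using r k(2) by (simp add: poly_mat_add poly_mat_mult[of r n "monom 1 k"] poly_mat_monom[of r n k])
  have "poly_mat (p * conj_poly q p) r = r"
  proof (rule eq_matI)
    fix i j assume "i < dim_row r" "j < dim_col r"
    then show "poly_mat (p * conj_poly q p) r $$ (i, j) = r $$ (i, j)"
      using arg_cong[OF eq, of "\<lambda>M. M $$ (i, j)"] r by simp
  qed (use r in auto)
  then show thesis by (intro that) (simp add: poly_mat_mult[OF r])
qed

lemma frobenius_hom: "comm_ring_hom (\<lambda>x :: 'a. x ^ q)"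
  by unfold_locales (use q_pos[OF q] in \<open>simp_all add: add_q[OF q] power_mult_distrib\<close>)

lemma frobenius_poly_mat:
  assumes "A \<in> carrier_mat n n"
  shows "map_mat (\<lambda>x :: 'a. x ^ q) (poly_mat p A) = poly_mat (conj_poly q p) (map_mat (\<lambda>x. x ^ q) A)"
  unfolding conj_poly_def by (rule comm_ring_hom.poly_mat_hom[OF frobenius_hom assms])

lemma conj_trans_poly_mat:
  assumes A: "A \<in> carrier_mat n n"
  shows "conj_trans q (poly_mat p A :: 'a mat) = poly_mat (conj_poly q p) (conj_trans q A)"
proof -
  have "map_mat (\<lambda>x. x ^ q) A \<in> carrier_mat n n" using A by simp
  then show ?thesis
    unfolding conj_trans_def frobenius_poly_mat[OF A] by (rule poly_mat_transpose)
qed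

text \<open>
  The map \<open>\<phi>\<close> will be the Frobenius map on the entries, or \<open>x \<mapsto> g\<^bsup>-1\<^esup> x\<^sup>* g\<close>, which reverses products;
  on the polynomials in one matrix both are semilinear ring homomorphisms.  Since \<open>\<phi>(z)\<close> is the inverse of
  \<open>z\<close>, it is a power of \<open>z\<close>, so that \<open>\<phi>\<close> acts as an involution on the finite abelian group \<open>D\<close> of
  invertible polynomials in \<open>z\<close>.  A fixed point \<open>r\<close> of \<open>\<phi>\<close> in \<open>D\<close> is a norm \<open>p(r) \<phi>(p(r))\<close> by \<open>norm_mat\<close>.
\<close>

lemma hilbert90_mat:
  fixes \<phi> :: "'a mat \<Rightarrow> 'a mat"
  assumes \<phi>: "\<And>x. x \<in> carrier_mat n n \<Longrightarrow> \<phi> x \<in> carrier_mat n n"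
    and poly: "\<And>p x. x \<in> carrier_mat n n \<Longrightarrow> \<phi> (poly_mat p x) = poly_mat (conj_poly q p) (\<phi> x)"
    and z: "z \<in> carrier_mat n n" "z * \<phi> z = 1\<^sub>m n"
  obtains p d where "d \<in> carrier_mat n n" "poly_mat p z * d = 1\<^sub>m n"
    "z * \<phi> (poly_mat p z) = poly_mat p z"
proof -
  let ?GL = "GL TYPE('a) n"
  interpret GL: group ?GL by (rule group_GL)
  define D where "D = {c \<in> carrier ?GL. \<exists>p. c = poly_mat p z}"
  have Dc: "c \<in> carrier_mat n n" if "c \<in> D" for c
    using that by (simp add: D_def carrier_GL_iff)
  have DI: "poly_mat p z \<in> D" if "poly_mat p z * d = 1\<^sub>m n" "d \<in> carrier_mat n n" for p d
    unfolding D_def carrier_GL_iff using that poly_mat_carrier[OF z(1)] by auto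
  have Dinv: "\<exists>r. poly_mat p z * poly_mat r z = 1\<^sub>m n" if pD: "poly_mat p z \<in> D" for p
  proof -
    obtain d where d: "d \<in> carrier_mat n n" "poly_mat p z * d = 1\<^sub>m n"
      using pD unfolding D_def carrier_GL_iff by auto
    obtain k where k: "k \<ge> 1" "poly_mat p z ^\<^sub>m k = 1\<^sub>m n"
      using invertible_finite_order[OF poly_mat_carrier[OF z(1)] d] .
    have "poly_mat p z * poly_mat (p ^ (k - 1)) z = poly_mat (p ^ k) z"
      using k(1) z by (simp add: poly_mat_mult[OF z(1), symmetric] flip: power_Suc)
    also have "p ^ k = pcompose (monom 1 k) p" by (simp add: pcompose_monom)
    also have "poly_mat \<dots> z = 1\<^sub>m n"
      using z k(2) by (simp only: poly_mat_pcompose poly_mat_monom[OF poly_mat_carrier])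
    finally show ?thesis by blast
  qed
  have sub: "subgroup D ?GL"
  proof (rule GL.subgroupI)
    show "D \<subseteq> carrier ?GL" by (auto simp: D_def)
    have "poly_mat 1 z \<in> D" by (rule DI[where d = "1\<^sub>m n"]) (use z in auto)
    then show "D \<noteq> {}" by auto
  next
    fix c assume c: "c \<in> D"
    then obtain p where p: "c = poly_mat p z" by (auto simp: D_def)
    then obtain r where r: "c * poly_mat r z = 1\<^sub>m n" using Dinv c by blast
    then have r': "poly_mat r z * c = 1\<^sub>m n"
      using z p by (simp add: poly_mat_commute)
    then have "poly_mat r z \<in> D"
      by (rule DI) (use p z in simp)
    moreover have "inv\<^bsub>?GL\<^esub> c = poly_mat r z"
      using r' c \<open>poly_mat r z \<in> D\<close> by (intro GL.inv_equality) (auto simp: D_def)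
    ultimately show "inv\<^bsub>?GL\<^esub> c \<in> D" by simp
  next
    fix c d assume "c \<in> D" "d \<in> D"
    then obtain p r where "c = poly_mat p z" "d = poly_mat r z" by (auto simp: D_def)
    moreover have "c \<otimes>\<^bsub>?GL\<^esub> d \<in> carrier ?GL"
      using \<open>c \<in> D\<close> \<open>d \<in> D\<close> by (intro GL.m_closed) (auto simp: D_def)
    ultimately show "c \<otimes>\<^bsub>?GL\<^esub> d \<in> D"
      using z by (auto simp: D_def poly_mat_mult[symmetric])
  qed
  define G where "G = ?GL\<lparr>carrier := D\<rparr>"
  have Gs [simp]: "carrier G = D" "monoid.mult G = (*)" "one G = 1\<^sub>m n"
    by (simp_all add: G_def)
  have "group G" unfolding G_def by (rule GL.subgroup_imp_group[OF sub])
  then interpret G: group G .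
  interpret G: comm_group G
  proof (rule G.group_comm_groupI)
    fix c d assume "c \<in> carrier G" "d \<in> carrier G"
    then show "c \<otimes>\<^bsub>G\<^esub> d = d \<otimes>\<^bsub>G\<^esub> c"
      using z by (auto simp: D_def intro: poly_mat_commute)
  qed
  obtain k where k: "k \<ge> 1" "z ^\<^sub>m k = 1\<^sub>m n"
    using invertible_finite_order[OF z(1) \<phi>[OF z(1)] z(2)] .
  have z': "\<phi> z * z = 1\<^sub>m n"
    by (rule mat_mult_left_right_inverse[OF z(1) \<phi>[OF z(1)] z(2)])
  have \<phi>z: "\<phi> z = poly_mat (monom 1 (k - 1)) z"
  proof -
    have "z ^\<^sub>m k = z ^\<^sub>m (k - 1) * z" using k(1) by (cases k) auto
    then have e: "z ^\<^sub>m (k - 1) * z = 1\<^sub>m n" using k(2) by simp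
    have "\<phi> z = (z ^\<^sub>m (k - 1) * z) * \<phi> z"
      unfolding e by (rule left_mult_one_mat[symmetric, OF \<phi>[OF z(1)]])
    also have "\<dots> = z ^\<^sub>m (k - 1) * (z * \<phi> z)"
      using z(1) \<phi>[OF z(1)] by (intro assoc_mult_mat) auto
    also have "\<dots> = z ^\<^sub>m (k - 1)"
      unfolding z(2) using z(1) by (intro right_mult_one_mat) auto
    finally show ?thesis using z(1) by (simp add: poly_mat_monom)
  qed
  \<comment> \<open>Applying \<open>\<phi>\<close> to \<open>\<phi> z = z ^ (k - 1)\<close> yields \<open>(\<phi> z) ^ (k - 1)\<close>, the inverse of \<open>\<phi> z\<close>.\<close>
  have \<phi>\<phi>z: "\<phi> (\<phi> z) = z"
  proof -
    have "\<phi> (\<phi> z) = poly_mat (conj_poly q (monom 1 (k - 1))) (\<phi> z)"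
      by (subst \<phi>z) (rule poly[OF z(1)])
    also have "\<dots> = \<phi> z ^\<^sub>m (k - 1)"
      using \<phi>[OF z(1)] by (simp add: conj_poly_monom[OF q] poly_mat_monom)
    finally have 1: "\<phi> (\<phi> z) = \<phi> z ^\<^sub>m (k - 1)" .
    have "\<phi> z ^\<^sub>m k = poly_mat (conj_poly q (monom 1 k)) (\<phi> z)"
      using \<phi>[OF z(1)] by (simp add: conj_poly_monom[OF q] poly_mat_monom)
    also have "\<dots> = \<phi> (poly_mat (monom 1 k) z)" by (rule poly[OF z(1), symmetric])
    also have "\<dots> = \<phi> (poly_mat 1 z)" using z(1) k(2) by (simp add: poly_mat_monom)
    also have "\<dots> = 1\<^sub>m n"
      using \<phi>[OF z(1)] by (simp only: poly[OF z(1)] conj_poly_1[OF q] poly_mat_1)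
    finally have 2: "\<phi> z ^\<^sub>m k = 1\<^sub>m n" .
    have "\<phi> z ^\<^sub>m k = \<phi> z ^\<^sub>m (k - 1) * \<phi> z" using k(1) by (cases k) auto
    then have e: "\<phi> z ^\<^sub>m (k - 1) * \<phi> z = 1\<^sub>m n" using 2 by simp
    have "z = (\<phi> z ^\<^sub>m (k - 1) * \<phi> z) * z"
      unfolding e by (rule left_mult_one_mat[symmetric, OF z(1)])
    also have "\<dots> = \<phi> z ^\<^sub>m (k - 1) * (\<phi> z * z)"
      using z(1) \<phi>[OF z(1)] by (intro assoc_mult_mat) auto
    also have "\<dots> = \<phi> z ^\<^sub>m (k - 1)"
      unfolding z' using \<phi>[OF z(1)] by (intro right_mult_one_mat) auto
    finally show ?thesis using 1 by simp
  qed
  have \<phi>_poly: "\<phi> (poly_mat p z) = poly_mat (pcompose (conj_poly q p) (monom 1 (k - 1))) z" for p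
    unfolding poly[OF z(1)] by (simp only: \<phi>z poly_mat_pcompose[OF z(1)])
  have \<phi>_mult: "\<phi> (poly_mat p z * poly_mat r z) = \<phi> (poly_mat p z) * \<phi> (poly_mat r z)" for p r
    unfolding poly_mat_mult[OF z(1), symmetric] poly[OF z(1)] conj_poly_mult[OF q]
    by (rule poly_mat_mult[OF \<phi>[OF z(1)]])
  have \<phi>_one: "\<phi> (1\<^sub>m n) = 1\<^sub>m n"
    using poly[OF z(1), of 1] z(1) \<phi>[OF z(1)] by (simp only: poly_mat_1 conj_poly_1[OF q])
  have \<phi>D: "\<phi> c \<in> D" if c: "c \<in> D" for c
  proof -
    obtain p where p: "c = poly_mat p z" using c by (auto simp: D_def)
    then obtain r where "poly_mat p z * poly_mat r z = 1\<^sub>m n" using Dinv c by blast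
    then have "\<phi> (poly_mat p z) * \<phi> (poly_mat r z) = 1\<^sub>m n"
      using \<phi>_one by (simp only: \<phi>_mult[symmetric])
    then show ?thesis
      unfolding p using \<phi>[OF poly_mat_carrier[OF z(1)]] unfolding \<phi>_poly[of p] by (rule DI)
  qed
  have hom: "\<phi> \<in> hom G G"
    by (rule homI) (auto simp: \<phi>D, auto simp: D_def \<phi>_mult)
  have fin: "finite (carrier G)"
    using finite_subset[OF _ finite_carrier_mat[of n n]] Dc by (metis Gs(1) subsetI)
  have invol: "\<phi> (\<phi> c) = c" if "c \<in> carrier G" for c
    using that \<phi>[OF z(1)] by (auto simp: D_def poly z(1) \<phi>\<phi>z conj_poly_simps(4)[OF q])
  have norm: "\<exists>d\<in>carrier G. r = d \<otimes>\<^bsub>G\<^esub> \<phi> d" if r: "r \<in> carrier G" and fixed: "\<phi> r = r" for r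
  proof -
    obtain t where t: "r = poly_mat t z" using r by (auto simp: D_def)
    have rc: "r \<in> carrier_mat n n" using r Dc by simp
    obtain s where s: "s \<in> carrier_mat n n" "r * s = 1\<^sub>m n"
      using r by (auto simp: D_def carrier_GL_iff)
    obtain p where p: "poly_mat p r * poly_mat (conj_poly q p) r = r"
      using norm_mat[OF rc s] .
    have "poly_mat p r * (poly_mat (conj_poly q p) r * s) = (poly_mat p r * poly_mat (conj_poly q p) r) * s"
      by (rule assoc_mult_mat[symmetric, OF poly_mat_carrier[OF rc] poly_mat_carrier[OF rc] s(1)])
    then have e: "poly_mat p r * (poly_mat (conj_poly q p) r * s) = 1\<^sub>m n"
      unfolding p s(2) .
    have "poly_mat (conj_poly q p) r * s \<in> carrier_mat n n"
      by (rule mult_carrier_mat[OF poly_mat_carrier[OF rc] s(1)])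
    with e have "poly_mat p r \<in> D"
      unfolding t poly_mat_pcompose[OF z(1), symmetric] by (rule DI)
    moreover have "r = poly_mat p r * \<phi> (poly_mat p r)"
      unfolding poly[OF rc] fixed using p by simp
    ultimately show ?thesis by auto
  qed
  have zG: "z \<in> carrier G" "z \<otimes>\<^bsub>G\<^esub> \<phi> z = \<one>\<^bsub>G\<^esub>"
    using z DI[of "monom 1 1" "\<phi> z"] \<phi> by auto
  obtain c where c: "c \<in> carrier G" "z = c \<otimes>\<^bsub>G\<^esub> inv\<^bsub>G\<^esub> (\<phi> c)"
    using G.hilbert90_counting[OF fin hom invol norm zG] .
  have "\<phi> c \<in> carrier G" using \<phi>D c(1) by simp
  then have "z \<otimes>\<^bsub>G\<^esub> \<phi> c = c"
    by (subst c(2)) (use c(1) in \<open>simp only: G.m_assoc G.inv_closed G.l_inv G.r_one\<close>)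
  moreover obtain p where p: "c = poly_mat p z" using c(1) by (auto simp: D_def)
  moreover obtain d where "d \<in> carrier_mat n n" "c * d = 1\<^sub>m n"
    using c(1) by (auto simp: D_def carrier_GL_iff)
  ultimately show thesis using that by auto
qed

end

section \<open>Hermitian matrices and descent up to similarity\<close>

lemma similar_mat_intertwineI:
  assumes "A \<in> carrier_mat n n" "B \<in> carrier_mat n n" "g \<in> carrier_mat n n" "h \<in> carrier_mat n n"
    and gh: "g * h = 1\<^sub>m n" and eq: "A * g = g * B"
  shows "similar_mat A (B :: 'a::field mat)"
proof -
  have hg: "h * g = 1\<^sub>m n" using assms by - (rule mat_mult_left_right_inverse, auto)
  have "A = A * (g * h)" using assms(1) unfolding gh by simp
  also have "\<dots> = A * g * h" using assms(1,3,4) by (intro assoc_mult_mat[symmetric])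
  finally have "A = A * g * h" .
  then have "A = g * B * h" by (simp add: eq)
  then have "similar_mat_wit A B g h"
    by (intro similar_mat_witI[of _ _ n]) (use assms hg in auto)
  then show ?thesis by (auto simp: similar_mat_def)
qed

lemma similar_mat_intertwineE:
  assumes "similar_mat A B" "A \<in> carrier_mat n n"
  obtains g h where "g \<in> carrier_mat n n" "h \<in> carrier_mat n n" "g * h = 1\<^sub>m n" "h * g = 1\<^sub>m n"
    "A * g = g * (B :: 'a::field mat)" "h * A = B * h" "B \<in> carrier_mat n n"
proof -
  obtain g h where w: "similar_mat_wit A B g h" using assms by (auto simp: similar_mat_def)
  note W = similar_mat_witD2[OF assms(2) w]
  have c: "g \<in> carrier_mat n n" "h \<in> carrier_mat n n" "B \<in> carrier_mat n n" using W by auto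
  have "g * B * h * g = g * B * (h * g)"
    using c by (intro assoc_mult_mat) auto
  then have 1: "A * g = g * B" using W c by simp
  have "h * (g * (B * h)) = h * g * (B * h)"
    using c by (intro assoc_mult_mat[symmetric]) auto
  then have 2: "h * A = B * h" using W c by (simp add: assoc_mult_mat[of g n n B n h n])
  show thesis by (rule that[of g h]) (use 1 2 W c in auto)
qed

lemma inverse_commute_mat:
  assumes "d \<in> carrier_mat n n" "c * d = 1\<^sub>m n" "d * c = 1\<^sub>m n" "c \<in> carrier_mat n n"
    "H \<in> carrier_mat n n" "H * c = c * (H :: 'a::semiring_1 mat)"
  shows "d * H = H * d"
proof -
  have "d * H = d * (H * (c * d))" using assms(2,5) by simp
  also have "\<dots> = d * ((H * c) * d)" using assms(1,4,5) by (simp add: assoc_mult_mat[of H n n c n d n])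
  also have "\<dots> = (d * c) * (H * d)"
    unfolding assms(6) using assms(1,4,5)
    by (simp add: assoc_mult_mat[of c n n H n d n] assoc_mult_mat[of d n n c n "H * d" n])
  finally show ?thesis using assms(1,3,5) by simp
qed

lemma intertwine_mult_mat:
  assumes "A \<in> carrier_mat n n" "B \<in> carrier_mat n n" "C \<in> carrier_mat n n"
    "g \<in> carrier_mat n n" "h \<in> carrier_mat n n"
    and gB: "A * g = g * B" and hC: "B * h = h * (C :: 'a::semiring_1 mat)"
  shows "A * (g * h) = g * h * C"
proof -
  have "A * (g * h) = A * g * h" using assms by (intro assoc_mult_mat[symmetric])
  also have "\<dots> = g * (B * h)" unfolding gB using assms by (intro assoc_mult_mat)
  also have "\<dots> = g * h * C" unfolding hC using assms by (intro assoc_mult_mat[symmetric])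
  finally show ?thesis .
qed

context
  fixes q :: nat
  assumes q: "primepow q" "CARD('a::{field,finite}) = q\<^sup>2"
begin

abbreviation frob :: "'a mat \<Rightarrow> 'a mat" where
  "frob A \<equiv> map_mat (\<lambda>x. x ^ q) A"

lemma frob_mult:
  "A \<in> carrier_mat l m \<Longrightarrow> B \<in> carrier_mat m n \<Longrightarrow> frob (A * B) = frob A * frob B"
  by (rule semiring_hom.mat_hom_mult) (use frobenius_hom[OF q] in \<open>simp add: comm_ring_hom_def ring_hom_def\<close>)

lemma frob_frob [simp]: "frob (frob A) = A"
  by (intro eq_matI) (auto simp: qq[OF q])

lemma frob_carrier_mat: "A \<in> carrier_mat n m \<Longrightarrow> frob A \<in> carrier_mat n m"
  by simp

lemma frob_one [simp]: "frob (1\<^sub>m n) = 1\<^sub>m n"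
  using q_pos[OF q] by (intro eq_matI) auto

text \<open>
  For Hermitian \<open>J\<close> the factors of \<open>J\<close> in \<open>norm_mat\<close> are \<open>P = p(J)\<close> and \<open>P\<^sup>*\<close>.  Applications use that \<open>P\<close>
  is a polynomial in \<open>J\<close>, which makes it commute with everything that commutes with \<open>J\<close>.
\<close>

lemma hermitian_gram:
  assumes J: "J \<in> carrier_mat n n" "K \<in> carrier_mat n n" "J * K = 1\<^sub>m n" and herm: "conj_trans q J = (J :: 'a mat)"
  obtains p e where "e \<in> carrier_mat n n" "poly_mat p J * e = 1\<^sub>m n" "e * poly_mat p J = 1\<^sub>m n"
    "conj_trans q (poly_mat p J) * poly_mat p J = J"
proof -
  obtain p where p: "poly_mat p J * poly_mat (conj_poly q p) J = J"
    using norm_mat[OF q J] .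
  let ?P = "poly_mat p J" and ?P' = "poly_mat (conj_poly q p) J"
  have c: "?P \<in> carrier_mat n n" "?P' \<in> carrier_mat n n" using J by auto
  have "?P * (?P' * K) = (?P * ?P') * K"
    by (rule assoc_mult_mat[symmetric]) (use c J in auto)
  then have e: "?P * (?P' * K) = 1\<^sub>m n" unfolding p J(3) .
  have ec: "?P' * K \<in> carrier_mat n n" using c J by auto
  have "?P' * K * ?P = 1\<^sub>m n"
    by (rule mat_mult_left_right_inverse[OF c(1) ec e])
  moreover have "conj_trans q ?P * ?P = J"
    unfolding conj_trans_poly_mat[OF q J(1)] herm using p poly_mat_commute[OF J(1)] by simp
  ultimately show thesis by (rule that[OF ec e])
qed

text \<open>
  A polar decomposition: if \<open>H' g = g H\<close>, then \<open>r = g\<^sup>* g\<close> is Hermitian and commutes with \<open>H\<close>.  With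
  \<open>c\<close> a polynomial in \<open>r\<close> such that \<open>c\<^sup>* c = r\<close>, the matrix \<open>u = g c\<^bsup>-1\<^esup>\<close> is unitary and still satisfies
  \<open>H' u = u H\<close>.
\<close>

lemma hermitian_similar_unitary:
  assumes H: "H \<in> carrier_mat n n" "H' \<in> carrier_mat n n"
    and herm: "conj_trans q H = (H :: 'a mat)" "conj_trans q H' = H'" and sim: "similar_mat H' H"
  obtains u where "u \<in> carrier_mat n n" "u * conj_trans q u = 1\<^sub>m n" "H' = u * H * conj_trans q u"
proof -
  obtain g h where g: "g \<in> carrier_mat n n" "h \<in> carrier_mat n n" "g * h = 1\<^sub>m n" "h * g = 1\<^sub>m n"
    "H' * g = g * H" by (rule similar_mat_intertwineE[OF sim H(2)])
  note asc = assoc_mult_mat[of _ n n _ n _ n] and mc [simp] = mult_carrier_mat[of _ n n _ n]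
  note ct = conj_trans_mult[OF q, of _ n n _ n]
  let ?gs = "conj_trans q g" and ?hs = "conj_trans q h"
  have gs: "?gs \<in> carrier_mat n n" "?hs \<in> carrier_mat n n" using g by auto
  have hgs: "?gs * ?hs = 1\<^sub>m n"
    unfolding ct[OF g(2,1), symmetric] g(4) by (rule conj_trans_one[OF q])
  have gsH: "?gs * H' = H * ?gs"
  proof -
    have "conj_trans q (H' * g) = conj_trans q (g * H)" by (simp only: g(5))
    then show ?thesis by (simp only: ct[OF H(2) g(1)] ct[OF g(1) H(1)] herm)
  qed
  let ?r = "?gs * g"
  have rs: "?r * (h * ?hs) = 1\<^sub>m n"
    using g gs hgs by (simp add: asc mc mult_cancel_inverse_mat[OF g(3), where m = n])
  have rh: "conj_trans q ?r = ?r"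
    unfolding ct[OF gs(1) g(1)] conj_trans_conj_trans[OF q] ..
  have rc: "?r \<in> carrier_mat n n" "h * ?hs \<in> carrier_mat n n" using g gs by auto
  obtain p d where d: "d \<in> carrier_mat n n" "poly_mat p ?r * d = 1\<^sub>m n" "d * poly_mat p ?r = 1\<^sub>m n"
    "conj_trans q (poly_mat p ?r) * poly_mat p ?r = ?r"
    using hermitian_gram[OF rc rs rh] .
  let ?c = "poly_mat p ?r"
  have c: "?c \<in> carrier_mat n n" "conj_trans q ?c \<in> carrier_mat n n" "conj_trans q d \<in> carrier_mat n n"
    using g gs d by (auto intro!: poly_mat_carrier)
  define u where "u = g * d"
  have u: "u \<in> carrier_mat n n" "conj_trans q u \<in> carrier_mat n n" using g d by (auto simp: u_def)
  have "conj_trans q u * u = conj_trans q d * (?r * d)"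
    unfolding u_def ct[OF g(1) d(1)] using g gs d c by (simp add: asc mc)
  also have "?r * d = conj_trans q ?c * (?c * d)"
    by (subst d(4)[symmetric]) (rule assoc_mult_mat[OF c(2,1) d(1)])
  also have "conj_trans q d * (conj_trans q ?c * (?c * d)) = conj_trans q (?c * d) * (?c * d)"
    unfolding ct[OF c(1) d(1)] using c d(1) by (simp only: asc mc)
  also have "\<dots> = 1\<^sub>m n" by (simp add: d(2) conj_trans_one[OF q])
  finally have "conj_trans q u * u = 1\<^sub>m n" .
  then have uu: "u * conj_trans q u = 1\<^sub>m n" using u by - (rule mat_mult_left_right_inverse, auto)
  have "H * ?r = (H * ?gs) * g" by (rule assoc_mult_mat[symmetric, OF H(1) gs(1) g(1)])
  also have "\<dots> = ?gs * (H' * g)"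
    unfolding gsH[symmetric] by (rule assoc_mult_mat[OF gs(1) H(2) g(1)])
  also have "\<dots> = ?r * H"
    unfolding g(5) by (rule assoc_mult_mat[symmetric, OF gs(1) g(1) H(1)])
  finally have "H * ?r = ?r * H" .
  then have "H * ?c = ?c * H"
    by (rule poly_mat_intertwine[OF rc(1) rc(1) H(1)])
  then have dH: "d * H = H * d"
    by (rule inverse_commute_mat[OF d(1,2,3) c(1) H(1)])
  have "H' * (g * d) = g * d * H"
    by (rule intertwine_mult_mat[OF H(2,1) H(1) g(1) d(1) g(5) dH[symmetric]])
  then have "H' * u = u * H" by (simp only: u_def)
  then have "u * H * conj_trans q u = H' * u * conj_trans q u" by simp
  also have "\<dots> = H' * (u * conj_trans q u)" by (rule assoc_mult_mat[OF H(2) u])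
  finally have "u * H * conj_trans q u = H' * (u * conj_trans q u)" .
  then have "H' = u * H * conj_trans q u" using H by (simp add: uu)
  then show thesis by (rule that[OF u(1) uu])
qed

text \<open>
  Write \<open>x'\<close> for the image of \<open>x\<close> under the Frobenius map.  If \<open>N g = g M\<close>, then \<open>z = g\<^bsup>-1\<^esup> g'\<close> commutes
  with \<open>M\<close> and \<open>z z' = 1\<close>.  Hilbert's Theorem 90 gives a polynomial \<open>c\<close> in \<open>z\<close> with \<open>z c' = c\<close>, which says
  that \<open>g c\<close> is fixed; and \<open>g c\<close> intertwines like \<open>g\<close>, since \<open>c\<close> commutes with \<open>M\<close>.
\<close>

lemma fixed_similar_descent:
  assumes MN: "M \<in> carrier_mat n n" "N \<in> carrier_mat n n"
    and fixed: "frob M = M" "frob N = N" and sim: "similar_mat N M"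
  obtains g h where "g \<in> carrier_mat n n" "h \<in> carrier_mat n n" "frob g = g" "frob h = h"
    "g * h = 1\<^sub>m n" "N * g = g * M"
proof -
  obtain g h where g: "g \<in> carrier_mat n n" "h \<in> carrier_mat n n" "g * h = 1\<^sub>m n" "h * g = 1\<^sub>m n"
    "N * g = g * M" "h * N = M * h" by (rule similar_mat_intertwineE[OF sim MN(2)])
  note asc = assoc_mult_mat[of _ n n _ n _ n] and mc [simp] = mult_carrier_mat[of _ n n _ n]
  note fm = frob_mult[of _ n n _ n]
  have fg: "frob g \<in> carrier_mat n n" "frob h \<in> carrier_mat n n" using g by auto
  have fgh: "frob g * frob h = 1\<^sub>m n" "N * frob g = frob g * M"
  proof -
    have "frob (g * h) = 1\<^sub>m n" "frob (N * g) = frob (g * M)" by (simp_all only: g(3,5) frob_one)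
    then show "frob g * frob h = 1\<^sub>m n" "N * frob g = frob g * M"
      by (simp_all only: fm[OF g(1,2)] fm[OF MN(2) g(1)] fm[OF g(1) MN(1)] fixed)
  qed
  define z where "z = h * frob g"
  have z: "z \<in> carrier_mat n n" using g by (simp add: z_def)
  have zz: "z * frob z = 1\<^sub>m n"
    using g fg by (simp add: z_def fm asc mc mult_cancel_inverse_mat[OF fgh(1), where m = n])
  obtain p d where d: "d \<in> carrier_mat n n" "poly_mat p z * d = 1\<^sub>m n"
    "z * frob (poly_mat p z) = poly_mat p z"
    using hilbert90_mat[of q n frob, OF q frob_carrier_mat frobenius_poly_mat[OF q] z zz] .
  let ?c = "poly_mat p z"
  have c: "?c \<in> carrier_mat n n" "frob ?c \<in> carrier_mat n n" using z by auto
  have "M * z = z * M"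
    unfolding z_def by (rule intertwine_mult_mat[OF MN(1,2,1) g(2) fg(1) g(6)[symmetric] fgh(2)])
  then have cM: "M * ?c = ?c * M"
    by (rule poly_mat_intertwine[OF z z MN(1)])
  have "g * ?c = g * (z * frob ?c)" by (simp only: d(3))
  also have "\<dots> = frob g * frob ?c"
    unfolding assoc_mult_mat[symmetric, OF g(1) z c(2)]
    unfolding z_def mult_cancel_inverse_mat[OF g(3,1,2) fg(1)] ..
  finally have fix1: "frob (g * ?c) = g * ?c" unfolding fm[OF g(1) c(1)] ..
  have gcdh: "(g * ?c) * (d * h) = 1\<^sub>m n"
    using g c d by (simp add: asc mc mult_cancel_inverse_mat[OF d(2), where m = n])
  then have dhgc: "(d * h) * (g * ?c) = 1\<^sub>m n"
    by (rule mat_mult_left_right_inverse[rotated 2]) (use g(1,2) c(1) d(1) in auto)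
  have "g * ?c * frob (d * h) = 1\<^sub>m n"
  proof -
    have "frob ((g * ?c) * (d * h)) = 1\<^sub>m n" by (simp only: gcdh frob_one)
    moreover have "frob ((g * ?c) * (d * h)) = frob (g * ?c) * frob (d * h)"
      using g(1,2) c d(1) by (intro fm) auto
    ultimately show ?thesis by (simp only: fix1)
  qed
  then have "(d * h) * (g * ?c * frob (d * h)) = d * h" using g d by simp
  moreover have "(d * h) * (g * ?c * frob (d * h)) = frob (d * h)"
    by (rule mult_cancel_inverse_mat[OF dhgc]) (use g c d in auto)
  ultimately have fix2: "frob (d * h) = d * h" by simp
  have "N * (g * ?c) = (g * ?c) * M"
    by (rule intertwine_mult_mat[OF MN(2,1,1) g(1) c(1) g(5) cM])
  then show thesis
    by (intro that[of "g * ?c" "d * h"]) (use g c d fix1 fix2 gcdh in auto)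
qed

text \<open>
  Write \<open>x'\<close> for the image of \<open>x\<close> under the Frobenius map, and let \<open>H' g = g H\<close>.  Then \<open>r = (g' g)\<^bsup>-1\<^esup>\<close>
  commutes with \<open>H\<close>.  Replacing \<open>g\<close> by \<open>G = g p(r)\<close>, where \<open>r\<close> is the norm of \<open>p(r)\<close> as in \<open>norm_mat\<close>,
  achieves \<open>G G' = 1\<close>.  Now Hilbert's Theorem 90 gives \<open>b\<close> with \<open>G b' = b\<close>, and \<open>b'\<^bsup>-1\<^esup> H b'\<close> is fixed.
\<close>

lemma frob_similar_fixed:
  assumes H: "H \<in> carrier_mat n n" and sim: "similar_mat (frob H) H"
  obtains M where "M \<in> carrier_mat n n" "frob M = M" "similar_mat M H"
proof -
  have fH: "frob H \<in> carrier_mat n n" using H by simp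
  obtain g h where g: "g \<in> carrier_mat n n" "h \<in> carrier_mat n n" "g * h = 1\<^sub>m n" "h * g = 1\<^sub>m n"
    "frob H * g = g * H" "h * frob H = H * h" by (rule similar_mat_intertwineE[OF sim fH])
  note asc = assoc_mult_mat[of _ n n _ n _ n] and mc [simp] = mult_carrier_mat[of _ n n _ n]
  note fm = frob_mult[of _ n n _ n]
  have fg: "frob g \<in> carrier_mat n n" "frob h \<in> carrier_mat n n" using g by auto
  have fgh: "frob g * frob h = 1\<^sub>m n" "frob h * frob g = 1\<^sub>m n" "frob h * H = frob H * frob h"
  proof -
    have "frob (g * h) = 1\<^sub>m n" "frob (h * g) = 1\<^sub>m n" "frob (h * frob H) = frob (H * h)"
      by (simp_all only: g(3,4,6) frob_one)
    then show "frob g * frob h = 1\<^sub>m n" "frob h * frob g = 1\<^sub>m n" "frob h * H = frob H * frob h"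
      by (simp_all only: fm[OF g(1,2)] fm[OF g(2,1)] fm[OF g(2) fH] fm[OF H g(2)] frob_frob)
  qed
  \<comment> \<open>Here \<open>h\<close> is the inverse of \<open>g\<close>, so this is the inverse of \<open>frob g * g\<close>.\<close>
  define r where "r = h * frob h"
  have r: "r \<in> carrier_mat n n" using g by (simp add: r_def)
  have rs: "r * (frob g * g) = 1\<^sub>m n" and sr: "(frob g * g) * r = 1\<^sub>m n"
    using g fg fgh by (simp_all add: r_def asc mc mult_cancel_inverse_mat[OF fgh(2), where m = n]
        mult_cancel_inverse_mat[OF g(3), where m = n])
  obtain p where p: "poly_mat p r * poly_mat (conj_poly q p) r = r"
    using norm_mat[OF q r mult_carrier_mat[OF fg(1) g(1)] rs] .
  let ?c = "poly_mat p r" and ?c' = "poly_mat (conj_poly q p) r"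
  have c: "?c \<in> carrier_mat n n" "?c' \<in> carrier_mat n n" "frob ?c \<in> carrier_mat n n" using r by auto
  have c'c: "?c' * ?c = r" using p poly_mat_commute[OF r] by simp
  have fr: "frob r = frob h * h" using g by (simp add: r_def fm)
  have "g * r = frob r * g"
    unfolding fr using g fg by (simp add: r_def asc mc mult_cancel_inverse_mat[OF g(3), where m = n])
  then have "g * ?c' = poly_mat (conj_poly q p) (frob r) * g"
    by (rule poly_mat_intertwine[OF r frob_carrier_mat[OF r] g(1)])
  then have gc: "frob ?c * g = g * ?c'" by (simp add: frobenius_poly_mat[OF q r])
  define G where "G = g * ?c"
  have G: "G \<in> carrier_mat n n" "frob G \<in> carrier_mat n n" using g c by (auto simp: G_def)
  have "frob G * G = frob g * (frob ?c * g * ?c)"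
    unfolding G_def using g fg c by (simp add: fm asc mc)
  also have "\<dots> = frob g * (g * (?c' * ?c))"
    unfolding gc using g fg c by (simp add: asc mc)
  also have "\<dots> = 1\<^sub>m n" unfolding c'c using sr g fg r by (simp add: asc mc)
  finally have GG: "G * frob G = 1\<^sub>m n" using G by - (rule mat_mult_left_right_inverse, auto)
  have "H * r = r * H"
    unfolding r_def by (rule intertwine_mult_mat[OF H fH H g(2) fg(2) g(6)[symmetric] fgh(3)[symmetric]])
  then have cH: "H * ?c = ?c * H"
    by (rule poly_mat_intertwine[OF r r H])
  have HG: "frob H * G = G * H"
    unfolding G_def by (rule intertwine_mult_mat[OF fH H H g(1) c(1) g(5) cH])
  obtain p2 d where d: "d \<in> carrier_mat n n" "poly_mat p2 G * d = 1\<^sub>m n"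
    "G * frob (poly_mat p2 G) = poly_mat p2 G"
    using hilbert90_mat[of q n frob, OF q frob_carrier_mat frobenius_poly_mat[OF q] G(1) GG] .
  let ?b = "poly_mat p2 G"
  have b: "?b \<in> carrier_mat n n" "frob ?b \<in> carrier_mat n n" "frob d \<in> carrier_mat n n" using G d by auto
  have db: "d * ?b = 1\<^sub>m n" by (rule mat_mult_left_right_inverse[OF b(1) d(1,2)])
  have fbd: "frob ?b * frob d = 1\<^sub>m n" "frob d * frob ?b = 1\<^sub>m n"
  proof -
    have "frob (?b * d) = 1\<^sub>m n" "frob (d * ?b) = 1\<^sub>m n" by (simp_all only: d(2) db frob_one)
    then show "frob ?b * frob d = 1\<^sub>m n" "frob d * frob ?b = 1\<^sub>m n"
      by (simp_all only: fm[OF b(1) d(1)] fm[OF d(1) b(1)])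
  qed
  have "d * G = d * (G * (frob ?b * frob d))" using G d fbd by simp
  also have "\<dots> = d * (G * frob ?b) * frob d" using G d(1) b by (simp only: asc mc)
  also have "\<dots> = frob d" unfolding d(3) db using b by simp
  finally have dG: "d * G = frob d" .
  define M where "M = frob d * H * frob ?b"
  have M: "M \<in> carrier_mat n n" using b H by (simp add: M_def)
  have "frob M = d * frob H * ?b"
    unfolding M_def using b d H fH by (simp add: fm mc)
  also have "\<dots> = d * frob H * (G * frob ?b)" by (simp only: d(3))
  also have "\<dots> = d * (frob H * G) * frob ?b" using G b d(1) H fH by (simp only: asc mc)
  also have "\<dots> = (d * G) * H * frob ?b" unfolding HG using G b d(1) H by (simp only: asc mc)
  finally have "frob M = M" unfolding dG M_def .
  moreover have "M * frob d = frob d * H"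
    unfolding M_def using b H fbd by (simp add: asc mc)
  then have "similar_mat M H"
    using M H b fbd by (intro similar_mat_intertwineI[of _ n _ "frob d" "frob ?b"])
  ultimately show thesis by (rule that[OF M])
qed

text \<open>
  Let \<open>M\<^sup>* g = g M\<close>.  A Hermitian \<open>J\<close> with \<open>M\<^sup>* J = J M\<close> is sought in the form \<open>g c\<close> with \<open>c\<close> commuting with
  \<open>M\<close>.  For \<open>\<phi>(x) = g\<^bsup>-1\<^esup> x\<^sup>* g\<close> and \<open>z = g\<^bsup>-1\<^esup> g\<^sup>*\<close>, the matrix \<open>g c\<close> is Hermitian if \<open>\<phi>(c) z = c\<close>, and
  \<open>z \<phi>(z) = 1\<close>, so Hilbert's Theorem 90 provides \<open>c\<close> as a polynomial in \<open>z\<close>.  With \<open>J = P\<^sup>* P\<close> the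
  matrix \<open>P M P\<^bsup>-1\<^esup>\<close> is Hermitian.
\<close>

lemma similar_conj_trans_hermitian:
  assumes M: "M \<in> carrier_mat n n" and sim: "similar_mat (conj_trans q M) (M :: 'a mat)"
  obtains H where "H \<in> carrier_mat n n" "conj_trans q H = H" "similar_mat H M"
proof -
  have Ms: "conj_trans q M \<in> carrier_mat n n" using M by simp
  obtain g h where g: "g \<in> carrier_mat n n" "h \<in> carrier_mat n n" "g * h = 1\<^sub>m n" "h * g = 1\<^sub>m n"
    "conj_trans q M * g = g * M" "h * conj_trans q M = M * h"
    by (rule similar_mat_intertwineE[OF sim Ms])
  note asc = assoc_mult_mat[of _ n n _ n _ n] and mc [simp] = mult_carrier_mat[of _ n n _ n]
  note ct = conj_trans_mult[OF q, of _ n n _ n] and cc = conj_trans_conj_trans[OF q]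
  let ?gs = "conj_trans q g" and ?hs = "conj_trans q h"
  have gs: "?gs \<in> carrier_mat n n" "?hs \<in> carrier_mat n n" using g by auto
  have ghs: "?gs * ?hs = 1\<^sub>m n" "?gs * M = conj_trans q M * ?gs"
  proof -
    have "conj_trans q (h * g) = 1\<^sub>m n" "conj_trans q (conj_trans q M * g) = conj_trans q (g * M)"
      by (simp_all only: g(4,5) conj_trans_one[OF q])
    then show "?gs * ?hs = 1\<^sub>m n" "?gs * M = conj_trans q M * ?gs"
      by (simp_all only: ct[OF g(2,1)] ct[OF Ms g(1)] ct[OF g(1) M] cc)
  qed
  define z where "z = h * ?gs"
  have z: "z \<in> carrier_mat n n" using g by (simp add: z_def)
  let ?\<phi> = "\<lambda>x. h * conj_trans q x * g"
  have \<phi>c: "?\<phi> x \<in> carrier_mat n n" if "x \<in> carrier_mat n n" for x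
    using that g by simp
  have \<phi>poly: "?\<phi> (poly_mat p x) = poly_mat (conj_poly q p) (?\<phi> x)" if x: "x \<in> carrier_mat n n" for p x
  proof -
    have xs: "conj_trans q x \<in> carrier_mat n n" using x by simp
    have "g * ?\<phi> x = conj_trans q x * g"
      using g xs by (simp add: asc mc mult_cancel_inverse_mat[OF g(3), where m = n])
    then have "g * poly_mat (conj_poly q p) (?\<phi> x) = poly_mat (conj_poly q p) (conj_trans q x) * g"
      by (rule poly_mat_intertwine[OF \<phi>c[OF x] xs g(1)])
    then have "h * (g * poly_mat (conj_poly q p) (?\<phi> x)) = ?\<phi> (poly_mat p x)"
      unfolding conj_trans_poly_mat[OF q x] using g poly_mat_carrier[OF xs] by (simp add: asc mc)
    then show ?thesis
      using mult_cancel_inverse_mat[OF g(4) g(2,1) poly_mat_carrier[OF \<phi>c[OF x]]] by simp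
  qed
  have \<phi>z: "?\<phi> z = ?hs * g"
    using g gs by (simp add: z_def ct cc asc mc mult_cancel_inverse_mat[OF g(4), where m = n])
  have z\<phi>: "z * ?\<phi> z = 1\<^sub>m n"
    unfolding \<phi>z using g gs by (simp add: z_def asc mc mult_cancel_inverse_mat[OF ghs(1), where m = n])
  obtain p d where d: "d \<in> carrier_mat n n" "poly_mat p z * d = 1\<^sub>m n"
    "z * ?\<phi> (poly_mat p z) = poly_mat p z"
    using hilbert90_mat[of q n ?\<phi>, OF q \<phi>c \<phi>poly z z\<phi>] .
  let ?c = "poly_mat p z"
  have c: "?c \<in> carrier_mat n n" "conj_trans q ?c \<in> carrier_mat n n" using z by auto
  have "z * ?\<phi> z = ?\<phi> z * z"
    using z\<phi> mat_mult_left_right_inverse[OF z \<phi>c[OF z] z\<phi>] by simp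
  then have "z * ?\<phi> ?c = ?\<phi> ?c * z"
    unfolding \<phi>poly[OF z] by (rule poly_mat_intertwine[OF \<phi>c[OF z] \<phi>c[OF z] z])
  then have cz: "?c = ?\<phi> ?c * z" using d(3) by simp
  define J where "J = g * ?c"
  have J: "J \<in> carrier_mat n n" using g c by (simp add: J_def)
  have "J = g * (?\<phi> ?c * z)" unfolding J_def by (simp only: cz[symmetric])
  also have "\<dots> = conj_trans q ?c * ?gs"
    using g gs c by (simp add: z_def asc mc mult_cancel_inverse_mat[OF g(3), where m = n])
  also have "\<dots> = conj_trans q J" using g c by (simp add: J_def ct)
  finally have Jherm: "conj_trans q J = J" ..
  have Jinv: "J * (d * h) = 1\<^sub>m n"
    using g c d by (simp add: J_def asc mc mult_cancel_inverse_mat[OF d(2), where m = n])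
  have "M * z = z * M"
    unfolding z_def by (rule intertwine_mult_mat[OF M Ms M g(2) gs(1) g(6)[symmetric] ghs(2)[symmetric]])
  then have cM: "M * ?c = ?c * M"
    by (rule poly_mat_intertwine[OF z z M])
  have JM: "conj_trans q M * J = J * M"
    unfolding J_def by (rule intertwine_mult_mat[OF Ms M M g(1) c(1) g(5) cM])
  obtain r e where e: "e \<in> carrier_mat n n" "poly_mat r J * e = 1\<^sub>m n" "e * poly_mat r J = 1\<^sub>m n"
    "conj_trans q (poly_mat r J) * poly_mat r J = J"
    using hermitian_gram[OF J mult_carrier_mat[OF d(1) g(2)] Jinv Jherm] .
  let ?P = "poly_mat r J" and ?Ps = "conj_trans q (poly_mat r J)" and ?es = "conj_trans q e"
  have P: "?P \<in> carrier_mat n n" "?Ps \<in> carrier_mat n n" "?es \<in> carrier_mat n n" using J e by auto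
  have eP: "?es * ?Ps = 1\<^sub>m n"
    unfolding ct[OF P(1) e(1), symmetric] e(2) by (rule conj_trans_one[OF q])
  define H where "H = ?P * M * e"
  have H: "H \<in> carrier_mat n n" using P M e by (simp add: H_def)
  have "(?Ps * ?P) * e = ?Ps * (?P * e)" by (rule assoc_mult_mat[OF P(2,1) e(1)])
  then have Je: "J * e = ?Ps" unfolding e(4) e(2) using P(2) by simp
  have "?Ps * H = (?Ps * ?P) * M * e" unfolding H_def using P M e(1) by (simp only: asc mc)
  also have "\<dots> = (conj_trans q M * J) * e" by (simp only: e(4) JM)
  also have "\<dots> = conj_trans q M * ?Ps"
    unfolding assoc_mult_mat[OF Ms J e(1)] Je ..
  finally have 1: "?es * (?Ps * H) = ?es * (conj_trans q M * ?Ps)" by simp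
  have "?es * (?Ps * H) = H" by (rule mult_cancel_inverse_mat[OF eP P(3,2) H])
  moreover have "conj_trans q H = ?es * (conj_trans q M * ?Ps)"
    unfolding H_def using P(1) M e(1) Ms by (simp add: ct mc asc)
  ultimately have "conj_trans q H = H" using 1 by simp
  moreover have "H * ?P = ?P * M" unfolding H_def using P(1) M e(1,3) by (simp add: asc mc)
  then have "similar_mat H M"
    using H M P e by (intro similar_mat_intertwineI[of _ n _ ?P e])
  ultimately show thesis by (rule that[OF H])
qed

end

section \<open>Diagonalisation over Euclidean rings, and similarity to the transpose\<close>

definition mat_equivalent :: "nat \<Rightarrow> 'a::comm_ring_1 mat \<Rightarrow> 'a mat \<Rightarrow> bool" where
  "mat_equivalent n A B \<longleftrightarrow> A \<in> carrier_mat n n \<and> (\<exists>U V. invertible_mat U \<and> invertible_mat V \<and>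
     U \<in> carrier_mat n n \<and> V \<in> carrier_mat n n \<and> B = U * A * V)"

lemma invertible_matI:
  assumes "A \<in> carrier_mat n n" "B \<in> carrier_mat n n" "A * B = 1\<^sub>m n" "B * A = 1\<^sub>m n"
  shows "invertible_mat A"
  using assms unfolding invertible_mat_def inverts_mat_def by (metis carrier_matD square_mat.simps)

lemma invertible_matE:
  assumes "invertible_mat A" "A \<in> carrier_mat n n"
  obtains B where "B \<in> carrier_mat n n" "A * B = 1\<^sub>m n" "B * A = 1\<^sub>m n"
proof -
  obtain B where B: "A * B = 1\<^sub>m (dim_row A)" "B * A = 1\<^sub>m (dim_row B)"
    using assms(1) unfolding invertible_mat_def inverts_mat_def by blast
  have "dim_col B = n" using arg_cong[OF B(1), of dim_col] assms(2) by simp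
  moreover have "dim_row B = n" using arg_cong[OF B(2), of dim_col] assms(2) by simp
  ultimately show thesis using that[of B] B assms(2) by auto
qed

lemma invertible_mat_mult:
  assumes "invertible_mat A" "invertible_mat B" "A \<in> carrier_mat n n" "B \<in> carrier_mat n n"
  shows "invertible_mat (A * (B :: 'a::comm_ring_1 mat))"
proof -
  obtain A' where A': "A' \<in> carrier_mat n n" "A * A' = 1\<^sub>m n" "A' * A = 1\<^sub>m n"
    using invertible_matE[OF assms(1,3)] .
  obtain B' where B': "B' \<in> carrier_mat n n" "B * B' = 1\<^sub>m n" "B' * B = 1\<^sub>m n"
    using invertible_matE[OF assms(2,4)] .
  show ?thesis
    by (rule invertible_matI[of _ n "B' * A'"])
       (use assms(3,4) A' B' in \<open>simp_all add: assoc_mult_mat[of _ n n _ n _ n] mult_carrier_mat[of _ n n _ n]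
          mult_cancel_inverse_mat[OF A'(3), where m = n] mult_cancel_inverse_mat[OF B'(2), where m = n]\<close>)
qed

lemma mat_equivalent_refl: "A \<in> carrier_mat n n \<Longrightarrow> mat_equivalent n A A"
  unfolding mat_equivalent_def
  by (intro conjI exI[of _ "1\<^sub>m n"]) (auto intro: invertible_matI[of _ n "1\<^sub>m n"])

lemma mat_equivalent_mult:
  assumes AB: "mat_equivalent n A B" and UV: "invertible_mat U" "invertible_mat V"
    "U \<in> carrier_mat n n" "V \<in> carrier_mat n n"
  shows "mat_equivalent n A (U * B * V)"
proof -
  obtain U0 V0 where 0: "A \<in> carrier_mat n n" "invertible_mat U0" "invertible_mat V0"
    "U0 \<in> carrier_mat n n" "V0 \<in> carrier_mat n n" "B = U0 * A * V0"
    using AB unfolding mat_equivalent_def by blast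
  have "U * B * V = (U * U0) * A * (V0 * V)"
    unfolding 0(6) using 0(1,4,5) UV
    by (simp add: assoc_mult_mat[of _ n n _ n _ n] mult_carrier_mat[of _ n n _ n])
  moreover have "invertible_mat (U * U0)" "invertible_mat (V0 * V)"
    using 0 UV by (auto intro: invertible_mat_mult)
  ultimately show ?thesis
    unfolding mat_equivalent_def using 0(1,4,5) UV(3,4) mult_carrier_mat by blast
qed

lemma mat_equivalent_carrier: "mat_equivalent n A B \<Longrightarrow> B \<in> carrier_mat n n"
  unfolding mat_equivalent_def by auto

lemma mat_equivalent_trans:
  "mat_equivalent n A B \<Longrightarrow> mat_equivalent n B C \<Longrightarrow> mat_equivalent n A C"
  using mat_equivalent_mult unfolding mat_equivalent_def[of n B C] by blast

lemma mat_equivalent_left: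
  assumes "mat_equivalent n A B" "invertible_mat U" "U \<in> carrier_mat n n"
  shows "mat_equivalent n A (U * B)"
proof -
  have "mat_equivalent n A (U * B * 1\<^sub>m n)"
    using assms by (intro mat_equivalent_mult) (auto intro: invertible_matI[of _ n "1\<^sub>m n"])
  then show ?thesis using assms mat_equivalent_carrier[OF assms(1)] by (simp add: mult_carrier_mat[of _ n n _ n])
qed

lemma mat_equivalent_right:
  assumes "mat_equivalent n A B" "invertible_mat U" "U \<in> carrier_mat n n"
  shows "mat_equivalent n A (B * U)"
proof -
  have "mat_equivalent n A (1\<^sub>m n * B * U)"
    using assms by (intro mat_equivalent_mult) (auto intro: invertible_matI[of _ n "1\<^sub>m n"])
  then show ?thesis using mat_equivalent_carrier[OF assms(1)] by simp
qed

lemma invertible_swaprows_mat: "k < n \<Longrightarrow> l < n \<Longrightarrow> invertible_mat (swaprows_mat n k l :: 'a::comm_ring_1 mat)"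
  by (rule invertible_matI[of _ n "swaprows_mat n k l"]) (simp_all add: swaprows_mat_inv)

lemma invertible_addrow_mat:
  assumes "k < n" "l < n" "k \<noteq> l"
  shows "invertible_mat (addrow_mat n a k l :: 'a::comm_ring_1 mat)"
  by (rule invertible_matI[of _ n "addrow_mat n (- a) k l"])
     (use addrow_mat_inv[OF assms, of a] addrow_mat_inv[OF assms, of "- a"] in simp_all)

definition diag_form :: "nat \<Rightarrow> nat \<Rightarrow> (nat \<Rightarrow> 'a::zero) \<Rightarrow> 'a mat" where
  "diag_form n r d = mat n n (\<lambda>(i, j). if i = j \<and> i < r then d i else 0)"

lemma diag_form_carrier [simp]: "diag_form n r d \<in> carrier_mat n n"
  by (simp add: diag_form_def)

lemma diag_form_dim [simp]: "dim_row (diag_form n r d) = n" "dim_col (diag_form n r d) = n"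
  by (simp_all add: diag_form_def)

lemma mat_equivalent_block:
  assumes "mat_equivalent n C C'"
  shows "mat_equivalent (Suc n) (four_block_mat (mat 1 1 (\<lambda>_. a)) (0\<^sub>m 1 n) (0\<^sub>m n 1) C)
     (four_block_mat (mat 1 1 (\<lambda>_. a)) (0\<^sub>m 1 n) (0\<^sub>m n 1) C')"
proof -
  obtain U V where C: "C \<in> carrier_mat n n" and UV: "invertible_mat U" "invertible_mat V"
    "U \<in> carrier_mat n n" "V \<in> carrier_mat n n" "C' = U * C * V"
    using assms unfolding mat_equivalent_def by blast
  let ?F = "\<lambda>x Y. four_block_mat x (0\<^sub>m 1 n) (0\<^sub>m n 1) Y"
  have prod: "?F x X * ?F y Y = ?F (x * y) (X * Y)"
    if "x \<in> carrier_mat 1 1" "y \<in> carrier_mat 1 1" "X \<in> carrier_mat n n" "Y \<in> carrier_mat n n" for x y X Y :: "'a mat"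
    using that by (subst mult_four_block_mat[of _ 1 1 _ n _ n _ _ 1 _ n]) (auto simp: mult_carrier_mat[of _ n n _ n])
  have inv: "invertible_mat (?F (1\<^sub>m 1) U)" if U: "invertible_mat U" "U \<in> carrier_mat n n" for U :: "'a mat"
  proof -
    obtain U' where U': "U' \<in> carrier_mat n n" "U * U' = 1\<^sub>m n" "U' * U = 1\<^sub>m n"
      using invertible_matE[OF U] .
    show ?thesis
      by (rule invertible_matI[of _ "1 + n" "?F (1\<^sub>m 1) U'"]) (use U' U(2) in \<open>auto simp: prod simp del: One_nat_def\<close>)
  qed
  have "mat_equivalent (1 + n) (?F (mat 1 1 (\<lambda>_. a)) C) (?F (1\<^sub>m 1) U * ?F (mat 1 1 (\<lambda>_. a)) C * ?F (1\<^sub>m 1) V)"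
    using UV C inv by (intro mat_equivalent_mult mat_equivalent_refl four_block_carrier_mat) auto
  also have "?F (1\<^sub>m 1) U * ?F (mat 1 1 (\<lambda>_. a)) C * ?F (1\<^sub>m 1) V = ?F (mat 1 1 (\<lambda>_. a)) C'"
    using UV C by (simp add: prod mult_carrier_mat[of _ n n _ n] del: One_nat_def)
  finally show ?thesis by simp
qed

lemma invertible_block_lower:
  fixes Y :: "'a::comm_ring_1 mat"
  assumes Y: "Y \<in> carrier_mat n 1"
  shows "invertible_mat (four_block_mat (1\<^sub>m 1) (0\<^sub>m 1 n) Y (1\<^sub>m n))"
proof -
  let ?F = "\<lambda>Y :: 'a mat. four_block_mat (1\<^sub>m 1) (0\<^sub>m 1 n) Y (1\<^sub>m n)"
  have FF: "?F Z * ?F (- Z) = 1\<^sub>m (1 + n)" if Z: "Z \<in> carrier_mat n 1" for Z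
  proof -
    have mZ: "- Z \<in> carrier_mat n 1" using Z by (simp only: uminus_carrier_iff_mat)
    have "1\<^sub>m 1 * 1\<^sub>m 1 + 0\<^sub>m 1 n * - Z = 1\<^sub>m 1" "1\<^sub>m 1 * 0\<^sub>m 1 n + 0\<^sub>m 1 n * 1\<^sub>m n = (0\<^sub>m 1 n :: 'a mat)"
      "Z * 1\<^sub>m 1 + 1\<^sub>m n * - Z = 0\<^sub>m n 1" "Z * 0\<^sub>m 1 n + 1\<^sub>m n * 1\<^sub>m n = 1\<^sub>m n"
      using Z mZ by (auto intro!: eq_matI simp del: One_nat_def)
    then show ?thesis
      unfolding mult_four_block_mat[OF one_carrier_mat zero_carrier_mat Z one_carrier_mat
          one_carrier_mat zero_carrier_mat mZ one_carrier_mat]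
      by (simp only: four_block_one_mat)
  qed
  have mY: "- Y \<in> carrier_mat n 1" using Y by (simp only: uminus_carrier_iff_mat)
  have c: "?F Y \<in> carrier_mat (1 + n) (1 + n)" "?F (- Y) \<in> carrier_mat (1 + n) (1 + n)"
    by (intro four_block_carrier_mat one_carrier_mat)+
  have "?F (- Y) * ?F Y = 1\<^sub>m (1 + n)" using FF[OF mY] by simp
  then show ?thesis by (rule invertible_matI[OF c FF[OF Y]])
qed

lemma invertible_block_upper:
  fixes X :: "'a::comm_ring_1 mat"
  assumes X: "X \<in> carrier_mat 1 n"
  shows "invertible_mat (four_block_mat (1\<^sub>m 1) X (0\<^sub>m n 1) (1\<^sub>m n))"
proof -
  let ?F = "\<lambda>X :: 'a mat. four_block_mat (1\<^sub>m 1) X (0\<^sub>m n 1) (1\<^sub>m n)"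
  have FF: "?F Z * ?F (- Z) = 1\<^sub>m (1 + n)" if Z: "Z \<in> carrier_mat 1 n" for Z
  proof -
    have mZ: "- Z \<in> carrier_mat 1 n" using Z by (simp only: uminus_carrier_iff_mat)
    have "1\<^sub>m 1 * 1\<^sub>m 1 + Z * 0\<^sub>m n 1 = 1\<^sub>m 1" "1\<^sub>m 1 * - Z + Z * 1\<^sub>m n = (0\<^sub>m 1 n :: 'a mat)"
      "0\<^sub>m n 1 * 1\<^sub>m 1 + 1\<^sub>m n * 0\<^sub>m n 1 = (0\<^sub>m n 1 :: 'a mat)" "0\<^sub>m n 1 * - Z + 1\<^sub>m n * 1\<^sub>m n = 1\<^sub>m n"
      using Z mZ by (auto intro!: eq_matI simp del: One_nat_def)
    then show ?thesis
      unfolding mult_four_block_mat[OF one_carrier_mat Z zero_carrier_mat one_carrier_mat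
          one_carrier_mat mZ zero_carrier_mat one_carrier_mat]
      by (simp only: four_block_one_mat)
  qed
  have mX: "- X \<in> carrier_mat 1 n" using X by (simp only: uminus_carrier_iff_mat)
  have c: "?F X \<in> carrier_mat (1 + n) (1 + n)" "?F (- X) \<in> carrier_mat (1 + n) (1 + n)"
    by (intro four_block_carrier_mat one_carrier_mat)+
  have "?F (- X) * ?F X = 1\<^sub>m (1 + n)" using FF[OF mX] by simp
  then show ?thesis by (rule invertible_matI[OF c FF[OF X]])
qed

text \<open>
  Once the corner entry divides the rest of its row and column, multiplication by unipotent block
  triangular matrices on both sides clears them.
\<close>

lemma clear_cross:
  fixes B :: "'a::comm_ring_1 mat"
  assumes B: "B \<in> carrier_mat (Suc n) (Suc n)"
    and row: "\<And>j. j < n \<Longrightarrow> B $$ (0, Suc j) = B $$ (0, 0) * x j"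
    and col: "\<And>i. i < n \<Longrightarrow> B $$ (Suc i, 0) = y i * B $$ (0, 0)"
  shows "\<exists>C. mat_equivalent (Suc n) B (four_block_mat (mat 1 1 (\<lambda>_. B $$ (0, 0))) (0\<^sub>m 1 n) (0\<^sub>m n 1) C) \<and>
     C \<in> carrier_mat n n"
proof -
  let ?a = "mat 1 1 (\<lambda>_. B $$ (0, 0))"
  define C where "C = mat n n (\<lambda>(i, j). B $$ (Suc i, Suc j))"
  define X where "X = mat 1 n (\<lambda>(i, j). x j)"
  define Y where "Y = mat n 1 (\<lambda>(i, j). y i)"
  have c: "C \<in> carrier_mat n n" "X \<in> carrier_mat 1 n" "Y \<in> carrier_mat n 1" "?a \<in> carrier_mat 1 1"
    by (auto simp: C_def X_def Y_def)
  have Yc: "dim_row Y = n" "dim_col Y = 1" and Xc: "dim_row X = 1" "dim_col X = n" using c by auto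
  have Bb: "B = four_block_mat ?a (?a * X) (Y * ?a) C"
    using B row col
    by (intro eq_matI) (auto simp: C_def X_def Y_def scalar_prod_def not_less_eq less_Suc_eq_0_disj)
  have L: "invertible_mat (four_block_mat (1\<^sub>m 1) (0\<^sub>m 1 n) (- Y) (1\<^sub>m n))"
    by (rule invertible_block_lower) (simp only: uminus_carrier_iff_mat c)
  have R: "invertible_mat (four_block_mat (1\<^sub>m 1) (- X) (0\<^sub>m n 1) (1\<^sub>m n))"
    by (rule invertible_block_upper) (simp only: uminus_carrier_iff_mat c)
  let ?L = "four_block_mat (1\<^sub>m 1) (0\<^sub>m 1 n) (- Y) (1\<^sub>m n)"
  let ?R = "four_block_mat (1\<^sub>m 1) (- X) (0\<^sub>m n 1) (1\<^sub>m n)"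
  have mults: "?a * X \<in> carrier_mat 1 n" "Y * ?a \<in> carrier_mat n 1"
    by (rule mult_carrier_mat[OF c(4,2)], rule mult_carrier_mat[OF c(3,4)])
  have mY: "- Y \<in> carrier_mat n 1" and mX: "- X \<in> carrier_mat 1 n"
    by (simp_all only: uminus_carrier_iff_mat c)
  define C' where "C' = - Y * (?a * X) + C"
  have C': "C' \<in> carrier_mat n n"
    unfolding C'_def by (rule add_carrier_mat[OF c(1)])
  have "?L * B = four_block_mat ?a (?a * X) (0\<^sub>m n 1) C'"
  proof -
    have "- Y * ?a + Y * ?a = 0\<^sub>m n 1"
      using Yc by (intro eq_matI) (auto simp: scalar_prod_def)
    moreover have "1\<^sub>m 1 * ?a + 0\<^sub>m 1 n * (Y * ?a) = ?a" "1\<^sub>m 1 * (?a * X) + 0\<^sub>m 1 n * C = ?a * X"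
      "1\<^sub>m n * (Y * ?a) = Y * ?a" "1\<^sub>m n * C = C"
      using c mults by (simp_all del: One_nat_def)
    ultimately show ?thesis
      by (subst Bb, subst mult_four_block_mat[OF one_carrier_mat zero_carrier_mat mY one_carrier_mat
          c(4) mults(1,2) c(1)]) (simp only: C'_def)
  qed
  then have "?L * B * ?R = four_block_mat ?a (?a * X) (0\<^sub>m n 1) C' * ?R" by simp
  also have "\<dots> = four_block_mat ?a (0\<^sub>m 1 n) (0\<^sub>m n 1) C'"
  proof -
    have "?a * - X + ?a * X = 0\<^sub>m 1 n"
      using Xc by (intro eq_matI) (auto simp: scalar_prod_def)
    moreover have "?a * 1\<^sub>m 1 + ?a * X * 0\<^sub>m n 1 = ?a" "?a * X * 1\<^sub>m n = ?a * X"
      "0\<^sub>m n 1 * 1\<^sub>m 1 + C' * 0\<^sub>m n 1 = 0\<^sub>m n 1" "0\<^sub>m n 1 * - X + C' * 1\<^sub>m n = C'"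
      unfolding left_mult_zero_mat[OF mX] using c C' mults by (simp_all del: One_nat_def)
    ultimately show ?thesis
      by (subst mult_four_block_mat[OF c(4) mults(1) zero_carrier_mat C' one_carrier_mat
          mX zero_carrier_mat one_carrier_mat]) simp
  qed
  finally have eq: "?L * B * ?R = four_block_mat ?a (0\<^sub>m 1 n) (0\<^sub>m n 1) C'" .
  have "?L \<in> carrier_mat (1 + n) (1 + n)" "?R \<in> carrier_mat (1 + n) (1 + n)"
    by (intro four_block_carrier_mat one_carrier_mat)+
  then have "mat_equivalent (Suc n) B (?L * B * ?R)"
    using mat_equivalent_mult[OF mat_equivalent_refl[OF B] L R] by simp
  then have "mat_equivalent (Suc n) B (four_block_mat ?a (0\<^sub>m 1 n) (0\<^sub>m n 1) C')"
    unfolding eq .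
  then show ?thesis using C' by (intro exI[of _ C'] conjI)
qed

text \<open>
  Among the matrices equivalent to \<open>A\<close> with nonzero corner entry, one whose corner has least size is
  chosen.  A nonzero remainder of an entry of its first row or column by the corner could be moved to
  the corner and would be smaller; hence the corner divides these entries, they can be cleared, and the
  induction hypothesis applies to the remaining block.  The size function is arbitrary, which covers
  polynomials (degree) and fields (constant size) alike.
\<close>

lemma diagonalise:
  fixes sz :: "'a::comm_ring_1 \<Rightarrow> nat"
  assumes euclid: "\<And>a b :: 'a. a \<noteq> 0 \<Longrightarrow> \<exists>c r. b = c * a + r \<and> (r = 0 \<or> sz r < sz a)"
    and A: "(A :: 'a mat) \<in> carrier_mat n n"
  shows "\<exists>r d. r \<le> n \<and> (\<forall>i<r. d i \<noteq> 0) \<and> mat_equivalent n A (diag_form n r d)"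
  using A
proof (induction n arbitrary: A)
  case 0
  then have "diag_form 0 0 (\<lambda>_. 0) = A" by (intro eq_matI) (auto simp: diag_form_def)
  then show ?case using mat_equivalent_refl[OF 0] by (intro exI[of _ 0] exI[of _ "\<lambda>_. 0"]) simp
next
  case (Suc n)
  show ?case
  proof (cases "A = 0\<^sub>m (Suc n) (Suc n)")
    case True
    then have "diag_form (Suc n) 0 (\<lambda>_. 0) = A" by (intro eq_matI) (auto simp: diag_form_def)
    then show ?thesis
      using mat_equivalent_refl[OF Suc.prems] by (intro exI[of _ 0] exI[of _ "\<lambda>_. 0"]) simp
  next
    case False
    let ?n = "Suc n"
    let ?P = "\<lambda>B. mat_equivalent ?n A B \<and> B $$ (0, 0) \<noteq> 0"
    have swap: "?P (swapcols 0 j (swaprows 0 i B))"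
      if B: "mat_equivalent ?n A B" "i < ?n" "j < ?n" "B $$ (i, j) \<noteq> 0" for B i j
    proof
      note c = mat_equivalent_carrier[OF B(1)]
      have "swapcols 0 j (swaprows 0 i B) = swaprows_mat ?n 0 i * B * swaprows_mat ?n 0 j"
        unfolding swaprows_mat[OF c zero_less_Suc B(2)]
        by (rule swapcols_mat[OF mult_carrier_mat[OF swaprows_mat_carrier c] zero_less_Suc B(3)])
      then show "mat_equivalent ?n A (swapcols 0 j (swaprows 0 i B))"
        using B by (simp add: mat_equivalent_mult invertible_swaprows_mat)
      show "swapcols 0 j (swaprows 0 i B) $$ (0, 0) \<noteq> 0" using c B by simp
    qed
    obtain i j where ij: "i < ?n" "j < ?n" "A $$ (i, j) \<noteq> 0"
    proof (rule ccontr)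
      assume "\<not> thesis"
      then have "A = 0\<^sub>m ?n ?n" using that Suc.prems by (intro eq_matI) auto
      then show False using False by simp
    qed
    obtain B where PB: "?P B" and least: "\<And>B'. ?P B' \<Longrightarrow> sz (B $$ (0, 0)) \<le> sz (B' $$ (0, 0))"
      using ex_has_least_nat[of ?P, OF swap[OF mat_equivalent_refl[OF Suc.prems] ij],
        where m = "\<lambda>B. sz (B $$ (0, 0))"] by (elim exE conjE) auto
    let ?a = "B $$ (0, 0)"
    have B: "B \<in> carrier_mat ?n ?n" using PB mat_equivalent_carrier by blast
    have noless: "r = 0 \<or> \<not> sz r < sz ?a"
      if B': "mat_equivalent ?n A B'" "i < ?n" "j < ?n" "B' $$ (i, j) = r" for B' i j r
    proof (rule disjCI)
      assume "\<not> \<not> sz r < sz ?a"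
      show "r = 0"
      proof (rule ccontr)
        assume "r \<noteq> 0"
        then have "?P (swapcols 0 j (swaprows 0 i B'))" using swap B' by simp
        then have "sz ?a \<le> sz (swapcols 0 j (swaprows 0 i B') $$ (0, 0))" by (rule least)
        also have "swapcols 0 j (swaprows 0 i B') $$ (0, 0) = r"
          using B' mat_equivalent_carrier[OF B'(1)] by simp
        finally show False using \<open>\<not> \<not> sz r < sz ?a\<close> by simp
      qed
    qed
    have "\<exists>c. B $$ (0, Suc j) = ?a * c" if j: "j < n" for j
    proof -
      obtain c r where cr: "B $$ (0, Suc j) = c * ?a + r" "r = 0 \<or> sz r < sz ?a"
        using euclid PB by meson
      have "mat_equivalent ?n A (addcol (- c) (Suc j) 0 B)"
        using PB j B by (simp add: addcol_mat[of _ ?n ?n] mat_equivalent_right invertible_addrow_mat)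
      moreover have "addcol (- c) (Suc j) 0 B $$ (0, Suc j) = r"
        using B j cr(1) by simp
      ultimately have "r = 0" using noless[of _ 0 "Suc j" r] cr(2) j by auto
      then show ?thesis using cr(1) by (auto simp: mult.commute)
    qed
    then obtain x where x: "\<And>j. j < n \<Longrightarrow> B $$ (0, Suc j) = ?a * x j" by metis
    have "\<exists>c. B $$ (Suc i, 0) = c * ?a" if i: "i < n" for i
    proof -
      obtain c r where cr: "B $$ (Suc i, 0) = c * ?a + r" "r = 0 \<or> sz r < sz ?a"
        using euclid PB by meson
      have "mat_equivalent ?n A (addrow (- c) (Suc i) 0 B)"
        using PB i B by (simp add: addrow_mat[of _ ?n ?n] mat_equivalent_left invertible_addrow_mat)
      moreover have "addrow (- c) (Suc i) 0 B $$ (Suc i, 0) = r"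
        using B i cr(1) by simp
      ultimately have "r = 0" using noless[of _ "Suc i" 0 r] cr(2) i by auto
      then show ?thesis using cr(1) by auto
    qed
    then obtain y where y: "\<And>i. i < n \<Longrightarrow> B $$ (Suc i, 0) = y i * ?a" by metis
    let ?F = "four_block_mat (mat 1 1 (\<lambda>_. ?a)) (0\<^sub>m 1 n) (0\<^sub>m n 1)"
    obtain C where C: "mat_equivalent ?n B (?F C)" "C \<in> carrier_mat n n"
      using clear_cross[OF B x y] by blast
    obtain r d where rd: "r \<le> n" "\<forall>i<r. d i \<noteq> 0" "mat_equivalent n C (diag_form n r d)"
      using Suc.IH[OF C(2)] by blast
    have "mat_equivalent ?n A (?F (diag_form n r d))"
      using PB C(1) mat_equivalent_block[OF rd(3)] mat_equivalent_trans by blast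
    also have "?F (diag_form n r d) = diag_form ?n (Suc r) (case_nat ?a d)"
      by (intro eq_matI) (auto simp: diag_form_def less_Suc_eq_0_disj split: nat.splits if_splits)
    finally show ?thesis
      using rd(1,2) PB by (intro exI[of _ "Suc r"] exI[of _ "case_nat ?a d"]) (auto split: nat.splits)
  qed
qed

text \<open>
  The polynomial matrix \<open>x I - M\<close>.
\<close>

definition pencil :: "'a::comm_ring_1 mat \<Rightarrow> 'a poly mat" where
  "pencil M = mat (dim_row M) (dim_col M) (\<lambda>(i, j). [:- M $$ (i, j), if i = j then 1 else 0:])"

lemma pencil_carrier [simp]: "M \<in> carrier_mat n n \<Longrightarrow> pencil M \<in> carrier_mat n n"
  by (simp add: pencil_def)

text \<open>
  If \<open>W\<close> is the sum of the \<open>x\<^sup>k W\<^sub>k\<close> with coefficient matrices \<open>W\<^sub>k\<close>, this is the sum of the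
  \<open>N\<^sup>k W\<^sub>k\<close>: the matrix \<open>N\<close> is substituted for \<open>x\<close> on the left.
\<close>

definition left_eval :: "'a::comm_ring_1 mat \<Rightarrow> 'a poly mat \<Rightarrow> 'a mat" where
  "left_eval N W = mat (dim_row N) (dim_col W)
     (\<lambda>(i, j). \<Sum>l<dim_row N. poly_mat (W $$ (l, j)) N $$ (i, l))"

lemma poly_mat_sum_index:
  assumes "N \<in> carrier_mat n n" "i < n" "j < n"
  shows "poly_mat (\<Sum>x\<in>S. f x) N $$ (i, j) = (\<Sum>x\<in>S. poly_mat (f x) N $$ (i, j))"
  using assms by (induction S rule: infinite_finite_induct) (auto simp: poly_mat_add)

lemma left_eval_mult:
  assumes N: "N \<in> carrier_mat n n" and A: "A \<in> carrier_mat n k" and X: "X \<in> carrier_mat k m"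
    and ij: "i < n" "j < m"
  shows "left_eval N (A * X) $$ (i, j)
    = (\<Sum>l<k. \<Sum>s<n. poly_mat (X $$ (l, j)) N $$ (i, s) * left_eval N A $$ (s, l))"
proof -
  have "left_eval N (A * X) $$ (i, j) = (\<Sum>t<n. poly_mat (\<Sum>l<k. X $$ (l, j) * A $$ (t, l)) N $$ (i, t))"
    using assms by (auto simp: left_eval_def scalar_prod_def lessThan_atLeast0 mult.commute intro!: sum.cong)
  also have "\<dots> = (\<Sum>t<n. \<Sum>l<k. (poly_mat (X $$ (l, j)) N * poly_mat (A $$ (t, l)) N) $$ (i, t))"
    using N ij by (intro sum.cong refl) (simp add: poly_mat_sum_index[OF N] poly_mat_mult[OF N])
  also have "\<dots> = (\<Sum>t<n. \<Sum>l<k. \<Sum>s<n. poly_mat (X $$ (l, j)) N $$ (i, s) * poly_mat (A $$ (t, l)) N $$ (s, t))"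
    using N ij by (intro sum.cong refl) (simp add: scalar_prod_def lessThan_atLeast0)
  also have "\<dots> = (\<Sum>l<k. \<Sum>t<n. \<Sum>s<n. poly_mat (X $$ (l, j)) N $$ (i, s) * poly_mat (A $$ (t, l)) N $$ (s, t))"
    by (rule sum.swap)
  also have "\<dots> = (\<Sum>l<k. \<Sum>s<n. \<Sum>t<n. poly_mat (X $$ (l, j)) N $$ (i, s) * poly_mat (A $$ (t, l)) N $$ (s, t))"
    by (intro sum.cong refl sum.swap)
  also have "\<dots> = (\<Sum>l<k. \<Sum>s<n. poly_mat (X $$ (l, j)) N $$ (i, s) * left_eval N A $$ (s, l))"
    using N A by (intro sum.cong refl) (simp add: left_eval_def sum_distrib_left)
  finally show ?thesis .
qed

lemma poly_mat_linear_index: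
  assumes "N \<in> carrier_mat n n" "i < n" "l < n"
  shows "poly_mat [:- c, if b then 1 else 0:] N $$ (i, l)
    = (if b then N $$ (i, l) else 0) - (if i = l then c else 0)"
  using assms by (simp add: poly_mat_pCons mult_smult_distrib[of N n n _ n])

lemma left_eval_pencil:
  assumes N: "N \<in> carrier_mat n n" and ij: "i < n" "j < n"
  shows "left_eval N (pencil N) $$ (i, j) = 0"
  using assms
  by (simp add: left_eval_def pencil_def poly_mat_linear_index sum_subtractf sum.delta if_distrib[of "\<lambda>x. N $$ (i, x)"])

text \<open>
  Substituting \<open>N\<close> on the left annihilates \<open>(x I - N) B\<close> and turns \<open>A (x I - M)\<close> into \<open>N G - G M\<close>, where
  \<open>G\<close> is the value of \<open>A\<close>.
\<close>

lemma left_eval_intertwines: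
  assumes M: "M \<in> carrier_mat n n" and N: "N \<in> carrier_mat n n"
    and A: "A \<in> carrier_mat n n" and B: "B \<in> carrier_mat n n"
    and eq: "A * pencil M = pencil N * B"
  shows "N * left_eval N A = left_eval N A * M"
proof (rule eq_matI)
  have c: "left_eval N A \<in> carrier_mat n n" using N A by (simp add: left_eval_def)
  fix i j assume "i < dim_row (left_eval N A * M)" "j < dim_col (left_eval N A * M)"
  then have ij: "i < n" "j < n" using c M by auto
  let ?G = "\<lambda>s l. left_eval N A $$ (s, l)"
  have "0 = left_eval N (pencil N * B) $$ (i, j)"
    by (subst left_eval_mult[OF N pencil_carrier[OF N] B ij]) (simp add: left_eval_pencil[OF N])
  also have "\<dots> = left_eval N (A * pencil M) $$ (i, j)" by (simp add: eq)
  also have "\<dots> = (\<Sum>l<n. \<Sum>s<n. poly_mat (pencil M $$ (l, j)) N $$ (i, s) * ?G s l)"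
    by (rule left_eval_mult[OF N A pencil_carrier[OF M] ij])
  also have "\<dots> = (\<Sum>l<n. (if l = j then \<Sum>s<n. N $$ (i, s) * ?G s l else 0) - ?G i l * M $$ (l, j))"
  proof (intro sum.cong refl)
    fix l assume "l \<in> {..<n}"
    then have l: "l < n" by simp
    have "(\<Sum>s<n. poly_mat (pencil M $$ (l, j)) N $$ (i, s) * ?G s l)
        = (\<Sum>s<n. (if l = j then N $$ (i, s) * ?G s l else 0) - (if i = s then M $$ (l, j) * ?G s l else 0))"
      using M N ij l by (intro sum.cong refl) (auto simp: pencil_def poly_mat_linear_index left_diff_distrib)
    also have "\<dots> = (if l = j then \<Sum>s<n. N $$ (i, s) * ?G s l else 0) - ?G i l * M $$ (l, j)"
      using ij by (auto simp: sum_subtractf sum.delta mult.commute)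
    finally show "(\<Sum>s<n. poly_mat (pencil M $$ (l, j)) N $$ (i, s) * ?G s l)
        = (if l = j then \<Sum>s<n. N $$ (i, s) * ?G s l else 0) - ?G i l * M $$ (l, j)" .
  qed
  also have "\<dots> = (N * left_eval N A) $$ (i, j) - (left_eval N A * M) $$ (i, j)"
    using M N c ij by (simp add: sum_subtractf sum.delta scalar_prod_def lessThan_atLeast0)
  finally show "(N * left_eval N A) $$ (i, j) = (left_eval N A * M) $$ (i, j)" by simp
qed (use M N A in \<open>auto simp: left_eval_def\<close>)

text \<open>
  The values \<open>G\<close> of \<open>A\<close> at \<open>N\<close> and \<open>G'\<close> of \<open>A'\<close> at \<open>M\<close> intertwine \<open>M\<close> and \<open>N\<close> in both directions.
  Moving the powers of \<open>N\<close> through \<open>G'\<close>, where they become powers of \<open>M\<close>, shows that \<open>G' G\<close> is the value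
  of \<open>A' A = 1\<close> at \<open>M\<close>.
\<close>

lemma similar_mat_of_pencils:
  fixes M N :: "'a::field mat"
  assumes M: "M \<in> carrier_mat n n" and N: "N \<in> carrier_mat n n"
    and c: "A \<in> carrier_mat n n" "A' \<in> carrier_mat n n" "B \<in> carrier_mat n n" "B' \<in> carrier_mat n n"
    and inv: "A' * A = 1\<^sub>m n" and eq: "A * pencil M = pencil N * B" "A' * pencil N = pencil M * B'"
  shows "similar_mat N M"
proof -
  let ?G = "left_eval N A" and ?G' = "left_eval M A'"
  have gc: "?G \<in> carrier_mat n n" "?G' \<in> carrier_mat n n" using M N c by (auto simp: left_eval_def)
  have G: "N * ?G = ?G * M" by (rule left_eval_intertwines[OF M N c(1,3) eq(1)])
  have G': "M * ?G' = ?G' * N" by (rule left_eval_intertwines[OF N M c(2,4) eq(2)])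
  have "?G' * ?G = 1\<^sub>m n"
  proof (rule eq_matI)
    fix i j assume "i < dim_row (1\<^sub>m n :: 'a mat)" "j < dim_col (1\<^sub>m n :: 'a mat)"
    then have ij: "i < n" "j < n" by auto
    have "(?G' * ?G) $$ (i, j) = (\<Sum>s<n. ?G' $$ (i, s) * (\<Sum>l<n. poly_mat (A $$ (l, j)) N $$ (s, l)))"
      using gc ij N c by (simp add: scalar_prod_def lessThan_atLeast0) (simp add: left_eval_def lessThan_atLeast0)
    also have "\<dots> = (\<Sum>l<n. \<Sum>s<n. ?G' $$ (i, s) * poly_mat (A $$ (l, j)) N $$ (s, l))"
      unfolding sum_distrib_left by (rule sum.swap)
    also have "\<dots> = (\<Sum>l<n. (?G' * poly_mat (A $$ (l, j)) N) $$ (i, l))"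
      using gc ij N by (intro sum.cong refl) (simp add: scalar_prod_def lessThan_atLeast0)
    also have "\<dots> = (\<Sum>l<n. (poly_mat (A $$ (l, j)) M * ?G') $$ (i, l))"
      by (simp add: poly_mat_intertwine[OF N M gc(2) G'[symmetric]])
    also have "\<dots> = (\<Sum>l<n. \<Sum>s<n. poly_mat (A $$ (l, j)) M $$ (i, s) * ?G' $$ (s, l))"
      using gc ij M by (intro sum.cong refl) (simp add: scalar_prod_def lessThan_atLeast0)
    also have "\<dots> = left_eval M (A' * A) $$ (i, j)"
      by (rule left_eval_mult[OF M c(2,1) ij, symmetric])
    also have "\<dots> = 1\<^sub>m n $$ (i, j)"
    proof -
      have "poly_mat (1\<^sub>m n $$ (l, j)) M $$ (i, l) = (if l = j \<and> i = l then 1 else 0)" if "l < n" for l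
        using that ij M by auto
      then have "left_eval M (1\<^sub>m n) $$ (i, j) = (\<Sum>l<n. if l = j \<and> i = l then 1 else 0)"
        using ij M by (simp add: left_eval_def)
      also have "\<dots> = (\<Sum>l<n. if l = j then (if i = j then 1 else 0) else 0)"
        by (intro sum.cong) auto
      finally show ?thesis unfolding inv using ij by (simp add: sum.delta)
    qed
    finally show "(?G' * ?G) $$ (i, j) = 1\<^sub>m n $$ (i, j)" .
  qed (use gc in auto)
  then have "?G * ?G' = 1\<^sub>m n" by (rule mat_mult_left_right_inverse[OF gc(2,1)])
  then show ?thesis by (rule similar_mat_intertwineI[OF N M gc _ G])
qed

lemma pencil_transpose: "M \<in> carrier_mat n n \<Longrightarrow> pencil (transpose_mat M) = transpose_mat (pencil M)"
  by (intro eq_matI) (auto simp: pencil_def)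

text \<open>
  Over the polynomial ring \<open>x I - M\<close> is equivalent to a diagonal matrix, which equals its transpose.
  So \<open>x I - M\<close> is equivalent to its transpose, the pencil of the transpose of \<open>M\<close>.
\<close>

lemma similar_mat_transpose:
  fixes M :: "'a::field mat"
  assumes M: "M \<in> carrier_mat n n"
  shows "similar_mat (transpose_mat M) M"
proof -
  let ?P = "pencil M" and ?T = "transpose_mat :: 'a poly mat \<Rightarrow> _"
  have P: "?P \<in> carrier_mat n n" "?T ?P \<in> carrier_mat n n" using M by auto
  have "\<exists>c r. b = c * a + r \<and> (r = 0 \<or> degree r < degree a)" if "a \<noteq> 0" for a b :: "'a poly"
    using degree_mod_less[OF that, of b]
    by - (rule exI[of _ "b div a"], rule exI[of _ "b mod a"], simp)
  from diagonalise[where sz = degree, OF this P(1)] obtain r d where "mat_equivalent n ?P (diag_form n r d)" by blast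
  then obtain U V where UV: "invertible_mat U" "invertible_mat V" "U \<in> carrier_mat n n" "V \<in> carrier_mat n n"
    "diag_form n r d = U * ?P * V"
    unfolding mat_equivalent_def by blast
  obtain U' where U': "U' \<in> carrier_mat n n" "U * U' = 1\<^sub>m n" "U' * U = 1\<^sub>m n"
    using invertible_matE[OF UV(1,3)] .
  obtain V' where V': "V' \<in> carrier_mat n n" "V * V' = 1\<^sub>m n" "V' * V = 1\<^sub>m n"
    using invertible_matE[OF UV(2,4)] .
  note tr = transpose_mult[of _ n n _ n]
  note asc = assoc_mult_mat[of _ n n _ n _ n] and mc [simp] = mult_carrier_mat[of _ n n _ n]
  have T: "?T V' * ?T V = 1\<^sub>m n" "?T V * ?T V' = 1\<^sub>m n" "?T U * ?T U' = 1\<^sub>m n" "?T U' * ?T U = 1\<^sub>m n"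
    using U' V' UV(3,4) by (simp_all flip: tr)
  have cT: "?T V' \<in> carrier_mat n n" "?T V \<in> carrier_mat n n" "?T U \<in> carrier_mat n n" "?T U' \<in> carrier_mat n n"
    using U' V' UV(3,4) by auto
  have "?T (diag_form n r d) = diag_form n r d"
    by (intro eq_matI) (auto simp: diag_form_def)
  then have key: "U * ?P * V = ?T V * ?T ?P * ?T U"
    unfolding UV(5) using P UV(3,4) cT by (simp add: tr asc)
  have A: "(?T V' * U) * ?P = ?T ?P * (?T U * V')"
  proof -
    have "(?T V' * U) * ?P = ?T V' * (U * ?P * V) * V'"
      using P UV(3,4) V' cT by (simp add: asc)
    also have "\<dots> = ?T ?P * (?T U * V')"
      unfolding key using P cT V'(1) by (simp add: asc mult_cancel_inverse_mat[OF T(1), where m = n])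
    finally show ?thesis .
  qed
  have A': "(U' * ?T V) * ?T ?P = ?P * (V * ?T U')"
  proof -
    have "(U' * ?T V) * ?T ?P = U' * (?T V * ?T ?P * ?T U) * ?T U'"
      using P U'(1) cT T(3) by (simp add: asc)
    also have "\<dots> = ?P * (V * ?T U')"
      unfolding key[symmetric] using P cT U'(1) UV(3,4)
      by (simp add: asc mult_cancel_inverse_mat[OF U'(3), where m = n])
    finally show ?thesis .
  qed
  have "(U' * ?T V) * (?T V' * U) = 1\<^sub>m n"
    using U' UV(3) cT by (simp add: asc mult_cancel_inverse_mat[OF T(2), where m = n])
  moreover have "?T V' * U \<in> carrier_mat n n" "U' * ?T V \<in> carrier_mat n n"
    "?T U * V' \<in> carrier_mat n n" "V * ?T U' \<in> carrier_mat n n"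
    using U' V' UV(3,4) cT by simp_all
  moreover have "transpose_mat M \<in> carrier_mat n n" using M by simp
  ultimately show ?thesis
    using similar_mat_of_pencils[OF M _ _ _ _ _ _ A[folded pencil_transpose[OF M]]
        A'[folded pencil_transpose[OF M]]] by blast
qed

text \<open>
  Let \<open>D\<close> be the standard idempotent of rank \<open>r\<close>.  Diagonalisation gives \<open>U P = D W\<close> with \<open>U\<close>, \<open>W\<close>
  invertible.  Then \<open>X = U P U\<^bsup>-1\<^esup>\<close> satisfies \<open>D X = X\<close> and, being idempotent, \<open>X D = D\<close>.  Therefore
  \<open>Z = X - D\<close> has square zero, and \<open>1 - Z\<close> conjugates \<open>D\<close> to \<open>X\<close>.
\<close>

lemma idempotent_similar_diag:
  fixes P :: "'a::field mat"
  assumes P: "P \<in> carrier_mat n n" and idem: "P * P = P"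
  obtains r where "r \<le> n" "similar_mat P (diag_form n r (\<lambda>_. 1))"
proof -
  have "\<exists>c r. b = c * a + r \<and> (r = 0 \<or> (0::nat) < 0)" if "a \<noteq> 0" for a b :: 'a
    using that by - (rule exI[of _ "b / a"], rule exI[of _ 0], simp)
  from diagonalise[where sz = "\<lambda>_. 0", OF this P] obtain r d where
    r: "r \<le> n" "\<forall>i<r. d i \<noteq> 0" "mat_equivalent n P (diag_form n r d)" by blast
  let ?D = "diag_form n r (\<lambda>_. 1 :: 'a)"
  obtain U V where UV: "invertible_mat U" "invertible_mat V" "U \<in> carrier_mat n n" "V \<in> carrier_mat n n"
    "diag_form n r d = U * P * V"
    using r(3) unfolding mat_equivalent_def by blast
  obtain U' where U': "U' \<in> carrier_mat n n" "U * U' = 1\<^sub>m n" "U' * U = 1\<^sub>m n"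
    using invertible_matE[OF UV(1,3)] .
  obtain V' where V': "V' \<in> carrier_mat n n" "V * V' = 1\<^sub>m n" "V' * V = 1\<^sub>m n"
    using invertible_matE[OF UV(2,4)] .
  note asc = assoc_mult_mat[of _ n n _ n _ n] and mc [simp] = mult_carrier_mat[of _ n n _ n]
  \<comment> \<open>\<open>E\<close> completes the diagonal by ones, so that it becomes invertible.\<close>
  define E where "E = diag_form n n (\<lambda>i. if i < r then d i else 1)"
  define E' where "E' = diag_form n n (\<lambda>i. if i < r then 1 / d i else 1)"
  have dd: "diag_form n k a * diag_form n l b = diag_form n (min k l) (\<lambda>i. a i * b i)" for k l and a b :: "nat \<Rightarrow> 'a"
  proof (rule eq_matI)
    fix i j assume "i < dim_row (diag_form n (min k l) (\<lambda>i. a i * b i))" "j < dim_col (diag_form n (min k l) (\<lambda>i. a i * b i))"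
    then have ij: "i < n" "j < n" by (auto simp: diag_form_def)
    then have "(diag_form n k a * diag_form n l b) $$ (i, j)
        = (\<Sum>t<n. (if i = t \<and> i < k then a i else 0) * (if t = j \<and> t < l then b t else 0))"
      by (simp add: diag_form_def scalar_prod_def lessThan_atLeast0)
    also have "\<dots> = (\<Sum>t<n. if t = i then (if i < k then a i else 0) * (if i = j \<and> i < l then b i else 0) else 0)"
      by (intro sum.cong) auto
    also have "\<dots> = diag_form n (min k l) (\<lambda>i. a i * b i) $$ (i, j)"
      using ij by (auto simp: sum.delta diag_form_def)
    finally show "(diag_form n k a * diag_form n l b) $$ (i, j) = diag_form n (min k l) (\<lambda>i. a i * b i) $$ (i, j)" .
  qed (auto simp: diag_form_def)
  have one: "1\<^sub>m n = diag_form n n (\<lambda>_. 1 :: 'a)"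
    by (intro eq_matI) (auto simp: diag_form_def)
  have EE: "E * E' = 1\<^sub>m n" "E' * E = 1\<^sub>m n"
    unfolding E_def E'_def dd one using r(2) by (auto simp: diag_form_def intro!: cong_mat)
  have "diag_form n r d = ?D * E"
    unfolding E_def dd using r(1) by (auto simp: diag_form_def intro!: cong_mat)
  have Ec: "E \<in> carrier_mat n n" "E' \<in> carrier_mat n n" "?D \<in> carrier_mat n n" by (auto simp: E_def E'_def)
  define W where "W = E * V'"
  have W: "W \<in> carrier_mat n n" using Ec V' by (simp add: W_def)
  have W': "V * E' \<in> carrier_mat n n" "W * (V * E') = 1\<^sub>m n"
    using Ec V' UV(4) EE by (auto simp: W_def asc mult_cancel_inverse_mat[OF V'(3), where m = n])
  have UP: "U * P = ?D * W"
  proof -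
    have "U * P = U * P * V * V'" using P UV(3,4) V' by (simp add: asc)
    also have "\<dots> = ?D * W"
      unfolding UV(5)[symmetric] \<open>diag_form n r d = ?D * E\<close> using Ec V' by (simp add: W_def asc)
    finally show ?thesis .
  qed
  define K where "K = W * U'"
  have K: "K \<in> carrier_mat n n" using W U' by (simp add: K_def)
  define X where "X = ?D * K"
  have X: "X \<in> carrier_mat n n" using K Ec by (simp add: X_def)
  have "U * P = X * U"
    unfolding X_def K_def UP using Ec W U' UV(3) by (simp add: asc)
  then have XP: "similar_mat X P"
    using X P U' UV(3) by (intro similar_mat_intertwineI[of _ n _ U U']) auto
  have DD: "?D * ?D = ?D" unfolding dd by simp
  have XD: "X * ?D = ?D"
  proof -
    have "X * (?D * W) = ?D * W"
    proof -
      have "X * (?D * W) = X * U * P" unfolding UP[symmetric] using X UV(3) P by (simp add: asc)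
      also have "\<dots> = U * (P * P)" unfolding \<open>U * P = X * U\<close>[symmetric] using UV(3) P by (simp add: asc)
      finally show ?thesis unfolding idem UP .
    qed
    then have "X * (?D * W) * (V * E') = ?D * W * (V * E')" by simp
    then show ?thesis using X Ec W W' by (simp add: asc)
  qed
  have DX: "?D * X = X"
    unfolding X_def using assoc_mult_mat[OF Ec(3,3) K] by (simp only: DD)
  define Z where "Z = X - ?D"
  have Z: "Z \<in> carrier_mat n n" unfolding Z_def by (rule minus_carrier_mat[OF Ec(3)])
  have DZ: "?D * Z = Z"
    unfolding Z_def mult_minus_distrib_mat[OF Ec(3) X Ec(3)] DX DD ..
  have ZD: "Z * ?D = 0\<^sub>m n n"
    unfolding Z_def minus_mult_distrib_mat[OF X Ec(3,3)] XD DD by (rule minus_r_inv_mat[OF Ec(3)])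
  have ZZ: "Z * Z = 0\<^sub>m n n"
  proof -
    have "Z * Z = Z * (?D * Z)" by (simp only: DZ)
    also have "\<dots> = 0\<^sub>m n n"
      unfolding assoc_mult_mat[OF Z Ec(3) Z, symmetric] ZD by (rule left_mult_zero_mat[OF Z])
    finally show ?thesis .
  qed
  have XZ: "X * Z = Z"
  proof -
    have "X * Z = X * (?D * Z)" by (simp only: DZ)
    also have "\<dots> = Z" unfolding assoc_mult_mat[OF X Ec(3) Z, symmetric] XD by (rule DZ)
    finally show ?thesis .
  qed
  have inv: "(1\<^sub>m n - Z) * (1\<^sub>m n + Z) = 1\<^sub>m n"
  proof -
    have "(1\<^sub>m n - Z) * (1\<^sub>m n + Z) = (1\<^sub>m n - Z) * 1\<^sub>m n + (1\<^sub>m n - Z) * Z"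
      by (rule mult_add_distrib_mat[OF minus_carrier_mat[OF Z] one_carrier_mat Z])
    also have "(1\<^sub>m n - Z) * Z = Z - 0\<^sub>m n n"
      unfolding minus_mult_distrib_mat[OF one_carrier_mat Z Z] ZZ using Z by simp
    also have "(1\<^sub>m n - Z) * 1\<^sub>m n + (Z - 0\<^sub>m n n) = 1\<^sub>m n"
      using Z by (intro eq_matI) auto
    finally show ?thesis .
  qed
  have "X * (1\<^sub>m n - Z) = (1\<^sub>m n - Z) * ?D"
  proof -
    have "X * (1\<^sub>m n - Z) = X - Z"
      unfolding mult_minus_distrib_mat[OF X one_carrier_mat Z] XZ using X by simp
    also have "\<dots> = ?D - 0\<^sub>m n n"
      unfolding Z_def using X Ec by (intro eq_matI) auto
    also have "\<dots> = (1\<^sub>m n - Z) * ?D"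
      unfolding minus_mult_distrib_mat[OF one_carrier_mat Z Ec(3)] ZD using Ec by simp
    finally show ?thesis .
  qed
  then have "similar_mat X ?D"
    using X Ec inv minus_carrier_mat[OF Z] add_carrier_mat[OF Z]
    by (intro similar_mat_intertwineI[of _ n _ "1\<^sub>m n - Z" "1\<^sub>m n + Z"])
  then have "similar_mat P ?D"
    using XP similar_mat_sym similar_mat_trans by blast
  then show thesis by (rule that[OF r(1)])
qed

section \<open>The embedding of the field with q elements\<close>

text \<open>
  Polynomials with integer coefficients can be evaluated in both fields, which thereby are compared
  without passing to a common prime field.
\<close>

definition int_eval :: "int poly \<Rightarrow> 'a::comm_ring_1 \<Rightarrow> 'a" where
  "int_eval f x = poly (map_poly of_int f) x"

lemma int_eval_0 [simp]: "int_eval 0 x = 0"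
  by (simp add: int_eval_def)

lemma int_eval_pCons [simp]: "int_eval (pCons c f) x = of_int c + x * int_eval f x"
  by (simp add: int_eval_def map_poly_pCons)

lemma int_eval_add [simp]: "int_eval (f + g) x = int_eval f x + int_eval g x"
  by (induction f g rule: poly_induct2) (simp_all add: algebra_simps)

lemma int_eval_smult [simp]: "int_eval (smult c f) x = of_int c * int_eval f x"
  by (induction f) (simp_all add: algebra_simps)

lemma int_eval_mult [simp]: "int_eval (f * g) x = int_eval f x * int_eval g x"
  by (induction f) (simp_all add: algebra_simps)

lemma int_eval_diff [simp]: "int_eval (f - g) x = int_eval f x - int_eval g x"
  using int_eval_add[of "f - g" g x] by (simp del: int_eval_add add: algebra_simps)

lemma int_eval_1 [simp]: "int_eval 1 x = 1"
  by (simp add: one_pCons)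

lemma int_eval_power [simp]: "int_eval (f ^ k) x = int_eval f x ^ k"
  by (induction k) simp_all

lemma int_eval_prod [simp]: "int_eval (prod f S) x = (\<Prod>i\<in>S. int_eval (f i) x)"
  by (induction S rule: infinite_finite_induct) simp_all

lemma int_eval_monom [simp]: "int_eval (monom c k) x = of_int c * x ^ k"
  by (induction k) (simp_all add: monom_0 monom_Suc algebra_simps)

lemma primitive_element:
  obtains a :: "'a::{field,finite}" where "\<forall>y. y \<noteq> 0 \<longrightarrow> (\<exists>i::nat. y = a ^ i)"
proof -
  let ?R = "\<lparr>carrier = UNIV :: 'a set, monoid.mult = (*), one = 1, zero = 0, add = (+)\<rparr>"
  have cr: "cring ?R"
  proof (rule cringI)
    show "abelian_group ?R"
    proof (rule abelian_groupI)
      fix x :: 'a assume "x \<in> carrier ?R"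
      show "\<exists>y\<in>carrier ?R. y \<oplus>\<^bsub>?R\<^esub> x = \<zero>\<^bsub>?R\<^esub>"
        by (intro bexI[of _ "- x"]) auto
    qed (auto simp: algebra_simps)
    show "comm_monoid ?R" by (rule comm_monoidI) (auto simp: algebra_simps)
  qed (auto simp: algebra_simps)
  then interpret R: cring ?R .
  have "x \<in> Units ?R" if x: "x \<noteq> 0" for x :: 'a
    unfolding Units_def using x by (auto intro!: exI[of _ "inverse x"])
  moreover have "0 \<notin> Units ?R" unfolding Units_def by auto
  ultimately have "Units ?R = carrier ?R - {\<zero>\<^bsub>?R\<^esub>}" by auto
  then have "field ?R" by (rule R.cring_fieldI)
  then interpret R: field ?R .
  have pow: "a [^]\<^bsub>?R\<^esub> (i::nat) = a ^ i" for a :: 'a and i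
    by (induction i) (simp_all add: mult.commute)
  have "finite (carrier ?R)" by simp
  from R.finite_field_mult_group_has_gen[OF this]
  have "\<exists>a :: 'a. a \<noteq> 0 \<and> (\<forall>y. (y \<noteq> 0) = (\<exists>i. y = a ^ i))"
    by (simp add: pow set_eq_iff Bex_def)
  then obtain a :: 'a where a: "a \<noteq> 0 \<and> (\<forall>y. (y \<noteq> 0) = (\<exists>i. y = a ^ i))" by (rule exE)
  then have "\<forall>y. y \<noteq> 0 \<longrightarrow> (\<exists>i. y = a ^ i)" by simp
  then show thesis by (rule that)
qed

context
  fixes q :: nat
  assumes q: "primepow q" "CARD('a::{field,finite}) = q\<^sup>2" and qk: "CARD('k::{field,finite}) = q"
begin

lemma of_int_eq_0_transfer: "(of_int c :: 'a) = 0 \<longleftrightarrow> (of_int c :: 'k) = 0"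
proof -
  obtain p k where p: "prime p" "q = p ^ k"
    using q(1) by (auto simp: primepow_def)
  have "CHAR('a) = p" "CHAR('k) = p"
    using CHAR_eq_of_card[of p "k * 2", where ?'a = 'a] CHAR_eq_of_card[of p k, where ?'a = 'k] p q(2) qk
    by (simp_all add: power_mult)
  then show ?thesis by (simp add: of_int_eq_0_iff_char_dvd)
qed

lemma of_int_frobenius: "(of_int c :: 'a) ^ q = of_int c"
proof -
  have "(of_int (int n) :: 'a) ^ q = of_int (int n)" for n
    using q_pos[OF q] by (induction n) (simp_all add: add_q[OF q])
  then show ?thesis
    by (cases c rule: int_cases2) (simp_all add: minus_q[OF q])
qed

lemma int_eval_frobenius: "(int_eval f (x :: 'a)) ^ q = int_eval f (x ^ q)"
  using q_pos[OF q]
  by (induction f) (simp_all add: add_q[OF q] of_int_frobenius power_mult_distrib)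

text \<open>
  Division by \<open>X\<^sup>q - X\<close>, carried out over the integers so that one remainder serves both fields.
\<close>

lemma int_poly_reduce:
  fixes a :: 'k
  shows "\<exists>r. degree r < q \<and> int_eval r a = int_eval f a \<and>
    (\<forall>x :: 'a. x ^ q = x \<longrightarrow> int_eval r x = int_eval f x)"
proof (induction f)
  case 0
  show ?case using q_pos[OF q] by (intro exI[of _ 0]) simp
next
  case (pCons c f)
  then obtain r where r: "degree r < q" "int_eval r a = int_eval f a"
    "\<And>x :: 'a. x ^ q = x \<Longrightarrow> int_eval r x = int_eval f x" by blast
  let ?s = "pCons c r" and ?b = "coeff (pCons c r) q"
  let ?r = "?s - monom ?b q + monom ?b 1"
  have "a ^ q = a" using power_card_field[of a] qk by simp
  then have "int_eval ?r a = int_eval (pCons c f) a" using r(2) by simp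
  moreover have "int_eval ?r x = int_eval (pCons c f) x" if "x ^ q = x" for x :: 'a
    using r(3)[OF that] that by simp
  moreover have "degree ?r < q"
  proof -
    have "coeff ?r i = 0" if "i \<ge> q" for i
    proof (cases "i = q")
      case True
      then show ?thesis using q_gt_1[OF q] by simp
    next
      case False
      then have "degree r < i - 1" "i > 1" using that r(1) q_gt_1[OF q] by auto
      then show ?thesis using False by (simp add: coeff_pCons coeff_eq_0 split: nat.split)
    qed
    then show ?thesis using q_pos[OF q] by (intro degree_lessI) auto
  qed
  ultimately show ?case by blast
qed

text \<open>
  Otherwise every fixed point \<open>b\<close> has a polynomial \<open>F\<^sub>b\<close> that vanishes at \<open>a\<close> but not at \<open>b\<close>.  The product
  of the \<open>1 - F\<^sub>b\<^bsup>q - 1\<^esup>\<close> is \<open>1\<close> at \<open>a\<close> and vanishes at all \<open>q\<close> fixed points.  Its remainder modulo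
  \<open>X\<^sup>q - X\<close> has degree less than \<open>q\<close>, hence is zero over the large field; as both fields have the same
  characteristic, it is zero over the small one, contradicting the value \<open>1\<close> at \<open>a\<close>.
\<close>

lemma embed_root:
  fixes a :: 'k
  obtains b :: 'a where "b ^ q = b" "\<forall>f. int_eval f a = 0 \<longrightarrow> int_eval f b = 0"
proof -
  let ?A = "{x :: 'a. x ^ q = x}"
  have "\<exists>b\<in>?A. \<forall>f. int_eval f a = 0 \<longrightarrow> int_eval f b = 0"
  proof (rule ccontr)
    assume "\<not> ?thesis"
    then have "\<forall>b\<in>?A. \<exists>f. int_eval f a = 0 \<and> int_eval f b \<noteq> 0" by blast
    then obtain F where F: "\<And>b. b \<in> ?A \<Longrightarrow> int_eval (F b) a = 0 \<and> int_eval (F b) b \<noteq> 0"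
      by metis
    define H where "H = (\<Prod>b\<in>?A. 1 - F b ^ (q - 1))"
    have "int_eval H a = 1"
      using F q_gt_1[OF q] by (simp add: H_def power_0_left)
    have "int_eval H b = 0" if b: "b \<in> ?A" for b
    proof -
      let ?v = "int_eval (F b) b"
      have "?v ^ q = ?v" using b by (simp add: int_eval_frobenius)
      then have "?v * ?v ^ (q - 1) = ?v * 1"
        using q_pos[OF q] by (simp flip: power_Suc)
      then have "?v ^ (q - 1) = 1" using F[OF b] by (metis mult_left_cancel)
      then have "1 - ?v ^ (q - 1) = 0" by simp
      then show ?thesis
        unfolding H_def int_eval_prod using b by (intro prod_zero) auto
    qed
    obtain r where r: "degree r < q" "int_eval r a = int_eval H a"
      "\<And>x :: 'a. x ^ q = x \<Longrightarrow> int_eval r x = int_eval H x"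
      using int_poly_reduce[of a H] by blast
    let ?r = "map_poly of_int r :: 'a poly"
    have "?r = 0"
    proof (rule ccontr)
      assume nz: "?r \<noteq> 0"
      have "?A \<subseteq> {x. poly ?r x = 0}"
        using r(3) \<open>\<And>b. b \<in> ?A \<Longrightarrow> int_eval H b = 0\<close> by (auto simp: int_eval_def)
      then have "card ?A \<le> card {x. poly ?r x = 0}"
        by (intro card_mono) auto
      also have "\<dots> \<le> degree ?r" by (rule card_poly_roots_bound[OF nz])
      also have "\<dots> \<le> degree r" by (intro degree_le) (simp add: coeff_map_poly coeff_eq_0)
      finally show False using r(1) card_fixed_points[OF q] by simp
    qed
    then have "coeff ?r i = 0" for i by simp
    then have "(of_int (coeff r i) :: 'k) = 0" for i
      by (simp add: coeff_map_poly of_int_eq_0_transfer)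
    then have "(map_poly of_int r :: 'k poly) = 0"
      by (intro poly_eqI) (simp add: coeff_map_poly)
    then have "int_eval r a = 0" by (simp add: int_eval_def)
    then show False using r(2) \<open>int_eval H a = 1\<close> by simp
  qed
  then obtain b where b: "b \<in> ?A" "\<forall>f. int_eval f a = 0 \<longrightarrow> int_eval f b = 0" by (elim bexE)
  have "b ^ q = b" using b(1) by simp
  then show thesis using b(2) by (rule that)
qed

text \<open>
  If \<open>a\<close> generates the multiplicative group of the small field and \<open>b\<close> is chosen as in \<open>embed_root\<close>,
  then \<open>f(a) \<mapsto> f(b)\<close> is well defined.  Its image consists of fixed points, and there are just \<open>q\<close> of
  these.
\<close>

lemma finite_field_embedding:
  obtains \<iota> :: "'k \<Rightarrow> 'a" where "field_hom \<iota>" "range \<iota> = {x. x ^ q = x}"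
proof -
  obtain a :: 'k where a: "\<forall>y. y \<noteq> 0 \<longrightarrow> (\<exists>i::nat. y = a ^ i)"
    using primitive_element[where ?'a = 'k] .
  obtain b :: 'a where b: "b ^ q = b" "\<forall>f. int_eval f a = 0 \<longrightarrow> int_eval f b = 0"
    using embed_root[of a] .
  have surj: "\<exists>f. y = int_eval f a" for y
  proof (cases "y = 0")
    case True
    then show ?thesis by (intro exI[of _ 0]) simp
  next
    case False
    then obtain i where "y = a ^ i" using a by blast
    then show ?thesis by (intro exI[of _ "monom 1 i"]) simp
  qed
  define \<iota> where "\<iota> y = int_eval (SOME f. y = int_eval f a) b" for y
  have \<iota>: "\<iota> (int_eval f a) = int_eval f b" for f
  proof -
    let ?g = "SOME g. int_eval f a = int_eval g a"
    have "int_eval f a = int_eval ?g a" by (rule someI[where x = f]) simp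
    then have "int_eval (f - ?g) b = 0" by (intro b(2)[rule_format]) simp
    then show ?thesis by (simp add: \<iota>_def)
  qed
  have hom: "field_hom \<iota>"
  proof unfold_locales
    show "\<iota> 0 = 0" using \<iota>[of 0] by simp
    show "\<iota> 1 = 1" using \<iota>[of 1] by simp
    fix x y
    obtain f g where "x = int_eval f a" "y = int_eval g a" using surj[of x] surj[of y] by (elim exE)
    then show "\<iota> (x + y) = \<iota> x + \<iota> y" "\<iota> (x * y) = \<iota> x * \<iota> y"
      using \<iota>[of "f + g"] \<iota>[of "f * g"] \<iota>[of f] \<iota>[of g] by simp_all
  qed
  interpret field_hom \<iota> by (rule hom)
  have "range \<iota> \<subseteq> {x. x ^ q = x}"
    by (auto simp: \<iota>_def int_eval_frobenius b(1))
  moreover have "card (range \<iota>) = q"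
    using qk by (simp add: card_image inj_f)
  ultimately have "range \<iota> = {x. x ^ q = x}"
    using card_fixed_points[OF q] by (intro card_subset_eq) auto
  then show thesis by (rule that[OF hom])
qed

end

section \<open>Normal forms under the unitary action\<close>

definition block_diag :: "'a::zero mat \<Rightarrow> 'a mat \<Rightarrow> 'a mat" where
  "block_diag B C = four_block_mat B (0\<^sub>m (dim_row B) (dim_col C)) (0\<^sub>m (dim_row C) (dim_col B)) C"

lemma block_diag_carrier:
  "B \<in> carrier_mat a b \<Longrightarrow> C \<in> carrier_mat c d \<Longrightarrow> block_diag B C \<in> carrier_mat (a + c) (b + d)"
  by (simp add: block_diag_def)

lemma block_diag_mult:
  assumes "B \<in> carrier_mat a b" "C \<in> carrier_mat c d" "B' \<in> carrier_mat b e" "C' \<in> carrier_mat d f"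
  shows "block_diag B C * block_diag B' C' = block_diag (B * B') (C * (C' :: 'a::semiring_0 mat))"
proof -
  have c: "B * B' \<in> carrier_mat a e" "C * C' \<in> carrier_mat c f" using assms by (auto intro: mult_carrier_mat)
  have "B * B' + 0\<^sub>m a d * 0\<^sub>m d e = B * B'" "B * 0\<^sub>m b f + 0\<^sub>m a d * C' = 0\<^sub>m a f"
    "0\<^sub>m c b * B' + C * 0\<^sub>m d e = 0\<^sub>m c e" "0\<^sub>m c b * 0\<^sub>m b f + C * C' = C * C'"
    using assms c by auto
  then show ?thesis
    unfolding block_diag_def using assms
      mult_four_block_mat[OF assms(1) zero_carrier_mat[of a d] zero_carrier_mat[of c b] assms(2)
        assms(3) zero_carrier_mat[of b f] zero_carrier_mat[of d e] assms(4)]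
    by auto
qed

lemma block_diag_inject:
  assumes "B \<in> carrier_mat a b" "C \<in> carrier_mat c d" "B' \<in> carrier_mat a b" "C' \<in> carrier_mat c d"
    and eq: "block_diag B C = block_diag B' C'"
  shows "B = B'" "C = C'"
proof -
  have e: "block_diag B C $$ (i, j) = block_diag B' C' $$ (i, j)" for i j by (simp add: eq)
  show "B = B'"
  proof (rule eq_matI)
    fix i j assume "i < dim_row B'" "j < dim_col B'"
    then show "B $$ (i, j) = B' $$ (i, j)"
      using assms(1-4) e[of i j] by (simp add: block_diag_def)
  qed (use assms in auto)
  show "C = C'"
  proof (rule eq_matI)
    fix i j assume "i < dim_row C'" "j < dim_col C'"
    then show "C $$ (i, j) = C' $$ (i, j)"
      using assms(1-4) e[of "a + i" "b + j"] by (simp add: block_diag_def)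
  qed (use assms in auto)
qed

lemma block_diag_one: "block_diag (1\<^sub>m a) (1\<^sub>m b) = (1\<^sub>m (a + b) :: 'a::{zero,one} mat)"
  by (simp add: block_diag_def)

lemma block_diag_pow:
  assumes "B \<in> carrier_mat a a" "C \<in> carrier_mat b b"
  shows "block_diag B C ^\<^sub>m k = block_diag (B ^\<^sub>m k) (C ^\<^sub>m k :: 'a::semiring_1 mat)"
proof (induction k)
  case 0
  show ?case using assms block_diag_one[of a b] by (simp add: block_diag_def)
next
  case (Suc k)
  then show ?case using assms by (simp add: block_diag_mult[of _ a a _ b b _ a _ b])
qed

lemma diag_form_one_block: "r \<le> n \<Longrightarrow> diag_form n r (\<lambda>_. 1) = block_diag (1\<^sub>m r) (0\<^sub>m (n - r) (n - r))"
  by (intro eq_matI) (auto simp: diag_form_def block_diag_def Let_def)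

text \<open>
  Comparing entries: an entry of \<open>Z\<close> whose row is among the first \<open>j\<close> vanishes unless its column is among
  the first \<open>i\<close>, and vice versa.
\<close>

lemma block_diag_of_intertwine:
  fixes Z :: "'a::comm_ring_1 mat"
  assumes Z: "Z \<in> carrier_mat m n" and ij: "i \<le> n" "j \<le> m"
    and eq: "diag_form m j (\<lambda>_. 1) * Z = Z * diag_form n i (\<lambda>_. 1)"
  obtains B C where "B \<in> carrier_mat j i" "C \<in> carrier_mat (m - j) (n - i)" "Z = block_diag B C"
proof -
  have entry: "(if r < j then Z $$ (r, c) else 0) = (if c < i then Z $$ (r, c) else 0)"
    if rc: "r < m" "c < n" for r c
  proof -
    have "(diag_form m j (\<lambda>_. 1) * Z) $$ (r, c) = (\<Sum>t<m. diag_form m j (\<lambda>_. 1) $$ (r, t) * Z $$ (t, c))"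
      using Z rc by (simp add: scalar_prod_def lessThan_atLeast0)
    also have "\<dots> = (\<Sum>t<m. if t = r then (if r < j then Z $$ (r, c) else 0) else 0)"
      using rc by (intro sum.cong) (auto simp: diag_form_def)
    finally have 1: "(diag_form m j (\<lambda>_. 1) * Z) $$ (r, c) = (if r < j then Z $$ (r, c) else 0)"
      using rc by (simp add: sum.delta)
    have "(Z * diag_form n i (\<lambda>_. 1)) $$ (r, c) = (\<Sum>t<n. Z $$ (r, t) * diag_form n i (\<lambda>_. 1) $$ (t, c))"
      using Z rc by (simp add: scalar_prod_def lessThan_atLeast0)
    also have "\<dots> = (\<Sum>t<n. if t = c then (if c < i then Z $$ (r, c) else 0) else 0)"
      using rc by (intro sum.cong) (auto simp: diag_form_def)
    finally have 2: "(Z * diag_form n i (\<lambda>_. 1)) $$ (r, c) = (if c < i then Z $$ (r, c) else 0)"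
      using rc by (simp add: sum.delta)
    show ?thesis using 1 2 unfolding eq by simp
  qed
  define B where "B = mat j i (\<lambda>(r, c). Z $$ (r, c))"
  define C where "C = mat (m - j) (n - i) (\<lambda>(r, c). Z $$ (r + j, c + i))"
  have "Z = block_diag B C"
  proof (rule eq_matI)
    fix r c assume "r < dim_row (block_diag B C)" "c < dim_col (block_diag B C)"
    then have rc: "r < m" "c < n" using ij by (auto simp: B_def C_def block_diag_def)
    then show "Z $$ (r, c) = block_diag B C $$ (r, c)"
      using entry[OF rc] ij by (auto simp: B_def C_def block_diag_def split: if_splits)
  qed (use Z ij in \<open>auto simp: B_def C_def block_diag_def\<close>)
  moreover have "B \<in> carrier_mat j i" "C \<in> carrier_mat (m - j) (n - i)" by (auto simp: B_def C_def)
  ultimately show thesis by (intro that)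
qed

text \<open>
  If \<open>b < a\<close>, padding with zeros makes \<open>A\<close> and \<open>B\<close> square and mutually inverse, but the padded
  product in the other order has a zero on its diagonal.
\<close>

lemma one_mat_factor_dim:
  fixes A B :: "'a::field mat"
  assumes A: "A \<in> carrier_mat a b" and B: "B \<in> carrier_mat b a" and AB: "A * B = 1\<^sub>m a"
  shows "a \<le> b"
proof (rule ccontr)
  assume "\<not> a \<le> b"
  then have ab: "b < a" by simp
  define A' where "A' = mat a a (\<lambda>(i, j). if j < b then A $$ (i, j) else 0)"
  define B' where "B' = mat a a (\<lambda>(i, j). if i < b then B $$ (i, j) else 0)"
  have "A' * B' = A * B"
  proof (rule eq_matI)
    fix i j assume "i < dim_row (A * B)" "j < dim_col (A * B)"
    then have ij: "i < a" "j < a" using A B by auto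
    have "(A' * B') $$ (i, j) = (\<Sum>t<a. if t < b then A $$ (i, t) * B $$ (t, j) else 0)"
      using ij by (simp add: A'_def B'_def scalar_prod_def lessThan_atLeast0) (auto intro!: sum.cong)
    also have "\<dots> = (\<Sum>t<b. A $$ (i, t) * B $$ (t, j))"
      using ab by (intro sum.mono_neutral_cong_right) auto
    also have "\<dots> = (A * B) $$ (i, j)"
      using ij A B by (simp add: scalar_prod_def lessThan_atLeast0)
    finally show "(A' * B') $$ (i, j) = (A * B) $$ (i, j)" .
  qed (use A B in \<open>auto simp: A'_def B'_def\<close>)
  then have "B' * A' = 1\<^sub>m a"
    unfolding AB by (intro mat_mult_left_right_inverse[of A' a B']) (auto simp: A'_def B'_def)
  moreover have "(B' * A') $$ (b, b) = 0"
    using ab by (simp add: A'_def B'_def scalar_prod_def)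
  ultimately show False using ab by simp
qed

lemma idempotent_invertible_one:
  fixes P :: "'a::comm_ring_1 mat"
  assumes P: "P \<in> carrier_mat n n" "Q \<in> carrier_mat n n" and "P * P = P" "P * Q = 1\<^sub>m n"
  shows "P = 1\<^sub>m n"
proof -
  have "P = P * (P * Q)" using assms by simp
  also have "\<dots> = (P * P) * Q" by (rule assoc_mult_mat[symmetric, OF P(1,1,2)])
  finally show ?thesis using assms by simp
qed

lemma idempotent_nilpotent_zero:
  fixes N :: "'a::comm_ring_1 mat"
  assumes N: "N \<in> carrier_mat n n" and nil: "nilpotent_mat N" and k: "k \<ge> 1"
    and idem: "N ^\<^sub>m k * N ^\<^sub>m k = N ^\<^sub>m k"
  shows "N ^\<^sub>m k = 0\<^sub>m n n"
proof -
  obtain l where l: "N ^\<^sub>m l = 0\<^sub>m n n" using nil N by (auto simp: nilpotent_mat_def)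
  have "N ^\<^sub>m (k * Suc t) = N ^\<^sub>m k" for t
  proof (induction t)
    case (Suc t)
    have "N ^\<^sub>m (k * Suc (Suc t)) = N ^\<^sub>m (k + k * Suc t)" by simp
    also have "\<dots> = N ^\<^sub>m k"
      unfolding pow_mat_add[OF N, of k "k * Suc t"] Suc idem ..
    finally show ?case .
  qed simp
  from this[of l] have "N ^\<^sub>m k = N ^\<^sub>m (k * Suc l)" ..
  also have "k * Suc l = l + (k * Suc l - l)" using k by (cases k) auto
  also have "N ^\<^sub>m \<dots> = 0\<^sub>m n n"
    unfolding pow_mat_add[OF N] l using N by (intro left_mult_zero_mat[of _ n n]) auto
  finally show ?thesis .
qed

text \<open>
  Because \<open>(B A)\<^bsup>k + 1\<^esup> = B (A B)\<^sup>k A\<close>.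
\<close>

lemma nilpotent_mat_swap:
  fixes A B :: "'a::comm_ring_1 mat"
  assumes A: "A \<in> carrier_mat a b" and B: "B \<in> carrier_mat b a" and nil: "nilpotent_mat (A * B)"
  shows "nilpotent_mat (B * A)"
proof -
  have c: "A * B \<in> carrier_mat a a" "B * A \<in> carrier_mat b b" using A B by auto
  obtain k where k: "(A * B) ^\<^sub>m k = 0\<^sub>m a a" using nil c(1) by (auto simp: nilpotent_mat_def)
  have "B * (A * B) = (B * A) * B" using A B by (intro assoc_mult_mat[symmetric])
  from poly_mat_intertwine[OF c(1,2) B this, of "monom 1 k"]
  have "B * (A * B) ^\<^sub>m k = (B * A) ^\<^sub>m k * B" by (simp only: poly_mat_monom[OF c(1)] poly_mat_monom[OF c(2)])
  then have z: "(B * A) ^\<^sub>m k * B = 0\<^sub>m b a" unfolding k using B by simp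
  have "(B * A) ^\<^sub>m Suc k = ((B * A) ^\<^sub>m k * B) * A"
    using A B c pow_carrier_mat[OF c(2), of k] by (simp add: assoc_mult_mat[of _ b b B a A b])
  then have "(B * A) ^\<^sub>m Suc k = 0\<^sub>m b b" unfolding z using A by simp
  then show ?thesis unfolding nilpotent_mat_def using c(2) by (metis carrier_matD square_mat.simps)
qed

lemma pow_mat_conjugate:
  fixes T :: "'a::comm_ring_1 mat"
  assumes c: "T \<in> carrier_mat n n" "Y \<in> carrier_mat n n" "Y' \<in> carrier_mat n n"
    and inv: "Y' * Y = 1\<^sub>m n" "Y * Y' = 1\<^sub>m n"
  shows "(Y * T * Y') ^\<^sub>m k = Y * T ^\<^sub>m k * Y'"
proof -
  let ?R = "Y * T * Y'"
  have R: "?R \<in> carrier_mat n n" "Y * T \<in> carrier_mat n n" using c by auto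
  have "?R * Y = Y * T"
    unfolding assoc_mult_mat[OF R(2) c(3,2)] inv by (rule right_mult_one_mat[OF R(2)])
  from poly_mat_intertwine[OF c(1) R(1) c(2) this[symmetric], of "monom 1 k"]
  have "Y * T ^\<^sub>m k = ?R ^\<^sub>m k * Y" by (simp only: poly_mat_monom[OF c(1)] poly_mat_monom[OF R(1)])
  then have "Y * T ^\<^sub>m k * Y' = ?R ^\<^sub>m k * (Y * Y')"
    using assoc_mult_mat[OF pow_carrier_mat[OF R(1)] c(2,3)] by simp
  then show ?thesis unfolding inv using right_mult_one_mat[OF pow_carrier_mat[OF R(1)]] by simp
qed

context
  fixes q :: nat
  assumes q: "primepow q" "CARD('a::{field,finite}) = q\<^sup>2"
begin

abbreviation unitaries :: "nat \<Rightarrow> 'a mat set" where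
  "unitaries n \<equiv> carrier (GU TYPE('a) q n)"

lemma unitaryD:
  assumes "X \<in> unitaries n"
  shows "X \<in> carrier_mat n n" "conj_trans q X \<in> carrier_mat n n"
    "X * conj_trans q X = 1\<^sub>m n" "conj_trans q X * X = 1\<^sub>m n"
proof -
  show c: "X \<in> carrier_mat n n" "conj_trans q X \<in> carrier_mat n n" and "X * conj_trans q X = 1\<^sub>m n"
    using assms by (auto simp: carrier_GU[OF q])
  then show "conj_trans q X * X = 1\<^sub>m n" by (intro mat_mult_left_right_inverse[OF c])
qed

lemma unitaryI: "X \<in> carrier_mat n n \<Longrightarrow> X * conj_trans q X = 1\<^sub>m n \<Longrightarrow> X \<in> unitaries n"
  by (simp add: carrier_GU[OF q])

lemma conj_trans_block_diag:
  "conj_trans q (block_diag B C) = block_diag (conj_trans q B) (conj_trans q C :: 'a mat)"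
  using q_pos[OF q]
  by (intro eq_matI) (auto simp: conj_trans_def block_diag_def Let_def)

lemma conj_trans_diag_form: "conj_trans q (diag_form n r (\<lambda>_. 1)) = (diag_form n r (\<lambda>_. 1) :: 'a mat)"
  using q_pos[OF q] by (intro eq_matI) (auto simp: conj_trans_def diag_form_def)

lemma gram_transform:
  assumes A: "(A :: 'a mat) \<in> carrier_mat m n" and X: "X \<in> unitaries m" and Y: "Y \<in> unitaries n"
  shows "conj_trans q (X * A * conj_trans q Y) * (X * A * conj_trans q Y)
      = Y * (conj_trans q A * A) * conj_trans q Y"
    and "(X * A * conj_trans q Y) * conj_trans q (X * A * conj_trans q Y)
      = X * (A * conj_trans q A) * conj_trans q X"
proof -
  note uX = unitaryD[OF X] and uY = unitaryD[OF Y]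
  let ?As = "conj_trans q A" and ?Xs = "conj_trans q X" and ?Ys = "conj_trans q Y"
  have As: "?As \<in> carrier_mat n m" using A by simp
  have XA: "X * A \<in> carrier_mat m n" "Y * ?As \<in> carrier_mat n m" "A * ?Ys \<in> carrier_mat m n"
    "?As * ?Xs \<in> carrier_mat n m"
    by (rule mult_carrier_mat[OF uX(1) A], rule mult_carrier_mat[OF uY(1) As],
        rule mult_carrier_mat[OF A uY(2)], rule mult_carrier_mat[OF As uX(2)])
  have Z: "X * A * ?Ys = X * (A * ?Ys)" by (rule assoc_mult_mat[OF uX(1) A uY(2)])
  have Zs: "conj_trans q (X * A * ?Ys) = Y * (?As * ?Xs)"
    unfolding conj_trans_mult[OF q XA(1) uY(2)] conj_trans_mult[OF q uX(1) A]
    by (simp only: conj_trans_conj_trans[OF q])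
  have Zs': "Y * (?As * ?Xs) = Y * ?As * ?Xs" by (rule assoc_mult_mat[symmetric, OF uY(1) As uX(2)])
  have "conj_trans q (X * A * ?Ys) * (X * A * ?Ys) = Y * ?As * (?Xs * (X * (A * ?Ys)))"
    unfolding Zs Zs' unfolding Z
    by (rule assoc_mult_mat[OF XA(2) uX(2) mult_carrier_mat[OF uX(1) XA(3)]])
  also have "?Xs * (X * (A * ?Ys)) = A * ?Ys" by (rule mult_cancel_inverse_mat[OF uX(4,2,1) XA(3)])
  also have "Y * ?As * (A * ?Ys) = Y * ?As * A * ?Ys" by (rule assoc_mult_mat[symmetric, OF XA(2) A uY(2)])
  also have "Y * ?As * A = Y * (?As * A)" by (rule assoc_mult_mat[OF uY(1) As A])
  finally show "conj_trans q (X * A * ?Ys) * (X * A * ?Ys) = Y * (?As * A) * ?Ys" .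
  have "(X * A * ?Ys) * conj_trans q (X * A * ?Ys) = X * A * (?Ys * (Y * (?As * ?Xs)))"
    unfolding Zs by (rule assoc_mult_mat[OF XA(1) uY(2) mult_carrier_mat[OF uY(1) XA(4)]])
  also have "?Ys * (Y * (?As * ?Xs)) = ?As * ?Xs" by (rule mult_cancel_inverse_mat[OF uY(4,2,1) XA(4)])
  also have "X * A * (?As * ?Xs) = X * A * ?As * ?Xs" by (rule assoc_mult_mat[symmetric, OF XA(1) As uX(2)])
  also have "X * A * ?As = X * (A * ?As)" by (rule assoc_mult_mat[OF uX(1) A As])
  finally show "(X * A * ?Ys) * conj_trans q (X * A * ?Ys) = X * (A * ?As) * ?Xs" .
qed

lemma hermitian_idempotent_diagonal:
  assumes P: "(P :: 'a mat) \<in> carrier_mat n n" "P * P = P" "conj_trans q P = P"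
  obtains r Y where "r \<le> n" "Y \<in> unitaries n" "diag_form n r (\<lambda>_. 1) = Y * P * conj_trans q Y"
proof -
  obtain r where r: "r \<le> n" "similar_mat P (diag_form n r (\<lambda>_. 1))"
    using idempotent_similar_diag[OF P(1,2)] .
  have "similar_mat (diag_form n r (\<lambda>_. 1)) P" using r(2) by (rule similar_mat_sym)
  from hermitian_similar_unitary[OF q P(1) diag_form_carrier P(3) conj_trans_diag_form this]
  obtain Y where Y: "Y \<in> carrier_mat n n" "Y * conj_trans q Y = 1\<^sub>m n"
    "diag_form n r (\<lambda>_. 1) = Y * P * conj_trans q Y" .
  show thesis by (rule that[OF r(1) unitaryI[OF Y(1,2)] Y(3)])
qed

lemma conj_trans_pow: "T \<in> carrier_mat n n \<Longrightarrow> conj_trans q T = T \<Longrightarrow> conj_trans q (T ^\<^sub>m k) = (T ^\<^sub>m k :: 'a mat)"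
  using conj_trans_poly_mat[OF q, of T n "monom 1 k"]
  by (simp add: poly_mat_monom conj_poly_monom[OF q])

lemma conj_trans_gram:
  assumes "(A :: 'a mat) \<in> carrier_mat m n"
  shows "conj_trans q (conj_trans q A * A) = conj_trans q A * A"
  using conj_trans_mult[OF q, of "conj_trans q A" n m A n] assms by (simp add: conj_trans_conj_trans[OF q])

text \<open>
  Let \<open>T = A\<^sup>* A\<close> and \<open>S = A A\<^sup>*\<close>, with \<open>T\<^sup>k\<close> and \<open>S\<^sup>k\<close> idempotent.  Unitary matrices bring both to
  standard form, and the transformed \<open>A\<close> intertwines them, so it is a block diagonal matrix of \<open>B\<close> and \<open>C\<close>.  The
  \<open>k\<close>-th powers of \<open>B\<^sup>* B\<close> and \<open>B B\<^sup>*\<close> are identities, which makes \<open>B\<close> square and invertible, and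
  the \<open>k\<close>-th power of \<open>C\<^sup>* C\<close> is zero.
\<close>

lemma normal_form_exists:
  assumes A: "(A :: 'a mat) \<in> carrier_mat m n"
  obtains i X Y B B' C where "i \<le> m" "i \<le> n" "X \<in> unitaries m" "Y \<in> unitaries n"
    "B \<in> carrier_mat i i" "B' \<in> carrier_mat i i" "B * B' = 1\<^sub>m i" "C \<in> nil_mats TYPE('a) q (m - i) (n - i)"
    "X * A * conj_trans q Y = block_diag B C"
proof -
  let ?As = "conj_trans q A"
  define T where "T = ?As * A"
  define S where "S = A * ?As"
  have As: "?As \<in> carrier_mat n m" using A by simp
  have TS: "T \<in> carrier_mat n n" "S \<in> carrier_mat m m" unfolding T_def S_def by (rule mult_carrier_mat[OF As A], rule mult_carrier_mat[OF A As])
  have herm: "conj_trans q T = T" "conj_trans q S = S"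
    using conj_trans_gram[OF A] conj_trans_gram[OF As] by (simp_all add: T_def S_def conj_trans_conj_trans[OF q])
  \<comment> \<open>The block matrix provides a common exponent for \<open>T\<close> and \<open>S\<close>.\<close>
  obtain k where k: "k \<ge> 1" "block_diag T S ^\<^sub>m (k + k) = block_diag T S ^\<^sub>m k"
    using idempotent_power[OF block_diag_carrier[OF TS]] .
  have P: "T ^\<^sub>m k \<in> carrier_mat n n" and Q: "S ^\<^sub>m k \<in> carrier_mat m m" using TS by auto
  have "T ^\<^sub>m (k + k) = T ^\<^sub>m k" "S ^\<^sub>m (k + k) = S ^\<^sub>m k"
    using block_diag_inject[of "T ^\<^sub>m (k + k)" n n "S ^\<^sub>m (k + k)" m m "T ^\<^sub>m k" "S ^\<^sub>m k"] TS k(2)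
    by (auto simp: block_diag_pow[OF TS])
  then have PP: "T ^\<^sub>m k * T ^\<^sub>m k = T ^\<^sub>m k" and QQ: "S ^\<^sub>m k * S ^\<^sub>m k = S ^\<^sub>m k"
    by (simp_all only: pow_mat_add[OF TS(1)] pow_mat_add[OF TS(2)])
  obtain r Y where r: "r \<le> n" "Y \<in> unitaries n" "diag_form n r (\<lambda>_. 1) = Y * T ^\<^sub>m k * conj_trans q Y"
    using hermitian_idempotent_diagonal[OF P PP conj_trans_pow[OF TS(1) herm(1)]] .
  obtain s X where s: "s \<le> m" "X \<in> unitaries m" "diag_form m s (\<lambda>_. 1) = X * S ^\<^sub>m k * conj_trans q X"
    using hermitian_idempotent_diagonal[OF Q QQ conj_trans_pow[OF TS(2) herm(2)]] .
  note uX = unitaryD[OF s(2)] and uY = unitaryD[OF r(2)]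
  let ?Xs = "conj_trans q X" and ?Ys = "conj_trans q Y"
  define Z where "Z = X * A * ?Ys"
  have Z: "Z \<in> carrier_mat m n" using uX uY A by (auto simp: Z_def intro!: mult_carrier_mat)
  have Zs: "conj_trans q Z \<in> carrier_mat n m" using Z by simp
  have gram: "conj_trans q Z * Z = Y * T * ?Ys" "Z * conj_trans q Z = X * S * ?Xs"
    unfolding Z_def T_def S_def by (rule gram_transform[OF A s(2) r(2)])+
  have gramk: "(conj_trans q Z * Z) ^\<^sub>m k = diag_form n r (\<lambda>_. 1)" "(Z * conj_trans q Z) ^\<^sub>m k = diag_form m s (\<lambda>_. 1)"
    unfolding gram r(3) s(3) by (rule pow_mat_conjugate[OF TS(1) uY(1,2,4,3)], rule pow_mat_conjugate[OF TS(2) uX(1,2,4,3)])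
  have c: "conj_trans q Z * Z \<in> carrier_mat n n" "Z * conj_trans q Z \<in> carrier_mat m m" by (rule mult_carrier_mat[OF Zs Z], rule mult_carrier_mat[OF Z Zs])
  have "Z * (conj_trans q Z * Z) = (Z * conj_trans q Z) * Z" by (rule assoc_mult_mat[symmetric, OF Z Zs Z])
  from poly_mat_intertwine[OF c Z this, of "monom 1 k"]
  have "diag_form m s (\<lambda>_. 1) * Z = Z * diag_form n r (\<lambda>_. 1)"
    by (simp only: poly_mat_monom[OF c(1)] poly_mat_monom[OF c(2)] gramk)
  then obtain B C where BC: "B \<in> carrier_mat s r" "C \<in> carrier_mat (m - s) (n - r)" "Z = block_diag B C"
    using block_diag_of_intertwine[OF Z r(1) s(1)] by metis
  let ?Bs = "conj_trans q B" and ?Cs = "conj_trans q C"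
  have bc: "?Bs \<in> carrier_mat r s" "?Cs \<in> carrier_mat (n - r) (m - s)" using BC by auto
  have g1: "?Bs * B \<in> carrier_mat r r" "?Cs * C \<in> carrier_mat (n - r) (n - r)"
    "B * ?Bs \<in> carrier_mat s s" "C * ?Cs \<in> carrier_mat (m - s) (m - s)"
    by (rule mult_carrier_mat[OF bc(1) BC(1)], rule mult_carrier_mat[OF bc(2) BC(2)],
        rule mult_carrier_mat[OF BC(1) bc(1)], rule mult_carrier_mat[OF BC(2) bc(2)])
  have "block_diag ((?Bs * B) ^\<^sub>m k) ((?Cs * C) ^\<^sub>m k) = block_diag (1\<^sub>m r) (0\<^sub>m (n - r) (n - r))"
    using gramk(1) unfolding BC(3) conj_trans_block_diag block_diag_mult[OF bc BC(1,2)]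
      block_diag_pow[OF g1(1,2)] diag_form_one_block[OF r(1)] .
  note Bk = block_diag_inject[OF pow_carrier_mat[OF g1(1)] pow_carrier_mat[OF g1(2)] one_carrier_mat zero_carrier_mat this]
  have "block_diag ((B * ?Bs) ^\<^sub>m k) ((C * ?Cs) ^\<^sub>m k) = block_diag (1\<^sub>m s) (0\<^sub>m (m - s) (m - s))"
    using gramk(2) unfolding BC(3) conj_trans_block_diag block_diag_mult[OF BC(1,2) bc]
      block_diag_pow[OF g1(3,4)] diag_form_one_block[OF s(1)] .
  note Bk' = block_diag_inject[OF pow_carrier_mat[OF g1(3)] pow_carrier_mat[OF g1(4)] one_carrier_mat zero_carrier_mat this]
  have split: "U ^\<^sub>m k = U * U ^\<^sub>m (k - 1)" if "U \<in> carrier_mat l l" for U :: "'a mat" and l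
    using pow_mat_add[OF that, of 1 "k - 1"] k(1) that by simp
  have "?Bs * (B * (?Bs * B) ^\<^sub>m (k - 1)) = 1\<^sub>m r"
    using assoc_mult_mat[OF bc(1) BC(1) pow_carrier_mat[OF g1(1)], of "k - 1"] Bk(1) split[OF g1(1)] by simp
  then have "r \<le> s"
    by (rule one_mat_factor_dim[OF bc(1) mult_carrier_mat[OF BC(1) pow_carrier_mat[OF g1(1)]]])
  have right: "B * (?Bs * (B * ?Bs) ^\<^sub>m (k - 1)) = 1\<^sub>m s"
    using assoc_mult_mat[OF BC(1) bc(1) pow_carrier_mat[OF g1(3)], of "k - 1"] Bk'(1) split[OF g1(3)] by simp
  then have "s \<le> r"
    by (rule one_mat_factor_dim[OF BC(1) mult_carrier_mat[OF bc(1) pow_carrier_mat[OF g1(3)]]])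
  with \<open>r \<le> s\<close> have rs: "s = r" by simp
  have "nilpotent_mat (?Cs * C)"
    unfolding nilpotent_mat_def using g1(2) Bk(2) by (metis carrier_matD square_mat.simps)
  then have nil: "C \<in> nil_mats TYPE('a) q (m - r) (n - r)"
    using BC(2) by (simp add: nil_mats_def rs)
  show thesis
    by (rule that[of r X Y B "?Bs * (B * ?Bs) ^\<^sub>m (k - 1)" C])
       (use r(1,2) s(1,2) BC nil right mult_carrier_mat[OF bc(1) pow_carrier_mat[OF g1(3)]] in \<open>simp_all add: rs Z_def\<close>)
qed

text \<open>
  An idempotent power is the identity on the invertible block and zero on the nilpotent one.
\<close>

lemma gram_power_projection:
  assumes B: "(B :: 'a mat) \<in> carrier_mat i i" "B' \<in> carrier_mat i i" "B * B' = 1\<^sub>m i"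
    and C: "C \<in> carrier_mat c c" "nilpotent_mat C" and k: "k \<ge> 1"
    and idem: "block_diag B C ^\<^sub>m (k + k) = block_diag B C ^\<^sub>m k"
  shows "block_diag B C ^\<^sub>m k = diag_form (i + c) i (\<lambda>_. 1)"
proof -
  have p: "B ^\<^sub>m k \<in> carrier_mat i i" "C ^\<^sub>m k \<in> carrier_mat c c" using B C by auto
  have "block_diag (B ^\<^sub>m k * B ^\<^sub>m k) (C ^\<^sub>m k * C ^\<^sub>m k) = block_diag (B ^\<^sub>m k) (C ^\<^sub>m k)"
    using idem unfolding block_diag_pow[OF B(1) C(1)] pow_mat_add[OF B(1)] pow_mat_add[OF C(1)] .
  note e = block_diag_inject[OF mult_carrier_mat[OF p(1,1)] mult_carrier_mat[OF p(2,2)] p this]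
  have "B ^\<^sub>m k = 1\<^sub>m i"
    by (rule idempotent_invertible_one[OF p(1) pow_carrier_mat[OF B(2)] e(1) pow_mat_inverse[OF B]])
  moreover have "C ^\<^sub>m k = 0\<^sub>m c c" by (rule idempotent_nilpotent_zero[OF C k e(2)])
  ultimately show ?thesis
    unfolding block_diag_pow[OF B(1) C(1)] by (simp add: diag_form_one_block)
qed

text \<open>
  Conjugation by \<open>Y\<close> takes the idempotent powers of the one matrix to those of the other, and these are
  standard idempotents by \<open>gram_power_projection\<close>.  So \<open>Y\<close> is block diagonal, and being unitary it has
  square diagonal blocks.
\<close>

lemma projection_intertwine:
  assumes B: "(B1 :: 'a mat) \<in> carrier_mat i i" "B1' \<in> carrier_mat i i" "B1 * B1' = 1\<^sub>m i"
      "B2 \<in> carrier_mat j j" "B2' \<in> carrier_mat j j" "B2 * B2' = 1\<^sub>m j"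
    and C: "C1 \<in> carrier_mat (n - i) (n - i)" "nilpotent_mat C1" "C2 \<in> carrier_mat (n - j) (n - j)" "nilpotent_mat C2"
    and ij: "i \<le> n" "j \<le> n" and Y: "Y \<in> unitaries n"
    and eq: "block_diag B2 C2 = Y * block_diag B1 C1 * conj_trans q Y"
  obtains Y1 Y2 where "i = j" "Y1 \<in> unitaries i" "Y2 \<in> unitaries (n - i)" "Y = block_diag Y1 Y2"
proof -
  note uY = unitaryD[OF Y]
  let ?T1 = "block_diag B1 C1" and ?T2 = "block_diag B2 C2" and ?Ys = "conj_trans q Y"
  have T: "?T1 \<in> carrier_mat n n" "?T2 \<in> carrier_mat n n"
    using block_diag_carrier[OF B(1) C(1)] block_diag_carrier[OF B(4) C(3)] ij by simp_all
  obtain k where k: "k \<ge> 1" "?T1 ^\<^sub>m (k + k) = ?T1 ^\<^sub>m k" using idempotent_power[OF T(1)] .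
  have pow: "?T2 ^\<^sub>m l = Y * ?T1 ^\<^sub>m l * ?Ys" for l
    unfolding eq by (rule pow_mat_conjugate[OF T(1) uY(1,2,4,3)])
  have k2: "?T2 ^\<^sub>m (k + k) = ?T2 ^\<^sub>m k" unfolding pow k(2) ..
  have D: "?T1 ^\<^sub>m k = diag_form n i (\<lambda>_. 1)" "?T2 ^\<^sub>m k = diag_form n j (\<lambda>_. 1)"
    using gram_power_projection[OF B(1-3) C(1,2) k] gram_power_projection[OF B(4-6) C(3,4) k(1) k2] ij by simp_all
  have "diag_form n j (\<lambda>_. 1) * Y = Y * diag_form n i (\<lambda>_. 1) * (?Ys * Y)"
    unfolding D[symmetric] pow
    by (rule assoc_mult_mat) (use uY T in \<open>auto intro!: mult_carrier_mat\<close>)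
  also have "\<dots> = Y * diag_form n i (\<lambda>_. 1)"
    unfolding uY(4) by (rule right_mult_one_mat[OF mult_carrier_mat[OF uY(1) diag_form_carrier]])
  finally obtain Y1 Y2 where YY: "Y1 \<in> carrier_mat j i" "Y2 \<in> carrier_mat (n - j) (n - i)" "Y = block_diag Y1 Y2"
    using block_diag_of_intertwine[OF uY(1) ij] by metis
  have s: "conj_trans q Y1 \<in> carrier_mat i j" "conj_trans q Y2 \<in> carrier_mat (n - i) (n - j)" using YY by auto
  have "block_diag (Y1 * conj_trans q Y1) (Y2 * conj_trans q Y2) = block_diag (1\<^sub>m j) (1\<^sub>m (n - j))"
    using uY(3) ij unfolding YY(3) conj_trans_block_diag block_diag_mult[OF YY(1,2) s] block_diag_one by simp
  note r = block_diag_inject[OF mult_carrier_mat[OF YY(1) s(1)] mult_carrier_mat[OF YY(2) s(2)]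
      one_carrier_mat one_carrier_mat this]
  have "block_diag (conj_trans q Y1 * Y1) (conj_trans q Y2 * Y2) = block_diag (1\<^sub>m i) (1\<^sub>m (n - i))"
    using uY(4) ij unfolding YY(3) conj_trans_block_diag block_diag_mult[OF s YY(1,2)] block_diag_one by simp
  note l = block_diag_inject[OF mult_carrier_mat[OF s(1) YY(1)] mult_carrier_mat[OF s(2) YY(2)]
      one_carrier_mat one_carrier_mat this]
  have ij': "i = j"
    using one_mat_factor_dim[OF YY(1) s(1) r(1)] one_mat_factor_dim[OF s(1) YY(1) l(1)] by simp
  show thesis
    by (rule that[of Y1 Y2]) (use ij' YY r in \<open>auto intro!: unitaryI\<close>)
qed

lemma gram_invertible:
  assumes "(B :: 'a mat) \<in> carrier_mat i i" "B' \<in> carrier_mat i i" "B * B' = 1\<^sub>m i"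
  shows "conj_trans q B * B * (B' * conj_trans q B') = 1\<^sub>m i"
    and "B * conj_trans q B * (conj_trans q B' * B') = 1\<^sub>m i"
proof -
  have s: "conj_trans q B \<in> carrier_mat i i" "conj_trans q B' \<in> carrier_mat i i" using assms by auto
  have BB: "B' * B = 1\<^sub>m i" by (rule mat_mult_left_right_inverse[OF assms])
  have 1: "conj_trans q B * conj_trans q B' = 1\<^sub>m i"
    unfolding conj_trans_mult[OF q assms(2,1), symmetric] BB by (rule conj_trans_one[OF q])
  note asc = assoc_mult_mat[of _ i i _ i _ i] and mc = mult_carrier_mat[of _ i i _ i]
  show "conj_trans q B * B * (B' * conj_trans q B') = 1\<^sub>m i"
    using assms s 1 by (simp add: asc mc mult_cancel_inverse_mat[OF assms(3), where m = i])
  show "B * conj_trans q B * (conj_trans q B' * B') = 1\<^sub>m i"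
    using assms s 1 by (simp add: asc mc mult_cancel_inverse_mat[OF 1, where m = i])
qed

text \<open>
  Both Gram matrices of \<open>block_diag B C\<close> have an invertible and a nilpotent block, and they are carried
  to those of \<open>block_diag D E\<close> by \<open>Y\<close> and by \<open>X\<close>.  Hence \<open>X\<close> and \<open>Y\<close> are block diagonal.
\<close>

lemma normal_form_unique:
  assumes B: "(B :: 'a mat) \<in> carrier_mat i i" "B' \<in> carrier_mat i i" "B * B' = 1\<^sub>m i"
      "D \<in> carrier_mat j j" "D' \<in> carrier_mat j j" "D * D' = 1\<^sub>m j"
    and C: "C \<in> nil_mats TYPE('a) q (m - i) (n - i)" "E \<in> nil_mats TYPE('a) q (m - j) (n - j)"
    and ij: "i \<le> m" "i \<le> n" "j \<le> m" "j \<le> n"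
    and XY: "X \<in> unitaries m" "Y \<in> unitaries n"
    and eq: "block_diag D E = X * block_diag B C * conj_trans q Y"
  obtains X1 X2 Y1 Y2 where "i = j" "X1 \<in> unitaries i" "X2 \<in> unitaries (m - i)"
    "Y1 \<in> unitaries i" "Y2 \<in> unitaries (n - i)" "D = X1 * B * conj_trans q Y1" "E = X2 * C * conj_trans q Y2"
proof -
  have Cc: "C \<in> carrier_mat (m - i) (n - i)" "E \<in> carrier_mat (m - j) (n - j)"
    and nil: "nilpotent_mat (conj_trans q C * C)" "nilpotent_mat (conj_trans q E * E)"
    using C by (auto simp: nil_mats_def)
  let ?s = "conj_trans q :: 'a mat \<Rightarrow> 'a mat"
  have sc: "?s B \<in> carrier_mat i i" "?s D \<in> carrier_mat j j" "?s C \<in> carrier_mat (n - i) (m - i)"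
    "?s E \<in> carrier_mat (n - j) (m - j)" "?s B' \<in> carrier_mat i i" "?s D' \<in> carrier_mat j j"
    using B Cc by auto
  have nil': "nilpotent_mat (C * ?s C)" "nilpotent_mat (E * ?s E)"
    by (rule nilpotent_mat_swap[OF sc(3) Cc(1) nil(1)], rule nilpotent_mat_swap[OF sc(4) Cc(2) nil(2)])
  have A: "block_diag B C \<in> carrier_mat m n" using block_diag_carrier[OF B(1) Cc(1)] ij by simp
  have 1: "block_diag (?s D * D) (?s E * E) = Y * block_diag (?s B * B) (?s C * C) * ?s Y"
    using gram_transform(1)[OF A XY]
    unfolding eq[symmetric] conj_trans_block_diag block_diag_mult[OF sc(2,4) B(4) Cc(2)]
      block_diag_mult[OF sc(1,3) B(1) Cc(1)] .
  have 2: "block_diag (D * ?s D) (E * ?s E) = X * block_diag (B * ?s B) (C * ?s C) * ?s X"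
    using gram_transform(2)[OF A XY]
    unfolding eq[symmetric] conj_trans_block_diag block_diag_mult[OF B(4) Cc(2) sc(2,4)]
      block_diag_mult[OF B(1) Cc(1) sc(1,3)] .
  obtain Y1 Y2 where Y: "i = j" "Y1 \<in> unitaries i" "Y2 \<in> unitaries (n - i)" "Y = block_diag Y1 Y2"
    using projection_intertwine[OF mult_carrier_mat[OF sc(1) B(1)] mult_carrier_mat[OF B(2) sc(5)]
        gram_invertible(1)[OF B(1-3)] mult_carrier_mat[OF sc(2) B(4)] mult_carrier_mat[OF B(5) sc(6)]
        gram_invertible(1)[OF B(4-6)] mult_carrier_mat[OF sc(3) Cc(1)] nil(1) mult_carrier_mat[OF sc(4) Cc(2)]
        nil(2) ij(2,4) XY(2) 1] .
  obtain X1 X2 where X: "i = j" "X1 \<in> unitaries i" "X2 \<in> unitaries (m - i)" "X = block_diag X1 X2"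
    using projection_intertwine[OF mult_carrier_mat[OF B(1) sc(1)] mult_carrier_mat[OF sc(5) B(2)]
        gram_invertible(2)[OF B(1-3)] mult_carrier_mat[OF B(4) sc(2)] mult_carrier_mat[OF sc(6) B(5)]
        gram_invertible(2)[OF B(4-6)] mult_carrier_mat[OF Cc(1) sc(3)] nil'(1) mult_carrier_mat[OF Cc(2) sc(4)]
        nil'(2) ij(1,3) XY(1) 2] .
  note uX1 = unitaryD[OF X(2)] and uX2 = unitaryD[OF X(3)] and uY1 = unitaryD[OF Y(2)] and uY2 = unitaryD[OF Y(3)]
  have c: "X1 * B \<in> carrier_mat i i" "X2 * C \<in> carrier_mat (m - i) (n - i)"
    by (rule mult_carrier_mat[OF uX1(1) B(1)], rule mult_carrier_mat[OF uX2(1) Cc(1)])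
  have "block_diag D E = block_diag (X1 * B * ?s Y1) (X2 * C * ?s Y2)"
    unfolding eq X(4) Y(4) conj_trans_block_diag block_diag_mult[OF uX1(1) uX2(1) B(1) Cc(1)]
    by (rule block_diag_mult[OF c uY1(2) uY2(2)])
  moreover have "D \<in> carrier_mat i i" "E \<in> carrier_mat (m - i) (n - i)" using B(4) Cc(2) Y(1) by auto
  ultimately have "D = X1 * B * ?s Y1" "E = X2 * C * ?s Y2"
    using block_diag_inject[OF _ _ mult_carrier_mat[OF c(1) uY1(2)] mult_carrier_mat[OF c(2) uY2(2)]] by auto
  then show thesis by (intro that[OF Y(1) X(2,3) Y(2,3)])
qed

end

section \<open>Counting the orbits\<close>

text \<open>
  Counts orbits by a complete invariant with values in \<open>K\<close>.  The invariant is given by a relation,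
  since it is read off from a normal form that depends on choices.
\<close>

lemma card_orbits_eq_card_keys:
  assumes total: "\<And>x. x \<in> E \<Longrightarrow> \<exists>y\<in>K. R x y"
    and surj: "\<And>y. y \<in> K \<Longrightarrow> \<exists>x\<in>E. R x y"
    and eq: "\<And>x x' y y'. x \<in> E \<Longrightarrow> x' \<in> E \<Longrightarrow> y \<in> K \<Longrightarrow> y' \<in> K \<Longrightarrow> R x y \<Longrightarrow> R x' y' \<Longrightarrow>
      orbit G \<phi> x = orbit G \<phi> x' \<longleftrightarrow> y = y'"
  shows "card (orbits G E \<phi>) = card K"
proof -
  define s where "s y = (SOME x. x \<in> E \<and> R x y)" for y
  have s: "s y \<in> E \<and> R (s y) y" if "y \<in> K" for y
    unfolding s_def by (rule someI_ex) (use surj[OF that] in auto)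
  have "bij_betw (\<lambda>y. orbit G \<phi> (s y)) K (orbits G E \<phi>)"
  proof (rule bij_betw_imageI)
    show "inj_on (\<lambda>y. orbit G \<phi> (s y)) K"
    proof (rule inj_onI)
      fix y y' assume y: "y \<in> K" "y' \<in> K" and o: "orbit G \<phi> (s y) = orbit G \<phi> (s y')"
      show "y = y'" using eq[of "s y" "s y'" y y'] s[OF y(1)] s[OF y(2)] y o by simp
    qed
    have "\<exists>y\<in>K. orbit G \<phi> x = orbit G \<phi> (s y)" if x: "x \<in> E" for x
    proof -
      obtain y where y: "y \<in> K" "R x y" using total[OF x] by (elim bexE)
      then have "orbit G \<phi> x = orbit G \<phi> (s y)" using eq[OF x _ y(1) y(1) y(2)] s[OF y(1)] by simp
      then show ?thesis using y(1) by (intro bexI)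
    qed
    then show "(\<lambda>y. orbit G \<phi> (s y)) ` K = orbits G E \<phi>"
      unfolding orbits_def
    proof (intro equalityI subsetI)
      fix S assume "S \<in> (\<lambda>y. orbit G \<phi> (s y)) ` K"
      then show "S \<in> {orbit G \<phi> x | x. x \<in> E}" using s by auto
    next
      fix S assume "S \<in> {orbit G \<phi> x | x. x \<in> E}"
      then obtain x where x: "x \<in> E" "S = orbit G \<phi> x" by auto
      obtain y where "y \<in> K" "orbit G \<phi> x = orbit G \<phi> (s y)"
        using \<open>\<And>x. x \<in> E \<Longrightarrow> \<exists>y\<in>K. orbit G \<phi> x = orbit G \<phi> (s y)\<close>[OF x(1)] by (elim bexE)
      then show "S \<in> (\<lambda>y. orbit G \<phi> (s y)) ` K" unfolding x(2) by (intro image_eqI)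
    qed
  qed
  then show ?thesis by (simp add: bij_betw_same_card)
qed

lemma (in group_action) orbit_eq_iff:
  assumes "x \<in> E" "y \<in> E"
  shows "orbit G \<phi> x = orbit G \<phi> y \<longleftrightarrow> y \<in> orbit G \<phi> x"
proof
  assume "orbit G \<phi> x = orbit G \<phi> y"
  then show "y \<in> orbit G \<phi> x" using orbit_refl[OF assms(2)] by simp
next
  assume y: "y \<in> orbit G \<phi> x"
  then have x: "x \<in> orbit G \<phi> y" by (rule orbit_sym[OF assms])
  have sub: "orbit G \<phi> z \<subseteq> E" if "z \<in> E" for z
    using that element_image unfolding orbit_def by blast
  show "orbit G \<phi> x = orbit G \<phi> y"
  proof (intro equalityI subsetI)
    fix z assume z: "z \<in> orbit G \<phi> x"
    then show "z \<in> orbit G \<phi> y" using orbit_trans[OF assms(2,1) _ x z] sub[OF assms(1)] by blast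
  next
    fix z assume z: "z \<in> orbit G \<phi> y"
    then show "z \<in> orbit G \<phi> x" using orbit_trans[OF assms(1,2) _ y z] sub[OF assms(2)] by blast
  qed
qed

lemma conjugacy_orbit_iff:
  assumes M: "M \<in> carrier (GL TYPE('k::field) n)" and M': "M' \<in> carrier (GL TYPE('k) n)"
  shows "M' \<in> orbit (GL TYPE('k) n) (\<lambda>g. \<lambda>h\<in>carrier (GL TYPE('k) n).
      g \<otimes>\<^bsub>GL TYPE('k) n\<^esub> h \<otimes>\<^bsub>GL TYPE('k) n\<^esub> inv\<^bsub>GL TYPE('k) n\<^esub> g) M \<longleftrightarrow> similar_mat M' M"
    (is "?l \<longleftrightarrow> ?r")
proof -
  let ?G = "GL TYPE('k) n"
  interpret G: group ?G by (rule group_GL)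
  have c: "g \<in> carrier_mat n n" if "g \<in> carrier ?G" for g
    using that by (simp add: carrier_GL_iff)
  have iff: "M' = g \<otimes>\<^bsub>?G\<^esub> M \<otimes>\<^bsub>?G\<^esub> inv\<^bsub>?G\<^esub> g \<longleftrightarrow> M' * g = g * M" if g: "g \<in> carrier ?G" for g
    using G.inv_solve_right[OF M' G.m_closed[OF g M] g] by auto
  show ?thesis
  proof
    assume ?l
    then obtain g where g: "g \<in> carrier ?G" "M' = g \<otimes>\<^bsub>?G\<^esub> M \<otimes>\<^bsub>?G\<^esub> inv\<^bsub>?G\<^esub> g"
      using M unfolding orbit_def by auto
    have "M' * g = g * M" by (rule iffD1[OF iff[OF g(1)] g(2)])
    moreover have "g * inv\<^bsub>?G\<^esub> g = 1\<^sub>m n" using G.r_inv[OF g(1)] by simp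
    ultimately show ?r
      using c[OF M] c[OF M'] c[OF g(1)] c[OF G.inv_closed[OF g(1)]] by (intro similar_mat_intertwineI)
  next
    assume ?r
    then obtain g h where g: "g \<in> carrier_mat n n" "h \<in> carrier_mat n n" "g * h = 1\<^sub>m n" "M' * g = g * M"
      by (rule similar_mat_intertwineE[OF _ c[OF M']])
    have gG: "g \<in> carrier ?G" unfolding carrier_GL_iff using g(1-3) by auto
    have "M' = g \<otimes>\<^bsub>?G\<^esub> M \<otimes>\<^bsub>?G\<^esub> inv\<^bsub>?G\<^esub> g" by (rule iffD2[OF iff[OF gG] g(4)])
    then show ?l unfolding orbit_def using gG M by auto
  qed
qed

context
  fixes q :: nat and \<iota> :: "'k::{field,finite} \<Rightarrow> 'a::{field,finite}"
  assumes q: "primepow q" "CARD('a) = q\<^sup>2"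
    and hom: "field_hom \<iota>" and range: "range \<iota> = {x. x ^ q = x}"
begin

interpretation field_hom \<iota> by (rule hom)

lemma fixed_preimage:
  assumes "A \<in> carrier_mat n m" "map_mat (\<lambda>x. x ^ q) A = A"
  obtains A0 where "A0 \<in> carrier_mat n m" "A = map_mat \<iota> A0"
proof (rule that)
  let ?A0 = "map_mat (inv_into UNIV \<iota>) A"
  show "?A0 \<in> carrier_mat n m" using assms(1) by simp
  show "A = map_mat \<iota> ?A0"
  proof (rule eq_matI)
    fix i j assume "i < dim_row (map_mat \<iota> ?A0)" "j < dim_col (map_mat \<iota> ?A0)"
    then have ij: "i < dim_row A" "j < dim_col A" by auto
    have "A $$ (i, j) ^ q = A $$ (i, j)" using arg_cong[OF assms(2), of "\<lambda>M. M $$ (i, j)"] ij by simp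
    then have "A $$ (i, j) \<in> range \<iota>" using range by simp
    then show "A $$ (i, j) = map_mat \<iota> ?A0 $$ (i, j)" using ij by (simp add: f_inv_into_f)
  qed auto
qed

lemma frobenius_map_embedding: "map_mat (\<lambda>x. x ^ q) (map_mat \<iota> M) = map_mat \<iota> M"
  using range by (intro eq_matI) auto

lemma map_embedding_inject:
  assumes "map_mat \<iota> A = map_mat \<iota> B"
  shows "A = B"
proof (rule eq_matI)
  show "dim_row A = dim_row B" "dim_col A = dim_col B"
    using arg_cong[OF assms, of dim_row] arg_cong[OF assms, of dim_col] by simp_all
  fix i j assume ij: "i < dim_row B" "j < dim_col B"
  then have "\<iota> (A $$ (i, j)) = \<iota> (B $$ (i, j))"
    using arg_cong[OF assms, of "\<lambda>M. M $$ (i, j)"] \<open>dim_row A = dim_row B\<close> \<open>dim_col A = dim_col B\<close> by simp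
  then show "A $$ (i, j) = B $$ (i, j)" by simp
qed

lemma similar_embedding_iff:
  assumes M: "M \<in> carrier_mat n n" "M' \<in> carrier_mat n n"
  shows "similar_mat (map_mat \<iota> M') (map_mat \<iota> M) \<longleftrightarrow> similar_mat M' M"
proof
  note hm = mat_hom_mult[of _ n n _ n]
  assume "similar_mat M' M"
  then obtain g h where g: "g \<in> carrier_mat n n" "h \<in> carrier_mat n n" "g * h = 1\<^sub>m n" "h * g = 1\<^sub>m n"
    "M' * g = g * M" by (rule similar_mat_intertwineE[OF _ M(2)])
  have "map_mat \<iota> g * map_mat \<iota> h = 1\<^sub>m n" "map_mat \<iota> M' * map_mat \<iota> g = map_mat \<iota> g * map_mat \<iota> M"
    unfolding hm[OF g(1,2), symmetric] hm[OF M(2) g(1), symmetric] hm[OF g(1) M(1), symmetric] g(3,5)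
    by (simp_all add: mat_hom_one)
  then show "similar_mat (map_mat \<iota> M') (map_mat \<iota> M)"
    using M g by (intro similar_mat_intertwineI[of _ n _ "map_mat \<iota> g" "map_mat \<iota> h"]) simp_all
next
  note hm = mat_hom_mult[of _ n n _ n]
  assume sim: "similar_mat (map_mat \<iota> M') (map_mat \<iota> M)"
  have c: "map_mat \<iota> M \<in> carrier_mat n n" "map_mat \<iota> M' \<in> carrier_mat n n" using M by auto
  obtain g h where g: "g \<in> carrier_mat n n" "h \<in> carrier_mat n n" "map_mat (\<lambda>x. x ^ q) g = g"
      "map_mat (\<lambda>x. x ^ q) h = h" "g * h = 1\<^sub>m n" "map_mat \<iota> M' * g = g * map_mat \<iota> M"
    using fixed_similar_descent[OF q c frobenius_map_embedding frobenius_map_embedding sim] .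
  obtain g0 where g0: "g0 \<in> carrier_mat n n" "g = map_mat \<iota> g0" using fixed_preimage[OF g(1,3)] .
  obtain h0 where h0: "h0 \<in> carrier_mat n n" "h = map_mat \<iota> h0" using fixed_preimage[OF g(2,4)] .
  have "map_mat \<iota> (g0 * h0) = map_mat \<iota> (1\<^sub>m n)" "map_mat \<iota> (M' * g0) = map_mat \<iota> (g0 * M)"
    using g(5,6) unfolding hm[OF g0(1) h0(1)] hm[OF M(2) g0(1)] hm[OF g0(1) M(1)] g0(2) h0(2)
    by (simp_all add: mat_hom_one)
  then have "g0 * h0 = 1\<^sub>m n" "M' * g0 = g0 * M" by (auto dest: map_embedding_inject)
  then show "similar_mat M' M" using M g0(1) h0(1) by (intro similar_mat_intertwineI[of _ n _ g0 h0])
qed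

text \<open>
  As \<open>B\<^sup>* B\<close> is Hermitian, its image under the Frobenius map is its transpose, to which it is similar.
\<close>

lemma gram_similar_to_embedded:
  assumes B: "(B :: 'a mat) \<in> carrier_mat n n" "B' \<in> carrier_mat n n" "B * B' = 1\<^sub>m n"
  obtains M where "M \<in> carrier (GL TYPE('k) n)" "similar_mat (conj_trans q B * B) (map_mat \<iota> M)"
proof -
  let ?H = "conj_trans q B * B"
  have H: "?H \<in> carrier_mat n n" using mult_carrier_mat[OF conj_trans_carrier[OF B(1)] B(1)] .
  have "conj_trans q ?H = ?H" by (rule conj_trans_gram[OF q B(1)])
  then have "transpose_mat (map_mat (\<lambda>x. x ^ q) ?H) = ?H" by (simp only: conj_trans_def)
  then have "map_mat (\<lambda>x. x ^ q) ?H = transpose_mat ?H" by (metis transpose_transpose)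
  then have "similar_mat (map_mat (\<lambda>x. x ^ q) ?H) ?H" using similar_mat_transpose[OF H] by simp
  then obtain N where N: "N \<in> carrier_mat n n" "map_mat (\<lambda>x. x ^ q) N = N" "similar_mat N ?H"
    by (rule frob_similar_fixed[OF q H])
  obtain M where M: "M \<in> carrier_mat n n" "N = map_mat \<iota> M" using fixed_preimage[OF N(1,2)] .
  have "det ?H * det (B' * conj_trans q B') = det (1\<^sub>m n :: 'a mat)"
    using arg_cong[OF gram_invertible(1)[OF q B], of det]
    by (simp only: det_mult[OF H mult_carrier_mat[OF B(2) conj_trans_carrier[OF B(2)]]])
  then have "det ?H \<noteq> 0" by (metis det_one mult_zero_left zero_neq_one)
  obtain g h where g: "g \<in> carrier_mat n n" "h \<in> carrier_mat n n" "g * h = 1\<^sub>m n" "N * g = g * ?H"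
    by (rule similar_mat_intertwineE[OF N(3,1)])
  have "det N * det g = det g * det ?H"
    using arg_cong[OF g(4), of det] by (simp only: det_mult[OF N(1) g(1)] det_mult[OF g(1) H])
  moreover have "det g * det h = 1" using arg_cong[OF g(3), of det] by (simp add: det_mult[OF g(1,2)])
  ultimately have "det N \<noteq> 0" using \<open>det ?H \<noteq> 0\<close> by auto
  then have "det M \<noteq> 0" unfolding M(2) hom_det[symmetric] by auto
  then have "M \<in> carrier (GL TYPE('k) n)"
    using det_non_zero_imp_unit[OF M(1)] by (simp add: GL_def units_of_def)
  moreover have "similar_mat ?H (map_mat \<iota> M)" using similar_mat_sym[OF N(3)] M(2) by simp
  ultimately show thesis by (rule that)
qed

text \<open>
  Over the subfield \<open>M\<^sup>*\<close> is the transpose of \<open>M\<close>, to which \<open>M\<close> is similar.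
\<close>

lemma embedded_similar_to_gram:
  assumes M: "M \<in> carrier (GL TYPE('k) n)"
  obtains B B' :: "'a mat" where "B \<in> carrier_mat n n" "B' \<in> carrier_mat n n" "B * B' = 1\<^sub>m n"
    "similar_mat (conj_trans q B * B) (map_mat \<iota> M)"
proof -
  note hm = mat_hom_mult[of _ n n _ n]
  obtain M' where M': "M \<in> carrier_mat n n" "M' \<in> carrier_mat n n" "M * M' = 1\<^sub>m n"
    using M unfolding carrier_GL_iff by (elim conjE bexE)
  let ?N = "map_mat \<iota> M" and ?N' = "map_mat \<iota> M'"
  have N: "?N \<in> carrier_mat n n" "?N' \<in> carrier_mat n n" using M' by auto
  have NN: "?N * ?N' = 1\<^sub>m n" unfolding hm[OF M'(1,2), symmetric] M'(3) by (rule mat_hom_one)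
  have "conj_trans q ?N = transpose_mat ?N" by (simp only: conj_trans_def frobenius_map_embedding)
  then have "similar_mat (conj_trans q ?N) ?N" using similar_mat_transpose[OF N(1)] by simp
  then obtain H where H: "H \<in> carrier_mat n n" "conj_trans q H = H" "similar_mat H ?N"
    by (rule similar_conj_trans_hermitian[OF q N(1)])
  obtain g h where g: "g \<in> carrier_mat n n" "h \<in> carrier_mat n n" "g * h = 1\<^sub>m n" "h * g = 1\<^sub>m n"
    "H * g = g * ?N" by (rule similar_mat_intertwineE[OF H(3,1)])
  have ginv: "g * ?N' \<in> carrier_mat n n" "g * ?N' * h \<in> carrier_mat n n"
    using g N by (auto intro: mult_carrier_mat)
  have "H * (g * ?N' * h) = H * g * ?N' * h"
    using H(1) g(1,2) N ginv by (simp add: assoc_mult_mat[of _ n n _ n _ n] mult_carrier_mat[of _ n n _ n])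
  also have "\<dots> = g * (?N * ?N') * h"
    unfolding g(5) using g(1,2) N by (simp add: assoc_mult_mat[of _ n n _ n _ n] mult_carrier_mat[of _ n n _ n])
  also have "\<dots> = 1\<^sub>m n" unfolding NN using g(1,3) by simp
  finally have Hinv: "H * (g * ?N' * h) = 1\<^sub>m n" .
  obtain p e where p: "e \<in> carrier_mat n n" "poly_mat p H * e = 1\<^sub>m n" "e * poly_mat p H = 1\<^sub>m n"
    "conj_trans q (poly_mat p H) * poly_mat p H = H"
    using hermitian_gram[OF q H(1) ginv(2) Hinv H(2)] .
  show thesis
    by (rule that[OF poly_mat_carrier[OF H(1)] p(1,2)]) (simp only: p(4) H(3))
qed

text \<open>
  If \<open>D\<^sup>* D\<close> and \<open>B\<^sup>* B\<close> are similar, then \<open>D\<^sup>* D = u (B\<^sup>* B) u\<^sup>*\<close> for a unitary \<open>u\<close>.  This makes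
  \<open>X = D u B\<^bsup>-1\<^esup>\<close> unitary, and \<open>D = X B u\<^sup>*\<close>.
\<close>

lemma unitary_equivalent_iff:
  assumes B: "(B :: 'a mat) \<in> carrier_mat n n" "B' \<in> carrier_mat n n" "B * B' = 1\<^sub>m n"
    and D: "D \<in> carrier_mat n n"
  shows "(\<exists>X\<in>unitaries q n. \<exists>Y\<in>unitaries q n. D = X * B * conj_trans q Y)
    \<longleftrightarrow> similar_mat (conj_trans q D * D) (conj_trans q B * B)"
proof
  let ?s = "conj_trans q :: 'a mat \<Rightarrow> 'a mat"
  have sc: "?s B \<in> carrier_mat n n" "?s D \<in> carrier_mat n n" "?s B' \<in> carrier_mat n n" using B D by auto
  have H: "?s B * B \<in> carrier_mat n n" "?s D * D \<in> carrier_mat n n"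
    by (rule mult_carrier_mat[OF sc(1) B(1)], rule mult_carrier_mat[OF sc(2) D])
  {
    assume "\<exists>X\<in>unitaries q n. \<exists>Y\<in>unitaries q n. D = X * B * ?s Y"
    then obtain X Y where XY: "X \<in> unitaries q n" "Y \<in> unitaries q n" "D = X * B * ?s Y"
      by blast
    note uY = unitaryD[OF q XY(2)]
    have "?s D * D = Y * (?s B * B) * ?s Y" unfolding XY(3) by (rule gram_transform(1)[OF q B(1) XY(1,2)])
    then have "?s D * D * Y = Y * (?s B * B) * (?s Y * Y)"
      using assoc_mult_mat[OF mult_carrier_mat[OF uY(1) H(1)] uY(2,1)] by simp
    then have "?s D * D * Y = Y * (?s B * B)"
      unfolding uY(4) using right_mult_one_mat[OF mult_carrier_mat[OF uY(1) H(1)]] by simp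
    then show "similar_mat (?s D * D) (?s B * B)"
      by (rule similar_mat_intertwineI[OF H(2,1) uY(1,2,3)])
  next
    assume "similar_mat (?s D * D) (?s B * B)"
    then obtain u where u: "u \<in> carrier_mat n n" "u * ?s u = 1\<^sub>m n" "?s D * D = u * (?s B * B) * ?s u"
      by (rule hermitian_similar_unitary[OF q H conj_trans_gram[OF q B(1)] conj_trans_gram[OF q D]])
    have us: "?s u \<in> carrier_mat n n" using u(1) by simp
    have uu: "?s u * u = 1\<^sub>m n" by (rule mat_mult_left_right_inverse[OF u(1) us u(2)])
    have BB: "B' * B = 1\<^sub>m n" by (rule mat_mult_left_right_inverse[OF B])
    note asc = assoc_mult_mat[of _ n n _ n _ n] and mc [simp] = mult_carrier_mat[of _ n n _ n]
    note ct = conj_trans_mult[OF q, of _ n n _ n]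
    have sBB: "?s B' * ?s B = 1\<^sub>m n"
      unfolding ct[OF B(1,2), symmetric] B(3) by (rule conj_trans_one[OF q])
    define X where "X = D * u * B'"
    have X: "X \<in> carrier_mat n n" using D u(1) B by (simp add: X_def)
    have "X * B * ?s u = D * (u * ((B' * B) * ?s u))"
      unfolding X_def using D u(1) us B(1,2) by (simp only: asc mc)
    also have "\<dots> = D" unfolding BB left_mult_one_mat[OF us] u(2) using D by simp
    finally have DX: "D = X * B * ?s u" ..
    have Du: "?s D * D * u = u * (?s B * B)"
      unfolding u(3) assoc_mult_mat[OF mult_carrier_mat[OF u(1) H(1)] us u(1)] uu
      by (rule right_mult_one_mat[OF mult_carrier_mat[OF u(1) H(1)]])
    have "?s X = ?s B' * (?s u * ?s D)"
      unfolding X_def ct[OF mult_carrier_mat[OF D u(1)] B(2)] ct[OF D u(1)] ..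
    then have "?s X * X = ?s B' * (?s u * ((?s D * D * u) * B'))"
      using D u(1) us B(2) sc by (simp only: X_def asc mc)
    also have "\<dots> = ?s B' * (?s u * (u * (?s B * (B * B'))))"
      unfolding Du using u(1) us B(1,2) sc by (simp only: asc mc)
    also have "\<dots> = 1\<^sub>m n"
      unfolding B(3) right_mult_one_mat[OF sc(1)] mult_cancel_inverse_mat[OF uu us u(1) sc(1)] by (rule sBB)
    finally have "X * ?s X = 1\<^sub>m n" using X by - (rule mat_mult_left_right_inverse, auto)
    then have "X \<in> unitaries q n" by (rule unitaryI[OF q X])
    then show "\<exists>X\<in>unitaries q n. \<exists>Y\<in>unitaries q n. D = X * B * ?s Y"
      by (intro bexI[where x = X] bexI[where x = u] DX unitaryI[OF q u(1,2)])
  }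
qed

end

lemma GU_orbit_iff:
  fixes A :: "'a::{field,finite} mat"
  assumes "A \<in> E"
  shows "A' \<in> orbit (GU TYPE('a) q m \<times>\<times> GU TYPE('a) q n) (GU_act q E) A
    \<longleftrightarrow> (\<exists>X\<in>unitaries q m. \<exists>Y\<in>unitaries q n. A' = X * A * conj_trans q Y)"
  using assms by (auto simp: orbit_def GU_act_def)

theorem corollary1p4:
  fixes q m n :: nat
  assumes "primepow q"
    and "CARD('k::{field,finite}) = q"
    and "CARD('l::{field,finite}) = q\<^sup>2"
    and "1 \<le> m" and "m \<le> n"
  shows "card (orbits (GU TYPE('l) q m \<times>\<times> GU TYPE('l) q n) (carrier_mat m n)
                 (GU_act q (carrier_mat m n)))
       = (\<Sum>i = 0..m. f_orbits TYPE('l) q (m - i) (n - i) * num_conj_classes (GL TYPE('k) i))"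
proof -
  note q = assms(1,3)
  obtain \<iota> :: "'k \<Rightarrow> 'l" where hom: "field_hom \<iota>" and range: "range \<iota> = {x. x ^ q = x}"
    using finite_field_embedding[OF q assms(2)] .
  note emb = q hom range
  let ?G = "\<lambda>a b. GU TYPE('l) q a \<times>\<times> GU TYPE('l) q b" and ?E = "carrier_mat m n :: 'l mat set"
  let ?N = "\<lambda>i. nil_mats TYPE('l) q (m - i) (n - i)"
  let ?conj = "\<lambda>i g. \<lambda>h\<in>carrier (GL TYPE('k) i). g \<otimes>\<^bsub>GL TYPE('k) i\<^esub> h \<otimes>\<^bsub>GL TYPE('k) i\<^esub> inv\<^bsub>GL TYPE('k) i\<^esub> g"
  let ?cl = "\<lambda>i. orbit (GL TYPE('k) i) (?conj i)"
  let ?orb = "\<lambda>i. orbit (?G (m - i) (n - i)) (GU_act q (?N i))"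
  let ?act = "GU_act q ?E"
  \<comment> \<open>The invariant of an orbit: the size of the invertible block, the orbit of the block \<open>C\<close>, and a
    conjugacy class over the small field.\<close>
  define K where "K = (SIGMA i:{0..m}. orbits (?G (m - i) (n - i)) (?N i) (GU_act q (?N i))
    \<times> orbits (GL TYPE('k) i) (carrier (GL TYPE('k) i)) (?conj i))"
  \<comment> \<open>\<open>W\<close> collects a normal form of \<open>A\<close> together with all choices made, among them the inverse \<open>B'\<close> of
    \<open>B\<close> and a matrix \<open>M\<close> over the small field that is similar to \<open>B\<^sup>* B\<close>.\<close>
  define W where "W A i X Y B B' C M \<longleftrightarrow> i \<le> m \<and> X \<in> unitaries q m \<and> Y \<in> unitaries q n \<and>
      B \<in> carrier_mat i i \<and> B' \<in> carrier_mat i i \<and> B * B' = 1\<^sub>m i \<and> C \<in> ?N i \<and> M \<in> carrier (GL TYPE('k) i) \<and>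
      X * A * conj_trans q Y = block_diag B C \<and> similar_mat (conj_trans q B * B) (map_mat \<iota> M)"
    for A i X Y B B' C M
  define R where "R A y \<longleftrightarrow> (\<exists>i X Y B B' C M. W A i X Y B B' C M \<and> y = (i, ?orb i C, ?cl i M))" for A y
  interpret big: group_action "?G m n" ?E ?act by (rule GU_action_carrier_mat[OF q])
  have nil: "group_action (?G a b) (nil_mats TYPE('l) q a b) (GU_act q (nil_mats TYPE('l) q a b))" for a b
    by (rule GU_action_nil_mats[OF q])
  have conj: "group_action (GL TYPE('k) i) (carrier (GL TYPE('k) i)) (?conj i)" for i
    by (rule conjugation_action[OF group_GL])
  have KI: "(i, ?orb i C, ?cl i M) \<in> K" if "i \<le> m" "C \<in> ?N i" "M \<in> carrier (GL TYPE('k) i)" for i C M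
    using that unfolding K_def orbits_def by auto
  have orbit_big: "orbit (?G m n) ?act A = orbit (?G m n) ?act A' \<longleftrightarrow>
      (\<exists>X\<in>unitaries q m. \<exists>Y\<in>unitaries q n. A' = X * A * conj_trans q Y)"
    if "A \<in> ?E" "A' \<in> ?E" for A A'
    using big.orbit_eq_iff[OF that] GU_orbit_iff[OF that(1)] by blast
  have normal: "Z \<in> ?E \<and> orbit (?G m n) ?act A = orbit (?G m n) ?act Z"
    if A: "A \<in> ?E" and X: "X \<in> unitaries q m" and Y: "Y \<in> unitaries q n"
      and Z: "Z = X * A * conj_trans q Y" for A X Y Z
  proof -
    note uX = unitaryD[OF q X] and uY = unitaryD[OF q Y]
    have "Z \<in> ?E" unfolding Z by (rule mult_carrier_mat[OF mult_carrier_mat[OF uX(1) A] uY(2)])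
    then show ?thesis using orbit_big[OF A] X Y Z by blast
  qed
  have "card (orbits (?G m n) ?E ?act) = card K"
  proof (rule card_orbits_eq_card_keys[where R = R])
    fix A assume A: "A \<in> ?E"
    obtain i X Y B B' C where nf: "i \<le> m" "i \<le> n" "X \<in> unitaries q m" "Y \<in> unitaries q n"
      "B \<in> carrier_mat i i" "B' \<in> carrier_mat i i" "B * B' = 1\<^sub>m i" "C \<in> ?N i"
      "X * A * conj_trans q Y = block_diag B C"
      using normal_form_exists[OF q A] .
    obtain M where M: "M \<in> carrier (GL TYPE('k) i)" "similar_mat (conj_trans q B * B) (map_mat \<iota> M)"
      using gram_similar_to_embedded[OF emb nf(5-7)] .
    have "W A i X Y B B' C M" unfolding W_def using nf M by blast
    then have "R A (i, ?orb i C, ?cl i M)" unfolding R_def by blast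
    then show "\<exists>y\<in>K. R A y" using KI[OF nf(1,8) M(1)] by blast
  next
    fix y assume "y \<in> K"
    then obtain i C M where y: "i \<le> m" "C \<in> ?N i" "M \<in> carrier (GL TYPE('k) i)" "y = (i, ?orb i C, ?cl i M)"
      unfolding K_def orbits_def by auto
    obtain B B' where B: "B \<in> carrier_mat i i" "B' \<in> carrier_mat i i" "B * B' = 1\<^sub>m i"
      "similar_mat (conj_trans q B * B) (map_mat \<iota> M)"
      using embedded_similar_to_gram[OF emb y(3)] .
    have C: "C \<in> carrier_mat (m - i) (n - i)" using y(2) by (simp add: nil_mats_def)
    have A: "block_diag B C \<in> ?E" using block_diag_carrier[OF B(1) C] y(1) assms(5) by simp
    have one: "(1\<^sub>m a :: 'l mat) \<in> unitaries q a" for a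
      by (rule unitaryI[OF q]) (simp_all add: conj_trans_one[OF q])
    have "1\<^sub>m m * block_diag B C * conj_trans q (1\<^sub>m n) = block_diag B C"
      using A by (simp add: conj_trans_one[OF q])
    then have "W (block_diag B C) i (1\<^sub>m m) (1\<^sub>m n) B B' C M" unfolding W_def using y B one by blast
    then have "R (block_diag B C) y" unfolding R_def y(4) by blast
    then show "\<exists>A\<in>?E. R A y" using A by blast
  next
    fix A A' y y' assume A: "A \<in> ?E" "A' \<in> ?E" and R: "R A y" "R A' y'"
    obtain i X Y B B' C M where w: "W A i X Y B B' C M" and y: "y = (i, ?orb i C, ?cl i M)"
      using R(1) unfolding R_def by (elim exE conjE)
    obtain j X' Y' D D' F M' where w': "W A' j X' Y' D D' F M'" and y': "y' = (j, ?orb j F, ?cl j M')"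
      using R(2) unfolding R_def by (elim exE conjE)
    have i: "i \<le> m" "i \<le> n" "j \<le> m" "j \<le> n" using w w' assms(5) unfolding W_def by auto
    have B: "B \<in> carrier_mat i i" "B' \<in> carrier_mat i i" "B * B' = 1\<^sub>m i"
      "D \<in> carrier_mat j j" "D' \<in> carrier_mat j j" "D * D' = 1\<^sub>m j"
      and C: "C \<in> ?N i" "F \<in> ?N j" and M: "M \<in> carrier (GL TYPE('k) i)" "M' \<in> carrier (GL TYPE('k) j)"
      and sim: "similar_mat (conj_trans q B * B) (map_mat \<iota> M)" "similar_mat (conj_trans q D * D) (map_mat \<iota> M')"
      and X: "X \<in> unitaries q m" "Y \<in> unitaries q n" "block_diag B C = X * A * conj_trans q Y"
      and X': "X' \<in> unitaries q m" "Y' \<in> unitaries q n" "block_diag D F = X' * A' * conj_trans q Y'"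
      using w w' unfolding W_def by auto
    note nA = normal[OF A(1) X] and nA' = normal[OF A(2) X']
    have "orbit (?G m n) ?act A = orbit (?G m n) ?act A' \<longleftrightarrow>
        (\<exists>X\<in>unitaries q m. \<exists>Y\<in>unitaries q n. block_diag D F = X * block_diag B C * conj_trans q Y)"
      using orbit_big[of "block_diag B C" "block_diag D F"] nA nA' by simp
    also have "\<dots> \<longleftrightarrow> y = y'"
    proof
      assume "\<exists>X\<in>unitaries q m. \<exists>Y\<in>unitaries q n. block_diag D F = X * block_diag B C * conj_trans q Y"
      then obtain X Y where XY: "X \<in> unitaries q m" "Y \<in> unitaries q n"
        "block_diag D F = X * block_diag B C * conj_trans q Y" by blast
      obtain X1 X2 Y1 Y2 where u: "i = j" "X1 \<in> unitaries q i" "X2 \<in> unitaries q (m - i)"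
        "Y1 \<in> unitaries q i" "Y2 \<in> unitaries q (n - i)"
        "D = X1 * B * conj_trans q Y1" "F = X2 * C * conj_trans q Y2"
        using normal_form_unique[OF q B C i XY] .
      have Mc: "M \<in> carrier_mat i i" "M' \<in> carrier_mat i i" using M u(1) by (simp_all add: carrier_GL_iff)
      have "similar_mat (conj_trans q D * D) (conj_trans q B * B)"
        using unitary_equivalent_iff[OF emb B(1-3), of D] B(4) u by blast
      then have "similar_mat (map_mat \<iota> M') (map_mat \<iota> M)"
        using sim similar_mat_sym similar_mat_trans by blast
      then have "similar_mat M' M" using similar_embedding_iff[OF emb Mc] by simp
      then have "?cl i M = ?cl i M'"
        using group_action.orbit_eq_iff[OF conj] conjugacy_orbit_iff M u(1) by blast
      moreover have "?orb i C = ?orb i F"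
        using group_action.orbit_eq_iff[OF nil] GU_orbit_iff[OF C(1)] C u by blast
      ultimately show "y = y'" unfolding y y' using u(1) by simp
    next
      assume "y = y'"
      then have ij: "i = j" and cl: "?cl i M = ?cl i M'" and orb: "?orb i C = ?orb i F"
        unfolding y y' by auto
      have Mc: "M \<in> carrier_mat i i" "M' \<in> carrier_mat i i" using M ij by (simp_all add: carrier_GL_iff)
      have "similar_mat M' M"
        using cl group_action.orbit_eq_iff[OF conj] conjugacy_orbit_iff M ij by blast
      then have "similar_mat (map_mat \<iota> M') (map_mat \<iota> M)" using similar_embedding_iff[OF emb Mc] by simp
      then have "similar_mat (conj_trans q D * D) (conj_trans q B * B)"
        using sim similar_mat_sym similar_mat_trans by blast
      then obtain X1 Y1 where 1: "X1 \<in> unitaries q i" "Y1 \<in> unitaries q i"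
        "D = X1 * B * conj_trans q Y1"
        using unitary_equivalent_iff[OF emb B(1-3), of D] B(4) ij by blast
      have "F \<in> ?orb i C"
        using orb group_action.orbit_eq_iff[OF nil] C ij by blast
      then obtain X2 Y2 where 2: "X2 \<in> unitaries q (m - i)" "Y2 \<in> unitaries q (n - i)"
        "F = X2 * C * conj_trans q Y2"
        using GU_orbit_iff[OF C(1)] by blast
      note u1 = unitaryD[OF q 1(1)] unitaryD[OF q 1(2)] and u2 = unitaryD[OF q 2(1)] unitaryD[OF q 2(2)]
      have Cc: "C \<in> carrier_mat (m - i) (n - i)" using C by (simp add: nil_mats_def)
      have "block_diag D F = block_diag X1 X2 * block_diag B C * conj_trans q (block_diag Y1 Y2)"
        unfolding conj_trans_block_diag[OF q] block_diag_mult[OF u1(1) u2(1) B(1) Cc] 1(3) 2(3)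
        by (rule block_diag_mult[symmetric, OF mult_carrier_mat[OF u1(1) B(1)] mult_carrier_mat[OF u2(1) Cc] u1(6) u2(6)])
      moreover have "block_diag U1 U2 \<in> unitaries q l"
        if "U1 \<in> unitaries q i" "U2 \<in> unitaries q (l - i)" "i \<le> l" for U1 U2 :: "'l mat" and l
      proof (rule unitaryI[OF q])
        note v1 = unitaryD[OF q that(1)] and v2 = unitaryD[OF q that(2)]
        show "block_diag U1 U2 \<in> carrier_mat l l" using block_diag_carrier[OF v1(1) v2(1)] that(3) by simp
        show "block_diag U1 U2 * conj_trans q (block_diag U1 U2) = 1\<^sub>m l"
          unfolding conj_trans_block_diag[OF q] block_diag_mult[OF v1(1) v2(1) v1(2) v2(2)] v1(3) v2(3)
            block_diag_one using that(3) by simp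
      qed
      ultimately show "\<exists>X\<in>unitaries q m. \<exists>Y\<in>unitaries q n.
          block_diag D F = X * block_diag B C * conj_trans q Y"
        using 1(1,2) 2(1,2) i by blast
    qed
    finally show "orbit (?G m n) ?act A = orbit (?G m n) ?act A' \<longleftrightarrow> y = y'" .
  qed
  also have "\<dots> = (\<Sum>i = 0..m. f_orbits TYPE('l) q (m - i) (n - i) * num_conj_classes (GL TYPE('k) i))"
  proof -
    have "finite (carrier (GL TYPE('k) i))" for i
      by (rule finite_subset[OF _ finite_carrier_mat[of i i]]) (auto simp: carrier_GL)
    moreover have "finite (?N i)" for i
      by (rule finite_subset[OF _ finite_carrier_mat[of "m - i" "n - i"]]) (auto simp: nil_mats_def)
    ultimately show ?thesis
      unfolding K_def f_orbits_def num_conj_classes_def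
      by (subst card_SigmaI) (auto simp: orbits_def card_cartesian_product)
  qed
  finally show ?thesis .
qed

end
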